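(* Let $\mathcal A$ be a cluster algebra of type $\mathbb A$, $\mathbb B$ or $\mathbb C$, and let $\mathbf x$ be an arbitrary cluster of $\mathcal A$. Then different cluster monomials of $\mathcal A$ have different denominator vectors with respect to $\mathbf x$.
   Context: Cluster algebras are taken with trivial coefficients. Write $[b]_+=\max(b,0)$. Let $\mathcal F$ be the field of rational functions in $n$ variables. An $n\times n$ integer matrix $B$ is skew-symmetrizable if $SB$ is skew-symmetric for some diagonal matrix $S$ with positive integer diagonal entries. A labeled seed is a pair $(B,\mathbf x)$ with $B=(b_{ij})$ skew-symmetrizable and $\mathbf x=(x_1,\dots,x_n)$ a free generating set of $\mathcal F$. The mutation $\mu_k(B,\mathbf x)=(B',\mathbf x')$ is given by $b'_{ij}=-b_{ij}$ if $i=k$ or $j=k$, and $b'_{ij}=b_{ij}+[b_{ik}]_+b_{kj}+b_{ik}[-b_{kj}]_+$ otherwise; $x'_j=x_j$ for $j\ne k$ and $x'_k=x_k^{-1}\big(\prod_i x_i^{[b_{ik}]_+}+\prod_i x_i^{[-b_{ik}]_+}\big)$. Let $\mathbb T_n$ be the $n$-regular tree with edges labeled by $1,\dots,n$ so that the edges at each vertex have distinct labels. Assigning a seed $(B,\mathbf x)$ to a root vertex $t_0$ determines seeds $\Sigma_t=(B_t,\mathbf x_t)$, $\mathbf x_t=(x_{1;t},\dots,x_{n;t})$, $t\in\mathbb T_n$, such that seeds at vertices joined by an edge labeled $k$ are related by $\mu_k$. The $x_{i;t}$ are the cluster variables, the $\mathbf x_t$ the clusters, and the cluster algebra $\mathcal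 A$ is the $\mathbb Z$-subalgebra of $\mathcal F$ generated by all cluster variables. A cluster monomial is a monomial (non-negative exponents) in cluster variables all belonging to one cluster. Type: the Cartan counterpart of $B=(b_{ij})$ is the matrix $A(B)=(c_{ij})$ with $c_{ii}=2$ and $c_{ij}=-|b_{ij}|$ for $i\ne j$. $\mathcal A$ is of type $\mathbb A$ (resp. $\mathbb B$, $\mathbb C$) if there is $t\in\mathbb T_n$ such that $A(B_t)$ is a Cartan matrix of type $\mathbb A_n$ (resp. $\mathbb B_n$, $\mathbb C_n$). Denominator vectors: fix a cluster $\mathbf x=(x_1,\dots,x_n)$ (any cluster may be chosen as the initial one). By the Laurent phenomenon every cluster variable $z$ can be written uniquely as $z=N(x_1,\dots,x_n)/(x_1^{d_1}\cdots x_n^{d_n})$ with $d_i\in\mathbb Z$ and $N$ a polynomial with integer coefficients not divisible by any $x_i$; the denominator vector of $z$ with respect to $\mathbf x$ is $\mathbf d(z)=(d_1,\dots,d_n)^{\rm tr}$ (so $\mathbf d(x_i)=-\mathbf e_i$). For a cluster monomial $\mathbf m=x_{1;t}^{k_1}\cdots x_{n;t}^{k_n}$, $\mathbf d(\mathbf m)=\sum_j k_j\mathbf d(x_{j;t})$. *)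

theory Defs
  imports
    "HOL-Analysis.Finite_Cartesian_Product"
    "HOL-Library.Poly_Mapping"
    "HOL-Computational_Algebra.Fraction_Field"
begin

text \<open>
  The rank is \<open>n = CARD('n)\<close>. The linear order on the index type is there only because the
  library needs it to make polynomial rings integral domains; no definition below refers to it.
  The field \<open>'n ratfun\<close> is the fraction field of the ring of integer polynomials in the
  variables indexed by \<open>'n\<close>, that is, the field of rational functions over the rationals.
\<close>

type_synonym 'n intpoly = "('n \<Rightarrow>\<^sub>0 nat) \<Rightarrow>\<^sub>0 int"

type_synonym 'n ratfun = "'n intpoly fract"

type_synonym 'n tuple = "'n ratfun ^ 'n"

type_synonym 'n int_matrix = "int ^ 'n ^ 'n"

type_synonym 'n seed = "'n int_matrix \<times> 'n tuple"

definition poly_var :: "'n \<Rightarrow> 'n intpoly" where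
  "poly_var i = Poly_Mapping.single (Poly_Mapping.single i 1) 1"

definition poly_subst :: "'n::{finite,linorder} intpoly \<Rightarrow> 'n tuple \<Rightarrow> 'n ratfun" where
  "poly_subst p x =
     (\<Sum>m\<in>Poly_Mapping.keys p.
        of_int (Poly_Mapping.lookup p m) * (\<Prod>i\<in>UNIV. (x $ i) ^ Poly_Mapping.lookup m i))"

text \<open>
  Clearing denominators, algebraic independence over the rationals and generation as a field
  over the rationals can both be expressed with integer polynomials.
\<close>

definition free_generating :: "'n::{finite,linorder} tuple \<Rightarrow> bool" where
  "free_generating x \<longleftrightarrow>
     (\<forall>p. poly_subst p x = 0 \<longrightarrow> p = 0) \<and>
     (\<forall>f. \<exists>p q. poly_subst q x \<noteq> 0 \<and> f = poly_subst p x / poly_subst q x)"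

definition skew_symmetrizable :: "'n::finite int_matrix \<Rightarrow> bool" where
  "skew_symmetrizable B \<longleftrightarrow>
     (\<exists>S :: 'n int_matrix.
        (\<forall>i. S $ i $ i > 0) \<and> (\<forall>i j. i \<noteq> j \<longrightarrow> S $ i $ j = 0) \<and>
        transpose (S ** B) = - (S ** B))"

definition labeled_seed :: "'n::{finite,linorder} seed \<Rightarrow> bool" where
  "labeled_seed \<Sigma> \<longleftrightarrow> skew_symmetrizable (fst \<Sigma>) \<and> free_generating (snd \<Sigma>)"

definition pos_part :: "int \<Rightarrow> int" where
  "pos_part b = max b 0"

definition mutate_matrix :: "'n \<Rightarrow> 'n::finite int_matrix \<Rightarrow> 'n int_matrix" where
  "mutate_matrix k B =
     (\<chi> i j. if i = k \<or> j = k then - B $ i $ j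
            else B $ i $ j + pos_part (B $ i $ k) * B $ k $ j + B $ i $ k * pos_part (- B $ k $ j))"

definition mutate_cluster ::
  "'n \<Rightarrow> 'n int_matrix \<Rightarrow> 'n::{finite,linorder} tuple \<Rightarrow> 'n tuple" where
  "mutate_cluster k B x =
     (\<chi> j. if j = k
          then inverse (x $ k) *
                 ((\<Prod>i\<in>UNIV. (x $ i) ^ nat (pos_part (B $ i $ k))) +
                  (\<Prod>i\<in>UNIV. (x $ i) ^ nat (pos_part (- B $ i $ k))))
          else x $ j)"

definition mutate :: "'n \<Rightarrow> 'n::{finite,linorder} seed \<Rightarrow> 'n seed" where
  "mutate k \<Sigma> = (mutate_matrix k (fst \<Sigma>), mutate_cluster k (fst \<Sigma>) (snd \<Sigma>))"

text \<open>
  A vertex of the \<open>n\<close>-regular tree is encoded as the sequence of edge labels on the path from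
  the root \<open>[]\<close> to it. These are exactly the words without two equal adjacent letters, and the
  edges labeled \<open>k\<close> join \<open>w\<close> and \<open>w @ [k]\<close>.
\<close>

definition regular_tree :: "'n list set" where
  "regular_tree = {w. distinct_adj w}"

definition seed_at :: "'n::{finite,linorder} seed \<Rightarrow> 'n list \<Rightarrow> 'n seed" where
  "seed_at \<Sigma> t = fold mutate t \<Sigma>"

abbreviation matrix_at :: "'n::{finite,linorder} seed \<Rightarrow> 'n list \<Rightarrow> 'n int_matrix" where
  "matrix_at \<Sigma> t \<equiv> fst (seed_at \<Sigma> t)"

abbreviation cluster_at :: "'n::{finite,linorder} seed \<Rightarrow> 'n list \<Rightarrow> 'n tuple" where
  "cluster_at \<Sigma> t \<equiv> snd (seed_at \<Sigma> t)"

definition cartan_counterpart :: "'n int_matrix \<Rightarrow> 'n::finite int_matrix" where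
  "cartan_counterpart B = (\<chi> i j. if i = j then 2 else - \<bar>B $ i $ j\<bar>)"

text \<open>
  Standard Cartan matrices with rows and columns numbered \<open>1, \<dots>, n\<close>, in Bourbaki's convention.
  Some authors exchange \<open>B\<close> and \<open>C\<close> (transposing the matrices). Small ranks are not excluded:
  \<open>B\<close> and \<open>C\<close> agree with \<open>A\<close> for \<open>n = 1\<close>, and with each other for \<open>n = 2\<close> up to renumbering.
\<close>

definition cartan_A :: "nat \<Rightarrow> nat \<Rightarrow> nat \<Rightarrow> int" where
  "cartan_A n i j = (if i = j then 2 else if i = j + 1 \<or> j = i + 1 then - 1 else 0)"

definition cartan_B :: "nat \<Rightarrow> nat \<Rightarrow> nat \<Rightarrow> int" where
  "cartan_B n i j = (if i + 1 = n \<and> j = n then - 2 else cartan_A n i j)"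

definition cartan_C :: "nat \<Rightarrow> nat \<Rightarrow> nat \<Rightarrow> int" where
  "cartan_C n i j = (if i = n \<and> j + 1 = n then - 2 else cartan_A n i j)"

text \<open>A Cartan matrix is of a given type if it is the standard one up to numbering the indices.\<close>

definition is_cartan_matrix_of :: "(nat \<Rightarrow> nat \<Rightarrow> nat \<Rightarrow> int) \<Rightarrow> 'n::finite int_matrix \<Rightarrow> bool" where
  "is_cartan_matrix_of C A \<longleftrightarrow>
     (\<exists>\<sigma>. bij_betw \<sigma> (UNIV :: 'n set) {1..CARD('n)} \<and>
          (\<forall>i j. A $ i $ j = C CARD('n) (\<sigma> i) (\<sigma> j)))"

definition cluster_type :: "(nat \<Rightarrow> nat \<Rightarrow> nat \<Rightarrow> int) \<Rightarrow> 'n::{finite,linorder} seed \<Rightarrow> bool" where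
  "cluster_type C \<Sigma> \<longleftrightarrow>
     (\<exists>t\<in>regular_tree. is_cartan_matrix_of C (cartan_counterpart (matrix_at \<Sigma> t)))"

definition cluster_monomial :: "'n::{finite,linorder} tuple \<Rightarrow> (nat, 'n) vec \<Rightarrow> 'n ratfun" where
  "cluster_monomial y k = (\<Prod>j\<in>UNIV. (y $ j) ^ (k $ j))"

definition denominator_vector :: "'n::{finite,linorder} tuple \<Rightarrow> 'n ratfun \<Rightarrow> (int, 'n) vec" where
  "denominator_vector x z =
     (THE d. \<exists>N :: 'n intpoly.
        (\<forall>i. \<not> poly_var i dvd N) \<and>
        z = poly_subst N x / (\<Prod>i\<in>UNIV. (x $ i) powi (d $ i)))"

text \<open>
  The denominator vector, with respect to \<open>x\<close>, of the cluster monomial with exponents \<open>k\<close> in the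
  cluster \<open>y\<close>.
\<close>

definition monomial_denominator_vector ::
  "'n::{finite,linorder} tuple \<Rightarrow> 'n tuple \<Rightarrow> (nat, 'n) vec \<Rightarrow> (int, 'n) vec" where
  "monomial_denominator_vector x y k =
     (\<Sum>j\<in>UNIV. int (k $ j) *s denominator_vector x (y $ j))"

end

theory Submission
  imports Defs
begin

text \<open>
  In types A, B and C the seeds are the triangulations of a polygon, invariant under the half turn
  for B and C. Cluster variables are lengths of diagonals, realised as determinants of plane
  vectors; for B and C the half turn acts on these vectors by a matrix of trace 0 and 2.
  The Ptolemy relation, applied to a triangle of the initial triangulation, shows by induction on
  the number of crossings that a length is a Laurent polynomial whose numerator is positive on
  each face \<open>x\<^sub>i = 0\<close>, and that its denominator exponents are crossing numbers up to fixed factors.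

  A cluster monomial is a weighted family of pairwise noncrossing diagonals. Its crossing numbers
  with the sides and one diagonal of a quadrilateral determine the one with the other diagonal.
  So if two cluster monomials have the same denominator vector with respect to one cluster, then
  they have the same one with respect to every cluster. With respect to the cluster of the first
  monomial all entries are non-positive, and this forces the second monomial to use
  the same diagonals with the same exponents.
\<close>


section \<open>Laurent polynomials and denominators\<close>

text \<open>Chords and whole monomials obey different rules. With the initial chord fixed, the
  crossing numbers of single chords satisfy the tropical Ptolemy relation
  (\<open>cr_tropical\<close>), so denominators can be computed by induction. With the monomial
  fixed and the initial chord flipped, that relation can fail: curves may fan out of a corner across
  both opposite sides, and copies of an initial chord count negatively. It is the noncrossing
  condition that still lets five numbers determine the sixth, and \<open>flip_count\<close> records
  how. What matters is only that it is a function, so that equality of two families of crossing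
  numbers passes through every flip.

  Mutation is reversible, so the polygon model may be anchored at any one seed. The Dynkin path is
  first oriented linearly, because the fan of diagonals at one vertex (with its image under the half
  turn) has exactly this quiver.

  The trace 2 of type C comes from the length of a diameter, the quadratic form A^2 + t A B + B^2 up
  to a factor: for t = 2 it is a square, and its root is the cluster variable.\<close>

definition eval_poly :: "('n::finite \<Rightarrow> 'a::comm_ring_1) \<Rightarrow> 'n intpoly \<Rightarrow> 'a" where
  "eval_poly \<phi> p =
     (\<Sum>m\<in>Poly_Mapping.keys p.
        of_int (Poly_Mapping.lookup p m) * (\<Prod>i\<in>UNIV. \<phi> i ^ Poly_Mapping.lookup m i))"

lemma poly_subst_eval_poly: "poly_subst p x = eval_poly (($) x) p"
  by (simp add: poly_subst_def eval_poly_def)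

lemma eval_poly_superset:
  assumes "finite K" "Poly_Mapping.keys p \<subseteq> K"
  shows "eval_poly \<phi> p =
     (\<Sum>m\<in>K. of_int (Poly_Mapping.lookup p m) * (\<Prod>i\<in>UNIV. \<phi> i ^ Poly_Mapping.lookup m i))"
  unfolding eval_poly_def
  by (rule sum.mono_neutral_left) (use assms in \<open>auto simp: in_keys_iff\<close>)

lemma eval_poly_0 [simp]: "eval_poly \<phi> 0 = 0"
  by (simp add: eval_poly_def)

lemma eval_poly_add: "eval_poly \<phi> (p + q) = eval_poly \<phi> p + eval_poly \<phi> q"
proof -
  let ?K = "Poly_Mapping.keys p \<union> Poly_Mapping.keys q"
  have "Poly_Mapping.keys (p + q) \<subseteq> ?K"
    by (rule Poly_Mapping.keys_add)
  then show ?thesis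
    by (simp add: eval_poly_superset[of ?K] lookup_add algebra_simps sum.distrib)
qed

lemma eval_poly_sum: "eval_poly \<phi> (sum f A) = (\<Sum>a\<in>A. eval_poly \<phi> (f a))"
  by (induction A rule: infinite_finite_induct) (auto simp: eval_poly_add)

lemma eval_poly_single:
  "eval_poly \<phi> (Poly_Mapping.single m c) = of_int c * (\<Prod>i\<in>UNIV. \<phi> i ^ Poly_Mapping.lookup m i)"
  by (subst eval_poly_superset[of "{m}"]) (auto simp: keys_single)

lemma poly_as_sum:
  "p = (\<Sum>m\<in>Poly_Mapping.keys p. Poly_Mapping.single m (Poly_Mapping.lookup p m))"
  by (rule poly_mapping_eqI) (auto simp: lookup_sum lookup_single when_def in_keys_iff)

lemma eval_poly_mult: "eval_poly \<phi> (p * q) = eval_poly \<phi> p * eval_poly \<phi> q"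
proof -
  let ?s = Poly_Mapping.single and ?l = Poly_Mapping.lookup and ?k = Poly_Mapping.keys
  have "eval_poly \<phi> (p * q) =
      eval_poly \<phi> ((\<Sum>m\<in>?k p. ?s m (?l p m)) * (\<Sum>m\<in>?k q. ?s m (?l q m)))"
    using poly_as_sum[of p] poly_as_sum[of q] by simp
  also have "\<dots> = (\<Sum>m\<in>?k p. \<Sum>m'\<in>?k q.
      (of_int (?l p m) * (\<Prod>i\<in>UNIV. \<phi> i ^ ?l m i)) * (of_int (?l q m') * (\<Prod>i\<in>UNIV. \<phi> i ^ ?l m' i)))"
    by (simp add: sum_product eval_poly_sum mult_single eval_poly_single lookup_add power_add
        prod.distrib algebra_simps)
  also have "\<dots> = eval_poly \<phi> p * eval_poly \<phi> q"
    by (simp add: sum_product eval_poly_def)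
  finally show ?thesis .
qed

lemma eval_poly_1 [simp]: "eval_poly \<phi> 1 = 1"
  using eval_poly_single[of \<phi> 0 1] by simp

lemma eval_poly_prod: "eval_poly \<phi> (prod f A) = (\<Prod>a\<in>A. eval_poly \<phi> (f a))"
  by (induction A rule: infinite_finite_induct) (auto simp: eval_poly_mult)

lemma eval_poly_power: "eval_poly \<phi> (p ^ n) = eval_poly \<phi> p ^ n"
  by (induction n) (auto simp: eval_poly_mult)

lemma eval_poly_var [simp]: "eval_poly \<phi> (poly_var i) = \<phi> i"
proof -
  have "\<phi> j ^ (Poly_Mapping.lookup (Poly_Mapping.single i 1) j) = (if j = i then \<phi> i else 1)" for j
    by (auto simp: lookup_single)
  then have "(\<Prod>j\<in>UNIV. \<phi> j ^ (Poly_Mapping.lookup (Poly_Mapping.single i 1) j)) = \<phi> i"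
    by simp
  then show ?thesis
    by (simp add: poly_var_def eval_poly_single del: lookup_single)
qed

lemma eval_poly_uminus: "eval_poly \<phi> (- p) = - eval_poly \<phi> p"
  using eval_poly_add[of \<phi> p "- p"] by (simp add: eq_neg_iff_add_eq_0 add.commute)

lemma eval_poly_diff: "eval_poly \<phi> (p - q) = eval_poly \<phi> p - eval_poly \<phi> q"
  using eval_poly_add[of \<phi> p "- q"] by (simp add: eval_poly_uminus)

lemma eval_poly_of_nat: "eval_poly \<phi> (of_nat n) = of_nat n"
  by (induction n) (auto simp: eval_poly_add)

lemma eval_poly_of_int: "eval_poly \<phi> (of_int n) = of_int n"
  by (cases n rule: int_diff_cases) (auto simp: eval_poly_diff eval_poly_of_nat)

text \<open>The property carried along mutations: evaluation at the cluster is injective, so Laurent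
  expansions are unique.\<close>

definition alg_indep :: "'n::{finite,linorder} tuple \<Rightarrow> bool" where
  "alg_indep x \<longleftrightarrow> (\<forall>p. eval_poly (($) x) p = 0 \<longrightarrow> p = 0)"

lemma free_generating_imp_alg_indep: "free_generating x \<Longrightarrow> alg_indep x"
  by (simp add: free_generating_def alg_indep_def poly_subst_eval_poly)

lemma alg_indep_eqD:
  assumes "alg_indep x" "eval_poly (($) x) p = eval_poly (($) x) q"
  shows "p = q"
proof -
  have "eval_poly (($) x) (p - q) = 0"
    using assms by (simp add: eval_poly_diff)
  then show ?thesis
    using assms unfolding alg_indep_def by auto
qed

lemma poly_var_nonzero [simp]: "poly_var (i :: 'n::finite) \<noteq> 0"
  using eval_poly_var[of "\<lambda>_. 1::int" i] by (metis eval_poly_0 zero_neq_one)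

lemma alg_indep_nonzero:
  assumes "alg_indep x" shows "x $ i \<noteq> 0"
  using assms alg_indep_eqD[of x "poly_var i" 0] by auto

lemma alg_indep_eval_nonzero:
  assumes "alg_indep x" "eval_poly (\<lambda>_. 1::int) p \<noteq> 0"
  shows "eval_poly (($) x) p \<noteq> 0"
  using assms unfolding alg_indep_def by (metis eval_poly_0)

text \<open>The relation x_k y_k = E is symmetric in the two clusters. Replacing variable k by E
  over itself and clearing denominators turns a relation p for y into a polynomial q with q(x) =
  x_k^r p(y) = 0, so q = 0. Then 0 = q(y) = y_k^r p(x), and p = 0.\<close>

lemma alg_indep_exchange:
  fixes x :: "'n::{finite,linorder} tuple"
  assumes x: "alg_indep x"
    and y: "\<And>i. i \<noteq> k \<Longrightarrow> y $ i = x $ i" "y $ k = inverse (x $ k) * eval_poly (($) x) E"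
    and E: "eval_poly (($) y) E = eval_poly (($) x) E" "eval_poly (($) x) E \<noteq> 0"
  shows "alg_indep y"
  unfolding alg_indep_def
proof (intro allI impI)
  fix p assume p: "eval_poly (($) y) p = 0"
  let ?l = Poly_Mapping.lookup and ?k = "Poly_Mapping.keys p"
  define r where "r = Max (insert 0 ((\<lambda>m. ?l m k) ` ?k))"
  have r: "?l m k \<le> r" if "m \<in> ?k" for m
    unfolding r_def by (rule Max_ge) (use that in auto)
  \<comment> \<open>The monomial \<open>m\<close> with variable k replaced by E over itself, times
    its r-th power. As \<open>r\<close> bounds the exponents of k, the subtraction is exact.\<close>
  define h where "h = (\<lambda>m. (\<Prod>i\<in>UNIV-{k}. poly_var i ^ ?l m i) * E ^ ?l m k * poly_var k ^ (r - ?l m k))"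
  define q where "q = (\<Sum>m\<in>?k. of_int (?l p m) * h m)"
  let ?e = "eval_poly (($) x) E"
  have xk: "x $ k \<noteq> 0" using x by (rule alg_indep_nonzero)
  have yk: "y $ k \<noteq> 0" using y(2) E(2) xk by auto
  have ex: "x $ k * y $ k = ?e" using y(2) xk by simp
  have spl: "(\<Prod>i\<in>UNIV. z i) = (\<Prod>i\<in>UNIV-{k}. z i) * z k" for z :: "'n \<Rightarrow> 'n ratfun"
    by (simp add: prod.remove[of UNIV k] mult.commute)
  have h: "eval_poly (($) z) (h m) =
      (\<Prod>i\<in>UNIV-{k}. z $ i ^ ?l m i) * eval_poly (($) z) E ^ ?l m k * z $ k ^ (r - ?l m k)" for z m
    by (simp add: h_def eval_poly_mult eval_poly_prod eval_poly_power)
  have "eval_poly (($) x) (h m) = x $ k ^ r * (\<Prod>i\<in>UNIV. y $ i ^ ?l m i)" if "m \<in> ?k" for m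
  proof -
    have "?e ^ ?l m k * x $ k ^ (r - ?l m k) = x $ k ^ r * y $ k ^ ?l m k"
      using r[OF that] by (simp add: ex[symmetric] power_mult_distrib mult.commute
         mult.left_commute power_add[symmetric])
    then show ?thesis
      by (simp add: h spl y(1) mult.assoc)
  qed
  then have "eval_poly (($) x) q = x $ k ^ r * eval_poly (($) y) p"
    by (simp add: q_def eval_poly_sum eval_poly_mult eval_poly_of_int eval_poly_def[of _ p]
        sum_distrib_left mult.left_commute)
  then have q: "q = 0"
    using p x unfolding alg_indep_def by simp
  have "eval_poly (($) y) (h m) = y $ k ^ r * (\<Prod>i\<in>UNIV. x $ i ^ ?l m i)" if "m \<in> ?k" for m
  proof -
    have "?e ^ ?l m k * y $ k ^ (r - ?l m k) = y $ k ^ r * x $ k ^ ?l m k"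
      using r[OF that] by (simp add: ex[symmetric] power_mult_distrib mult.commute
         mult.left_commute power_add[symmetric])
    then show ?thesis
      by (simp add: h spl y(1) E(1) mult.assoc)
  qed
  then have "eval_poly (($) y) q = y $ k ^ r * eval_poly (($) x) p"
    by (simp add: q_def eval_poly_sum eval_poly_mult eval_poly_of_int eval_poly_def[of _ p]
        sum_distrib_left mult.left_commute)
  then have "eval_poly (($) x) p = 0"
    using q yk by simp
  then show "p = 0"
    using x unfolding alg_indep_def by simp
qed

text \<open>The point of the face x_i = 0 with all other coordinates 1; a nonzero value certifies
  that x_i is no divisor. Such integer evaluations are why \<open>eval_poly\<close> admits every
  commutative ring.\<close>

definition eval_face :: "'n \<Rightarrow> 'n::finite intpoly \<Rightarrow> int" where
  "eval_face i = eval_poly (\<lambda>j. if j = i then 0 else 1)"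

definition monomial :: "('n \<Rightarrow> nat) \<Rightarrow> 'n::finite intpoly" where
  "monomial e = (\<Prod>i\<in>UNIV. poly_var i ^ e i)"

lemma eval_monomial: "eval_poly \<phi> (monomial e) = (\<Prod>i\<in>UNIV. \<phi> i ^ e i)"
  by (simp add: monomial_def eval_poly_prod eval_poly_power)

lemma eval_face_monomial: "eval_face i (monomial e) = (if e i = 0 then 1 else 0)"
proof -
  have "(\<Prod>j\<in>UNIV. (if j = i then 0 else 1 :: int) ^ e j) = (\<Prod>j\<in>UNIV. if j = i then 0 ^ e i else 1)"
    by (intro prod.cong) auto
  then show ?thesis
    by (simp add: eval_face_def eval_monomial)
qed

lemma eval_face_dvd: "poly_var i dvd p \<Longrightarrow> eval_face i p = 0"
  by (auto simp: eval_face_def eval_poly_mult)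

text \<open>Positive face values imply that no x_i divides the numerator and, unlike mere
  indivisibility, they survive addition.\<close>

definition laurent_denom :: "'n::{finite,linorder} tuple \<Rightarrow> 'n ratfun \<Rightarrow> ('n \<Rightarrow> int) \<Rightarrow> bool" where
  "laurent_denom x z d \<longleftrightarrow>
     (\<exists>N. (\<forall>i. eval_face i N > 0) \<and> z = eval_poly (($) x) N / (\<Prod>i\<in>UNIV. (x $ i) powi d i))"

lemma monomial_single:
  fixes e :: "'n::finite \<Rightarrow> nat"
  shows "monomial e = Poly_Mapping.single (\<Sum>i\<in>UNIV. Poly_Mapping.single i (e i)) 1"
proof -
  have "poly_var i ^ n = Poly_Mapping.single (Poly_Mapping.single i n) 1" for i :: 'n and n
    by (induction n) (auto simp: poly_var_def mult_single single_add[symmetric])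
  moreover have "(\<Prod>i\<in>A. Poly_Mapping.single (Poly_Mapping.single i (e i)) (1::int)) =
      Poly_Mapping.single (\<Sum>i\<in>A. Poly_Mapping.single i (e i)) 1" for A :: "'n set"
    by (induction A rule: infinite_finite_induct) (auto simp: mult_single)
  ultimately show ?thesis by (simp add: monomial_def)
qed

text \<open>Each exponent vector of \<open>p\<close>, shifted by \<open>e\<close>, is one of
  \<open>q\<close> shifted by \<open>f\<close>; in coordinate i, where \<open>e\<close> vanishes and
  \<open>f\<close> does not, it must be positive.\<close>

lemma poly_var_dvd_of_mult_monomial:
  fixes p q :: "'n::{finite,linorder} intpoly"
  assumes eq: "p * monomial e = q * monomial f" and e: "e i = 0" and f: "f i > 0"
  shows "poly_var i dvd p"
proof -
  let ?l = Poly_Mapping.lookup and ?s = Poly_Mapping.single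
  define E where "E = (\<Sum>i\<in>UNIV. ?s i (e i))"
  define F where "F = (\<Sum>i\<in>UNIV. ?s i (f i))"
  have l: "?l E j = e j" "?l F j = f j" for j
    by (auto simp: E_def F_def lookup_sum lookup_single when_def)
  have key: "?l m i > 0" if m: "m \<in> Poly_Mapping.keys p" for m
  proof -
    have "m + E \<in> Poly_Mapping.keys (p * ?s E 1)"
    proof -
      have "p * ?s E 1 = (\<Sum>m\<in>Poly_Mapping.keys p. ?s (m + E) (?l p m))"
        by (subst poly_as_sum[of p]) (simp add: sum_distrib_right mult_single)
      then have "?l (p * ?s E 1) (m + E) = (\<Sum>m'\<in>Poly_Mapping.keys p. ?l p m' when m' = m)"
        by (simp add: lookup_sum lookup_single)
      also have "\<dots> = ?l p m" using m by (simp add: when_def)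
      finally show ?thesis using m by (simp add: in_keys_iff)
    qed
    then have "m + E \<in> Poly_Mapping.keys (q * ?s F 1)"
      using eq by (simp add: monomial_single E_def F_def)
    then obtain m' where "m + E = m' + F"
      using keys_mult[of q "?s F 1"] by (auto split: if_splits)
    then have "?l m i + e i = ?l m' i + f i"
      by (metis l lookup_add)
    then show ?thesis using e f by simp
  qed
  have "p = poly_var i * (\<Sum>m\<in>Poly_Mapping.keys p. ?s (m - ?s i 1) (?l p m))"
  proof -
    have m: "?s i 1 + (m - ?s i 1) = m" if "m \<in> Poly_Mapping.keys p" for m
      by (rule poly_mapping_eqI)
        (use key[OF that] in \<open>auto simp: lookup_add lookup_minus lookup_single when_def\<close>)
    have "poly_var i * (\<Sum>m\<in>Poly_Mapping.keys p. ?s (m - ?s i 1) (?l p m)) =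
        (\<Sum>m\<in>Poly_Mapping.keys p. ?s (?s i 1 + (m - ?s i 1)) (?l p m))"
      by (simp add: poly_var_def sum_distrib_left mult_single)
    also have "\<dots> = (\<Sum>m\<in>Poly_Mapping.keys p. ?s m (?l p m))"
      by (intro sum.cong refl) (simp only: m)
    also have "\<dots> = p"
      by (rule poly_as_sum[symmetric])
    finally show ?thesis ..
  qed
  then show ?thesis by (metis dvd_triv_left)
qed

text \<open>Cross-multiplying by the positive and negative parts of \<open>e - d\<close> leaves
  monomials \<open>u\<close> and \<open>v\<close> without a common variable. A difference in
  exponent i would then make x_i divide one of the numerators.\<close>

lemma laurent_denom_unique:
  fixes x :: "'n::{finite,linorder} tuple"
  assumes x: "alg_indep x"
    and M: "\<And>i. \<not> poly_var i dvd M" "z = eval_poly (($) x) M / (\<Prod>i\<in>UNIV. (x $ i) powi d i)"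
    and N: "\<And>i. \<not> poly_var i dvd N" "z = eval_poly (($) x) N / (\<Prod>i\<in>UNIV. (x $ i) powi e i)"
  shows "d = e"
proof
  fix i
  have nz: "x $ i \<noteq> 0" for i using x by (rule alg_indep_nonzero)
  have pnz: "(\<Prod>i\<in>UNIV. (x $ i) powi g i) \<noteq> 0" for g using nz by simp
  have cross: "m * U = n * V" if "m / D = n / E" "D \<noteq> 0" "E \<noteq> 0" "E * V = D * U"
    for m n U V D E :: "'n ratfun"
  proof -
    have "(m * U) * E = (n * D) * U" using that by (simp add: field_simps)
    also have "\<dots> = (n * V) * E" using that(4) by (simp add: mult_ac)
    finally show ?thesis using that(3) by simp
  qed
  define u where "u i = nat (e i - d i)" for i
  define v where "v i = nat (d i - e i)" for i
  have "(\<Prod>i\<in>UNIV. (x $ i) powi e i) * (\<Prod>i\<in>UNIV. x $ i ^ v i) =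
      (\<Prod>i\<in>UNIV. (x $ i) powi d i) * (\<Prod>i\<in>UNIV. x $ i ^ u i)"
    unfolding prod.distrib[symmetric]
  proof (intro prod.cong refl)
    fix j
    have "x $ j powi e j * x $ j ^ v j = x $ j powi (e j + int (v j))"
      "x $ j powi d j * x $ j ^ u j = x $ j powi (d j + int (u j))"
      using nz by (simp_all add: power_int_add)
    moreover have "e j + int (v j) = d j + int (u j)"
      by (auto simp: u_def v_def)
    ultimately show "x $ j powi e j * x $ j ^ v j = x $ j powi d j * x $ j ^ u j" by simp
  qed
  then have "eval_poly (($) x) M * (\<Prod>i\<in>UNIV. x $ i ^ u i) = eval_poly (($) x) N * (\<Prod>i\<in>UNIV. x $ i ^ v i)"
    by (rule cross[OF trans[OF M(2)[symmetric] N(2)] pnz pnz])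
  then have eq: "M * monomial u = N * monomial v"
    by (intro alg_indep_eqD[OF x]) (simp add: eval_poly_mult eval_monomial)
  show "d i = e i"
  proof (rule linorder_cases[of "d i" "e i"])
    assume "d i < e i"
    then have "u i > 0" "v i = 0" by (auto simp: u_def v_def)
    then show ?thesis using poly_var_dvd_of_mult_monomial[OF eq[symmetric]] N(1) by auto
  next
    assume "d i > e i"
    then have "v i > 0" "u i = 0" by (auto simp: u_def v_def)
    then show ?thesis using poly_var_dvd_of_mult_monomial[OF eq] M(1) by auto
  qed
qed

lemma denominator_vector_eq:
  assumes x: "alg_indep x" and z: "laurent_denom x z d"
  shows "denominator_vector x z = (\<chi> i. d i)"
proof -
  obtain N where N: "\<And>i. eval_face i N > 0" "z = eval_poly (($) x) N / (\<Prod>i\<in>UNIV. (x $ i) powi d i)"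
    using z unfolding laurent_denom_def by blast
  have nd: "\<not> poly_var i dvd N" for i
    using N(1)[of i] eval_face_dvd[of i N] by auto
  show ?thesis
    unfolding denominator_vector_def poly_subst_eval_poly
  proof (rule the_equality)
    show "\<exists>N. (\<forall>i. \<not> poly_var i dvd N) \<and>
        z = eval_poly (($) x) N / (\<Prod>i\<in>UNIV. (x $ i) powi ((\<chi> i. d i) $ i))"
      using nd N(2) by auto
  next
    fix e :: "(int, 'a) vec"
    assume "\<exists>N. (\<forall>i. \<not> poly_var i dvd N) \<and> z = eval_poly (($) x) N / (\<Prod>i\<in>UNIV. (x $ i) powi (e $ i))"
    then obtain M where "\<And>i. \<not> poly_var i dvd M"
      "z = eval_poly (($) x) M / (\<Prod>i\<in>UNIV. (x $ i) powi (e $ i))" by blast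
    then have "($) e = d"
      using laurent_denom_unique[OF x _ _ nd N(2)] by metis
    then show "e = (\<chi> i. d i)" by (simp add: vec_eq_iff)
  qed
qed

lemma laurent_denom_mult:
  assumes x: "alg_indep x" and "laurent_denom x z d" "laurent_denom x w e"
  shows "laurent_denom x (z * w) (\<lambda>i. d i + e i)"
proof -
  obtain M N where M: "\<And>i. eval_face i M > 0" "z = eval_poly (($) x) M / (\<Prod>i\<in>UNIV. (x $ i) powi d i)"
    and N: "\<And>i. eval_face i N > 0" "w = eval_poly (($) x) N / (\<Prod>i\<in>UNIV. (x $ i) powi e i)"
    using assms(2,3) unfolding laurent_denom_def by blast
  have "eval_face i (M * N) > 0" for i
    using M(1)[of i] N(1)[of i] by (simp add: eval_face_def eval_poly_mult)
  moreover have "z * w = eval_poly (($) x) (M * N) / (\<Prod>i\<in>UNIV. (x $ i) powi (d i + e i))"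
    using alg_indep_nonzero[OF x] by (simp add: M(2) N(2) eval_poly_mult power_int_add prod.distrib)
  ultimately show ?thesis unfolding laurent_denom_def by blast
qed

lemma laurent_denom_lower:
  assumes x: "alg_indep x" and "z = eval_poly (($) x) M / (\<Prod>i\<in>UNIV. (x $ i) powi d i)"
    and le: "\<And>i. d i \<le> g i"
  shows "z = eval_poly (($) x) (M * monomial (\<lambda>i. nat (g i - d i))) / (\<Prod>i\<in>UNIV. (x $ i) powi g i)"
proof -
  have "(\<Prod>i\<in>UNIV. (x $ i) powi g i) = (\<Prod>i\<in>UNIV. (x $ i) powi d i) * (\<Prod>i\<in>UNIV. x $ i ^ nat (g i - d i))"
    unfolding prod.distrib[symmetric]
  proof (intro prod.cong refl)
    fix i
    have "d i + int (nat (g i - d i)) = g i" using le[of i] by simp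
    then show "x $ i powi g i = x $ i powi d i * x $ i ^ nat (g i - d i)"
      by (metis power_int_add power_int_of_nat alg_indep_nonzero[OF x])
  qed
  moreover have "(\<Prod>i\<in>UNIV. x $ i ^ nat (g i - d i)) \<noteq> 0"
    using alg_indep_nonzero[OF x] by simp
  ultimately show ?thesis
    by (simp add: assms(2) eval_poly_mult eval_monomial)
qed

text \<open>Positivity on the faces \<open>x\<^sub>i = 0\<close> rules out cancellation, so denominators tropicalise.\<close>

lemma laurent_denom_add:
  assumes x: "alg_indep x" and "laurent_denom x z d" "laurent_denom x w e"
  shows "laurent_denom x (z + w) (\<lambda>i. max (d i) (e i))"
proof -
  obtain M N where M: "\<And>i. eval_face i M > 0" "z = eval_poly (($) x) M / (\<Prod>i\<in>UNIV. (x $ i) powi d i)"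
    and N: "\<And>i. eval_face i N > 0" "w = eval_poly (($) x) N / (\<Prod>i\<in>UNIV. (x $ i) powi e i)"
    using assms(2,3) unfolding laurent_denom_def by blast
  define g where "g i = max (d i) (e i)" for i
  define P where "P = M * monomial (\<lambda>i. nat (g i - d i)) + N * monomial (\<lambda>i. nat (g i - e i))"
  have "eval_face i P > 0" for i
  proof -
    have P: "eval_face i P = eval_face i M * eval_face i (monomial (\<lambda>i. nat (g i - d i)))
       + eval_face i N * eval_face i (monomial (\<lambda>i. nat (g i - e i)))"
      by (simp add: P_def eval_face_def eval_poly_add eval_poly_mult)
    show ?thesis unfolding P eval_face_monomial
      using M(1)[of i] N(1)[of i] by (auto simp: g_def)
  qed
  moreover have "z + w = eval_poly (($) x) P / (\<Prod>i\<in>UNIV. (x $ i) powi g i)"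
    using laurent_denom_lower[OF x M(2), of g] laurent_denom_lower[OF x N(2), of g]
    by (simp add: g_def P_def eval_poly_add add_divide_distrib)
  ultimately show ?thesis unfolding laurent_denom_def g_def by blast
qed

lemma laurent_denom_monomial:
  assumes x: "alg_indep x"
  shows "laurent_denom x (\<Prod>i\<in>UNIV. (x $ i) powi d i) (\<lambda>i. - d i)"
  unfolding laurent_denom_def
  by (rule exI[of _ 1]) (simp add: eval_face_def power_int_minus divide_inverse prod_inversef[unfolded o_def])

lemma laurent_denom_1:
  assumes x: "alg_indep x" shows "laurent_denom x 1 (\<lambda>i. 0)"
  using laurent_denom_monomial[OF x, of "\<lambda>_. 0"] by simp

lemma laurent_denom_var_power:
  assumes x: "alg_indep x"
  shows "laurent_denom x ((x $ k) powi n) (\<lambda>i. if i = k then - n else 0)"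
proof -
  have "(x $ i) powi (if i = k then n else 0) = (if i = k then (x $ k) powi n else 1)" for i
    by simp
  then have "(\<Prod>i\<in>UNIV. (x $ i) powi (if i = k then n else 0)) = (x $ k) powi n"
    by simp
  then show ?thesis
    using laurent_denom_monomial[OF x, of "\<lambda>i. if i = k then n else 0"]
    by (simp add: if_distrib[of uminus] cong: if_cong)
qed

lemma laurent_denom_divide_power:
  assumes x: "alg_indep x" and z: "laurent_denom x z d"
  shows "laurent_denom x (z / (x $ k) ^ n) (\<lambda>i. d i + (if i = k then int n else 0))"
proof -
  have "laurent_denom x (z * (x $ k) powi (- int n)) (\<lambda>i. d i + (if i = k then - (- int n) else 0))"
    by (rule laurent_denom_mult[OF x z laurent_denom_var_power[OF x]])
  then show ?thesis
    by (simp add: power_int_minus divide_inverse cong: if_cong)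
qed

section \<open>Triangulations of a polygon\<close>

declare [[smt_nat_as_int]]

definition ccw :: "nat \<Rightarrow> nat \<Rightarrow> nat \<Rightarrow> bool" where
  "ccw a b c \<longleftrightarrow> a < b \<and> b < c \<or> b < c \<and> c < a \<or> c < a \<and> a < b"

text \<open>One of \<open>c\<close>, \<open>d\<close> lies in each open arc between \<open>a\<close>
  and \<open>b\<close>, so chords with a common end never cross.\<close>

definition crosses :: "nat \<Rightarrow> nat \<Rightarrow> nat \<Rightarrow> nat \<Rightarrow> bool" where
  "crosses a b c d \<longleftrightarrow> ccw a c b \<and> ccw b d a \<or> ccw a d b \<and> ccw b c a"

definition same_chord :: "nat \<Rightarrow> nat \<Rightarrow> nat \<Rightarrow> nat \<Rightarrow> bool" where
  "same_chord a b c d \<longleftrightarrow> a = c \<and> b = d \<or> a = d \<and> b = c"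

definition edge :: "nat \<Rightarrow> nat \<Rightarrow> nat \<Rightarrow> bool" where
  "edge N a b \<longleftrightarrow> a < N \<and> b < N \<and> a \<noteq> b"

definition bdry :: "nat \<Rightarrow> nat \<Rightarrow> nat \<Rightarrow> bool" where
  "bdry N a b \<longleftrightarrow> edge N a b \<and> (\<forall>c<N. \<forall>d<N. \<not> crosses a b c d)"

text \<open>Boundary edges belong to every triangulation, as they cross nothing.\<close>

definition triangulation :: "nat \<Rightarrow> (nat \<Rightarrow> nat \<Rightarrow> bool) \<Rightarrow> bool" where
  "triangulation N T \<longleftrightarrow> (\<forall>a b. T a b \<longleftrightarrow> edge N a b \<and> (\<forall>c d. T c d \<longrightarrow> \<not> crosses a b c d))"

lemma ccw_rotate: "ccw a b c \<longleftrightarrow> ccw b c a"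
  by (auto simp: ccw_def)

lemma crs_swap: "crosses a b c d \<longleftrightarrow> crosses b a c d" "crosses a b c d \<longleftrightarrow> crosses a b d c" "crosses a b c d \<longleftrightarrow> crosses c d a b"
  unfolding crosses_def ccw_def by (smt (z3))+

lemma eqc_swap: "same_chord a b c d \<longleftrightarrow> same_chord b a c d" "same_chord a b c d \<longleftrightarrow> same_chord a b d c" "same_chord a b c d \<longleftrightarrow> same_chord c d a b"
  by (auto simp: same_chord_def)

lemma eqc_refl [simp]: "same_chord a b a b" "same_chord a b b a"
  by (auto simp: same_chord_def)

lemma edge_swap: "edge N a b \<longleftrightarrow> edge N b a"
  by (auto simp: edge_def)

lemma bdry_swap: "bdry N a b \<longleftrightarrow> bdry N b a"
  unfolding bdry_def using crs_swap(1) edge_swap by blast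

lemma tri_sym: "triangulation N T \<Longrightarrow> T a b \<Longrightarrow> T b a"
  unfolding triangulation_def using crs_swap(1) edge_swap by metis

lemma tri_edge: "triangulation N T \<Longrightarrow> T a b \<Longrightarrow> a < N \<and> b < N \<and> a \<noteq> b"
  unfolding triangulation_def edge_def by blast

lemma tri_noncrossing: "triangulation N T \<Longrightarrow> T a b \<Longrightarrow> T c d \<Longrightarrow> \<not> crosses a b c d"
  unfolding triangulation_def by blast

lemma tri_maximal:
  "triangulation N T \<Longrightarrow> edge N a b \<Longrightarrow> (\<And>c d. T c d \<Longrightarrow> \<not> crosses a b c d) \<Longrightarrow> T a b"
  unfolding triangulation_def by blast

lemma tri_bdry: "triangulation N T \<Longrightarrow> bdry N a b \<Longrightarrow> T a b"
  by (rule tri_maximal) (auto simp: bdry_def dest: tri_edge)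

text \<open>Position of \<open>x\<close> counted from \<open>a\<close>: the rotation moving
  \<open>a\<close> to 0, after which cyclic order from \<open>a\<close> is linear order.\<close>

definition key :: "nat \<Rightarrow> nat \<Rightarrow> nat \<Rightarrow> nat" where
  "key N a x = (if a \<le> x then x - a else x + N - a)"

lemma key_self [simp]: "key N a a = 0"
  by (simp add: key_def)

lemma key_eq_iff: "a < N \<Longrightarrow> x < N \<Longrightarrow> y < N \<Longrightarrow> key N a x = key N a y \<longleftrightarrow> x = y"
  by (auto simp: key_def split: if_splits)

lemma ccw_key:
  "a < N \<Longrightarrow> x < N \<Longrightarrow> y < N \<Longrightarrow> z < N \<Longrightarrow> ccw (key N a x) (key N a y) (key N a z) \<longleftrightarrow> ccw x y z"
  unfolding ccw_def key_def by (auto split: if_splits)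

lemma ccw_key_from:
  "a < N \<Longrightarrow> x < N \<Longrightarrow> y < N \<Longrightarrow> ccw a x y \<longleftrightarrow> 0 < key N a x \<and> key N a x < key N a y"
  using ccw_key[of a N a x y] by (auto simp: ccw_def)

text \<open>Take the neighbour \<open>b\<close> of \<open>a\<close> farthest towards
  \<open>c\<close>. A chord of \<open>T\<close> crossing \<open>b c\<close> avoids
  \<open>a b\<close> and \<open>a c\<close>, so it starts at \<open>a\<close> and ends beyond
  \<open>b\<close>, which contradicts the choice. Maximality of \<open>T\<close> then puts
  \<open>b c\<close> into \<open>T\<close>.\<close>

lemma tri_apex:
  assumes T: "triangulation N T" and ac: "T a c" and x: "x < N" "ccw a x c"
  obtains b where "b < N" "ccw a b c" "T a b" "T b c"
proof -
  have acN: "a < N" "c < N" "a \<noteq> c" using tri_edge[OF T ac] by auto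
  define S where "S = {b. b < N \<and> ccw a b c \<and> T a b}"
  \<comment> \<open>The successor of \<open>a\<close>: the side \<open>a s\<close> lies in every
    triangulation, so \<open>S\<close> is not empty.\<close>
  define s where "s = (if Suc a = N then 0 else Suc a)"
  have s: "s < N" using acN by (auto simp: s_def)
  have "bdry N a s"
    using s acN x unfolding bdry_def edge_def s_def crosses_def ccw_def by auto
  then have "T a s" by (rule tri_bdry[OF T])
  moreover have "ccw a s c"
    using s acN x unfolding s_def ccw_def by (auto split: if_splits)
  ultimately have "s \<in> S" using s by (simp add: S_def)
  moreover have "finite S" unfolding S_def by simp
  ultimately have "finite (key N a ` S)" "key N a ` S \<noteq> {}"
    by auto
  then have "Max (key N a ` S) \<in> key N a ` S" "\<And>y. y \<in> S \<Longrightarrow> key N a y \<le> Max (key N a ` S)"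
    by (rule Max_in, simp)
  then obtain b where b: "b \<in> S" "\<And>y. y \<in> S \<Longrightarrow> key N a y \<le> key N a b"
    by auto
  have bN: "b < N" "ccw a b c" "T a b" using b(1) by (auto simp: S_def)
  have "T b c"
  proof (rule tri_maximal[OF T])
    show "edge N b c" using bN acN by (auto simp: edge_def ccw_def)
    have key: False if gh: "T g h" and g: "ccw b g c" and h: "ccw c h b" for g h
    proof -
      have ghN: "g < N" "h < N" using tri_edge[OF T gh] by auto
      have "\<not> crosses a b g h" "\<not> crosses a c g h"
        using tri_noncrossing[OF T] gh bN(3) ac by auto
      then have "h = a"
        using g h bN(2) unfolding crosses_def ccw_def by (smt (z3))
      then have "g \<in> S"
        using tri_sym[OF T gh] g ghN bN(2) unfolding S_def ccw_def by auto
      then have "key N a g \<le> key N a b" by (rule b(2))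
      then show False
        using g bN acN ghN ccw_key[of a N b g c] ccw_key_from[of a N b c] by (auto simp: ccw_def)
    qed
    show "\<not> crosses b c g h" if "T g h" for g h
      using key[OF that] key[OF tri_sym[OF T that]] unfolding crosses_def by blast
  qed
  then show thesis using that bN by blast
qed

lemma tri_apex_unique:
  assumes T: "triangulation N T" and "ccw a b c" "T a b" "T b c" "ccw a b' c" "T a b'" "T b' c"
  shows "b = b'"
proof -
  have "\<not> crosses a b b' c" "\<not> crosses a b' b c"
    using tri_noncrossing[OF T] assms by auto
  then show ?thesis using assms unfolding crosses_def ccw_def by (smt (z3))
qed

definition quad :: "(nat \<Rightarrow> nat \<Rightarrow> bool) \<Rightarrow> nat \<Rightarrow> nat \<Rightarrow> nat \<Rightarrow> nat \<Rightarrow> bool" where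
  "quad T a b c d \<longleftrightarrow> T a c \<and> T a b \<and> T b c \<and> T c d \<and> T d a \<and> ccw a b c \<and> ccw c d a"

text \<open>A chord crossing \<open>b d\<close> runs through the quadrilateral; without crossing a
  side it can only join \<open>a\<close> and \<open>c\<close>.\<close>

lemma quad_crossing:
  assumes T: "triangulation N T" and q: "quad T a b c d" and xy: "T x y" "crosses b d x y"
  shows "same_chord x y a c"
proof -
  have "\<not> crosses x y a b" "\<not> crosses x y b c" "\<not> crosses x y c d" "\<not> crosses x y d a"
    using tri_noncrossing[OF T xy(1)] q unfolding quad_def by auto
  then show ?thesis using xy(2) q unfolding quad_def crosses_def ccw_def same_chord_def by (smt (z3))
qed

text \<open>Gives maximality of the flipped family: the only chord obstructed by \<open>a c\<close>
  alone is the new diagonal.\<close>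

lemma quad_crossed_only:
  assumes T: "triangulation N T" and q: "quad T a b c d" and xy: "crosses x y a c"
    and n: "\<And>g h. T g h \<Longrightarrow> \<not> same_chord g h a c \<Longrightarrow> \<not> crosses x y g h"
  shows "same_chord x y b d"
proof -
  have "\<not> same_chord a b a c" "\<not> same_chord b c a c" "\<not> same_chord c d a c" "\<not> same_chord d a a c"
    using q unfolding quad_def same_chord_def ccw_def by auto
  then have "\<not> crosses x y a b" "\<not> crosses x y b c" "\<not> crosses x y c d" "\<not> crosses x y d a"
    using n q unfolding quad_def by auto
  then show ?thesis using xy q unfolding quad_def crosses_def ccw_def same_chord_def by (smt (z3))
qed

lemma crs_irrefl: "same_chord x y u v \<Longrightarrow> \<not> crosses x y u v"
  unfolding same_chord_def crosses_def ccw_def by (smt (z3))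

lemma crs_eqc: "same_chord u v u' v' \<Longrightarrow> crosses x y u v \<longleftrightarrow> crosses x y u' v'"
  using crs_swap by (auto simp: same_chord_def)

lemma quad_diagonals_cross: "quad T a b c d \<Longrightarrow> crosses b d a c"
  by (auto simp: quad_def crosses_def ccw_def)

definition flip :: "(nat \<Rightarrow> nat \<Rightarrow> bool) \<Rightarrow> nat \<Rightarrow> nat \<Rightarrow> nat \<Rightarrow> nat \<Rightarrow> nat \<Rightarrow> nat \<Rightarrow> bool" where
  "flip T a b c d x y \<longleftrightarrow> T x y \<and> \<not> same_chord x y a c \<or> same_chord x y b d"

lemma tri_flip:
  assumes T: "triangulation N T" and q: "quad T a b c d"
  shows "triangulation N (flip T a b c d)"
  unfolding triangulation_def
proof (intro allI iffI)
  fix x y assume xy: "flip T a b c d x y"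
  have bd: "edge N b d"
    using q tri_edge[OF T] unfolding quad_def edge_def ccw_def by auto
  have "edge N x y"
    using xy bd tri_edge[OF T] unfolding flip_def same_chord_def edge_def by auto
  moreover have "\<not> crosses x y u v" if uv: "flip T a b c d u v" for u v
  proof
    assume c: "crosses x y u v"
    consider "T x y" "T u v" | "same_chord x y b d" "same_chord u v b d" | "T x y" "\<not> same_chord x y a c" "same_chord u v b d"
      | "T u v" "\<not> same_chord u v a c" "same_chord x y b d"
      using xy uv unfolding flip_def by blast
    then show False
    proof cases
      case 1 then show False using tri_noncrossing[OF T] c by blast
    next
      case 2 then show False using c unfolding same_chord_def crosses_def ccw_def by (smt (z3))
    next
      case 3 then have "crosses b d x y" using c crs_eqc crs_swap(3) by blast
      then show False using quad_crossing[OF T q] 3 by blast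
    next
      case 4 then have "crosses b d u v" using c crs_eqc crs_swap(3) by blast
      then show False using quad_crossing[OF T q] 4 by blast
    qed
  qed
  ultimately show "edge N x y \<and> (\<forall>c' d'. flip T a b c d c' d' \<longrightarrow> \<not> crosses x y c' d')"
    by blast
next
  fix x y assume xy: "edge N x y \<and> (\<forall>c' d'. flip T a b c d c' d' \<longrightarrow> \<not> crosses x y c' d')"
  then have n: "\<And>g h. T g h \<Longrightarrow> \<not> same_chord g h a c \<Longrightarrow> \<not> crosses x y g h" and nb: "\<not> crosses x y b d"
    by (auto simp: flip_def)
  show "flip T a b c d x y"
  proof (cases "crosses x y a c")
    case True
    then show ?thesis using quad_crossed_only[OF T q _ n] by (simp add: flip_def)
  next
    case False
    have "T x y"
      by (rule tri_maximal[OF T]) (use xy n False crs_eqc in blast)+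
    moreover have "\<not> same_chord x y a c"
      using nb quad_diagonals_cross[OF q] crs_eqc crs_swap(3) by blast
    ultimately show ?thesis by (simp add: flip_def)
  qed
qed

lemma quad_exists:
  assumes T: "triangulation N T" and ac: "T a c" and nb: "\<not> bdry N a c"
  obtains b d where "quad T a b c d"
proof -
  obtain x y where "x < N" "y < N" "crosses a c x y"
    using nb tri_edge[OF T ac] unfolding bdry_def edge_def by auto
  then obtain x y where "x < N" "y < N" "ccw a x c" "ccw c y a"
    unfolding crosses_def by blast
  then show thesis
    using tri_apex[OF T ac, of x] tri_apex[OF T tri_sym[OF T ac], of y] that ac
    unfolding quad_def by metis
qed

lemma quad_rotate: "triangulation N T \<Longrightarrow> quad T a b c d \<longleftrightarrow> quad T c d a b"
  unfolding quad_def using tri_sym[of N T] by blast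

lemma quad_unique:
  assumes "triangulation N T" "quad T a b c d" "quad T a b' c d'"
  shows "b = b'" "d = d'"
  using assms tri_apex_unique[OF assms(1)] unfolding quad_def by blast+

section \<open>Exchange matrices of symmetric triangulations\<close>

text \<open>Mutation for the integers read off a triangulation; the exchange matrix of the seed is a
  rescaling of these.\<close>

definition mutate_fun :: "'n \<Rightarrow> ('n \<Rightarrow> 'n \<Rightarrow> int) \<Rightarrow> 'n \<Rightarrow> 'n \<Rightarrow> int" where
  "mutate_fun k \<beta> i j =
     (if i = k \<or> j = k then - \<beta> i j
      else \<beta> i j + pos_part (\<beta> i k) * \<beta> k j + \<beta> i k * pos_part (- \<beta> k j))"

lemma mutate_fun_alt:
  "i \<noteq> k \<Longrightarrow> j \<noteq> k \<Longrightarrow> mutate_fun k \<beta> i j =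
     \<beta> i j + pos_part (\<beta> i k) * pos_part (\<beta> k j) - pos_part (- \<beta> i k) * pos_part (- \<beta> k j)"
  by (auto simp: mutate_fun_def pos_part_def max_def algebra_simps)

text \<open>An orientation preserving involution: the identity in type A, the half turn in types B
  and C. The combinatorics of all three types is done here at once.\<close>

locale symmetric_polygon =
  fixes N :: nat and r :: "nat \<Rightarrow> nat"
  assumes r_less: "i < N \<Longrightarrow> r i < N"
    and r_r: "i < N \<Longrightarrow> r (r i) = i"
    and r_ccw: "a < N \<Longrightarrow> b < N \<Longrightarrow> c < N \<Longrightarrow> ccw (r a) (r b) (r c) \<longleftrightarrow> ccw a b c"
    and r_cases: "(\<forall>i<N. r i = i) \<or> (\<forall>i<N. r i \<noteq> i)"
begin

lemma r_eq_iff: "a < N \<Longrightarrow> b < N \<Longrightarrow> r a = r b \<longleftrightarrow> a = b"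
  using r_r by metis

lemma r_crs: "a < N \<Longrightarrow> b < N \<Longrightarrow> c < N \<Longrightarrow> d < N \<Longrightarrow> crosses (r a) (r b) (r c) (r d) \<longleftrightarrow> crosses a b c d"
  by (simp add: crosses_def r_ccw)

lemma r_eqc: "a < N \<Longrightarrow> b < N \<Longrightarrow> c < N \<Longrightarrow> d < N \<Longrightarrow> same_chord (r a) (r b) (r c) (r d) \<longleftrightarrow> same_chord a b c d"
  by (simp add: same_chord_def r_eq_iff)

lemma r_edge: "edge N a b \<Longrightarrow> edge N (r a) (r b)"
  by (simp add: edge_def r_eq_iff r_less)

lemma r_bdry:
  assumes "bdry N a b" shows "bdry N (r a) (r b)"
  unfolding bdry_def
proof (intro conjI allI impI)
  show "edge N (r a) (r b)" using assms r_edge by (simp add: bdry_def)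
  fix c d assume cd: "c < N" "d < N"
  have "crosses (r a) (r b) (r (r c)) (r (r d)) \<longleftrightarrow> crosses a b (r c) (r d)"
    using assms cd by (intro r_crs r_less) (auto simp: bdry_def edge_def)
  then show "\<not> crosses (r a) (r b) c d"
    using assms cd r_less by (simp add: r_r bdry_def)
qed

definition orb :: "nat \<times> nat \<Rightarrow> nat \<Rightarrow> nat \<Rightarrow> bool" where
  "orb c x y \<longleftrightarrow> same_chord x y (fst c) (snd c) \<or> same_chord x y (r (fst c)) (r (snd c))"

definition chords :: "('n \<Rightarrow> nat \<times> nat) \<Rightarrow> nat \<Rightarrow> nat \<Rightarrow> bool" where
  "chords L x y \<longleftrightarrow> bdry N x y \<or> (\<exists>i. orb (L i) x y)"

definition labelled_tri :: "('n \<Rightarrow> nat \<times> nat) \<Rightarrow> bool" where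
  "labelled_tri L \<longleftrightarrow> triangulation N (chords L) \<and>
     (\<forall>i j x y. orb (L i) x y \<longrightarrow> orb (L j) x y \<longrightarrow> i = j) \<and>
     (\<forall>i. \<not> bdry N (fst (L i)) (snd (L i)))"

definition ind :: "('n \<Rightarrow> nat \<times> nat) \<Rightarrow> 'n \<Rightarrow> nat \<Rightarrow> nat \<Rightarrow> int" where
  "ind L i x y = (if orb (L i) x y then 1 else 0)"

lemma orb_self [simp]: "orb c (fst c) (snd c)" "orb (a, b) a b"
  by (auto simp: orb_def)

lemma orb_swap: "orb c x y \<longleftrightarrow> orb c y x"
  unfolding orb_def using eqc_swap by blast

lemma orb_r: "fst c < N \<Longrightarrow> snd c < N \<Longrightarrow> x < N \<Longrightarrow> y < N \<Longrightarrow> orb c (r x) (r y) \<longleftrightarrow> orb c x y"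
  unfolding orb_def by (metis r_eqc r_r r_less)

text \<open>A chord and its image never share exactly one end, because \<open>r\<close> is the
  identity or has no fixed vertex. Hence no two sides of a triangle carry the same label.\<close>

lemma orb_adjacent:
  assumes c: "fst c < N" "snd c < N" and "orb c x y" "orb c y z"
  shows "x = z"
proof -
  define p q where "p = fst c" and "q = snd c"
  have pq: "p < N" "q < N" using c by (auto simp: p_def q_def)
  have o: "x = p \<and> y = q \<or> x = q \<and> y = p \<or> x = r p \<and> y = r q \<or> x = r q \<and> y = r p"
    "y = p \<and> z = q \<or> y = q \<and> z = p \<or> y = r p \<and> z = r q \<or> y = r q \<and> z = r p"
    using assms(3,4) by (auto simp: orb_def same_chord_def p_def q_def)
  have rr: "r (r p) = p" "r (r q) = q" using pq r_r by auto
  show ?thesis using r_cases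
  proof
    assume "\<forall>i<N. r i = i"
    then have "r p = p" "r q = q" using pq by auto
    then show ?thesis using o by auto
  next
    assume "\<forall>i<N. r i \<noteq> i"
    then have "r p \<noteq> p" "r q \<noteq> q" using pq by auto
    then show ?thesis using o rr by metis
  qed
qed

lemma ltri:
  assumes "labelled_tri L"
  shows ltri_tri: "triangulation N (chords L)"
    and ltri_inj: "orb (L i) x y \<Longrightarrow> orb (L j) x y \<Longrightarrow> i = j"
    and ltri_nbdry: "\<not> bdry N (fst (L i)) (snd (L i))"
  using assms unfolding labelled_tri_def by blast+

lemma chords_orb: "orb (L i) x y \<Longrightarrow> chords L x y"
  by (auto simp: chords_def)

lemma ltri_less:
  assumes "labelled_tri L" shows "fst (L i) < N" "snd (L i) < N"
  using tri_edge[OF ltri_tri[OF assms] chords_orb[OF orb_self(1)]] by auto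

lemma ltri_orb_nbdry:
  assumes L: "labelled_tri L" and o: "orb (L i) x y" shows "\<not> bdry N x y"
proof -
  have l: "fst (L i) < N" "snd (L i) < N" using ltri_less[OF L] by auto
  have "\<not> bdry N (r (fst (L i))) (r (snd (L i)))"
    using r_bdry[of "r (fst (L i))" "r (snd (L i))"] ltri_nbdry[OF L, of i] l by (auto simp: r_r)
  then show ?thesis
    using o ltri_nbdry[OF L, of i] bdry_swap unfolding orb_def same_chord_def by blast
qed

lemma chords_r:
  assumes L: "labelled_tri L" and x: "chords L x y"
  shows "chords L (r x) (r y)"
proof -
  have "x < N" "y < N" using tri_edge[OF ltri_tri[OF L] x] by auto
  then show ?thesis using x orb_r[OF ltri_less[OF L]] r_bdry unfolding chords_def by blast
qed

lemma quad_less: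
  assumes "triangulation N T" "quad T a b c d" shows "a < N" "b < N" "c < N" "d < N"
  using assms tri_edge[OF assms(1)] unfolding quad_def by blast+

lemma quad_r:
  assumes L: "labelled_tri L" and q: "quad (chords L) a b c d"
  shows "quad (chords L) (r a) (r b) (r c) (r d)"
  using q quad_less[OF ltri_tri[OF L] q] chords_r[OF L] unfolding quad_def by (auto simp: r_ccw)

lemma quad_swap: "labelled_tri L \<Longrightarrow> quad (chords L) a b c d \<Longrightarrow> quad (chords L) c d a b"
  using quad_rotate ltri_tri by blast

text \<open>A diagonal determines its two triangles, so only its direction and the choice between it
  and its image are free. This makes the entries of \<open>exchange_matrix\<close> well
  defined.\<close>

lemma quad_orb_unique:
  assumes L: "labelled_tri L" and q: "quad (chords L) a b c d" and q': "quad (chords L) a' b' c' d'"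
    and o: "orb (a, c) a' c'"
  shows "(a', b', c', d') \<in> {(a, b, c, d), (c, d, a, b), (r a, r b, r c, r d), (r c, r d, r a, r b)}"
proof -
  note T = ltri_tri[OF L]
  consider "a' = a" "c' = c" | "a' = c" "c' = a" | "a' = r a" "c' = r c" | "a' = r c" "c' = r a"
    using o unfolding orb_def same_chord_def by auto
  then show ?thesis
  proof cases
    case 1 then show ?thesis using quad_unique[OF T q] q' by auto
  next
    case 2 then show ?thesis using quad_unique[OF T quad_swap[OF L q]] q' by auto
  next
    case 3 then show ?thesis using quad_unique[OF T quad_r[OF L q]] q' by auto
  next
    case 4 then show ?thesis using quad_unique[OF T quad_swap[OF L quad_r[OF L q]]] q' by auto
  qed
qed

definition quad_sum :: "('n \<Rightarrow> nat \<times> nat) \<Rightarrow> 'n \<Rightarrow> nat \<Rightarrow> nat \<Rightarrow> nat \<Rightarrow> nat \<Rightarrow> int" where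
  "quad_sum L i a b c d = ind L i a b + ind L i c d - ind L i b c - ind L i d a"

text \<open>Column k counts with signs the sides of the quadrilateral around orbit k. Around a
  diameter of the half turn, opposite sides lie in one orbit, so that column is even.\<close>

definition exchange_matrix :: "('n \<Rightarrow> nat \<times> nat) \<Rightarrow> ('n \<Rightarrow> 'n \<Rightarrow> int) \<Rightarrow> bool" where
  "exchange_matrix L \<beta> \<longleftrightarrow> (\<forall>i k a b c d. quad (chords L) a b c d \<longrightarrow> orb (L k) a c \<longrightarrow>
     \<beta> i k = quad_sum L i a b c d)"

lemma ind_r: "labelled_tri L \<Longrightarrow> x < N \<Longrightarrow> y < N \<Longrightarrow> ind L i (r x) (r y) = ind L i x y"
  unfolding ind_def using orb_r ltri_less by metis

lemma exchange_matrixI: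
  assumes L: "labelled_tri L"
    and ex: "\<And>k. \<exists>a b c d. quad (chords L) a b c d \<and> orb (a, c) (fst (L k)) (snd (L k)) \<and>
       (\<forall>i. \<beta> i k = quad_sum L i a b c d)"
  shows "exchange_matrix L \<beta>"
  unfolding exchange_matrix_def
proof (intro allI impI)
  fix i k a' b' c' d'
  assume q': "quad (chords L) a' b' c' d'" and o': "orb (L k) a' c'"
  obtain a b c d where q: "quad (chords L) a b c d" and o: "orb (a, c) (fst (L k)) (snd (L k))"
    and \<beta>: "\<beta> i k = quad_sum L i a b c d"
    using ex by blast
  note lt = quad_less[OF ltri_tri[OF L] q] 
  have "orb (a, c) a' c'"
    using o o' lt(1,3) r_r unfolding orb_def same_chord_def by auto
  then have "(a', b', c', d') \<in> {(a, b, c, d), (c, d, a, b), (r a, r b, r c, r d), (r c, r d, r a, r b)}"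
    by (rule quad_orb_unique[OF L q q'])
  then have "quad_sum L i a' b' c' d' = quad_sum L i a b c d"
    using ind_r[OF L] lt unfolding quad_sum_def by auto
  then show "\<beta> i k = quad_sum L i a' b' c' d'" using \<beta> by simp
qed

lemma ind_adjacent:
  assumes L: "labelled_tri L" and "x \<noteq> z"
  shows "ind L i x y = 0 \<or> ind L i y z = 0"
  using orb_adjacent[OF ltri_less[OF L]] assms(2) unfolding ind_def by (auto split: if_splits)

lemma ind_nonneg: "ind L i x y \<ge> 0" "ind L i x y \<le> 1"
  by (auto simp: ind_def)

lemma quad_distinct: "quad T a b c d \<Longrightarrow> a \<noteq> b \<and> b \<noteq> c \<and> c \<noteq> d \<and> d \<noteq> a \<and> a \<noteq> c \<and> b \<noteq> d"
  by (auto simp: quad_def ccw_def)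

text \<open>Consecutive sides have opposite signs and different orbits, so for each \<open>i\<close>
  positive and negative contributions never meet.\<close>

lemma exchange_matrix_parts:
  assumes L: "labelled_tri L" and E: "exchange_matrix L \<beta>"
    and q: "quad (chords L) a b c d" and o: "orb (L k) a c"
  shows "pos_part (\<beta> i k) = ind L i a b + ind L i c d"
    and "pos_part (- \<beta> i k) = ind L i b c + ind L i d a"
proof -
  have \<beta>: "\<beta> i k = quad_sum L i a b c d" using E q o unfolding exchange_matrix_def by blast
  note dist = quad_distinct[OF q]
  have "ind L i a b = 0 \<or> ind L i b c = 0" "ind L i d a = 0 \<or> ind L i a b = 0"
    "ind L i b c = 0 \<or> ind L i c d = 0" "ind L i c d = 0 \<or> ind L i d a = 0"
    using ind_adjacent[OF L] dist by metis+
  then show "pos_part (\<beta> i k) = ind L i a b + ind L i c d" "pos_part (- \<beta> i k) = ind L i b c + ind L i d a"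
    unfolding \<beta> quad_sum_def pos_part_def
    using ind_nonneg[of L i a b] ind_nonneg[of L i b c] ind_nonneg[of L i c d] ind_nonneg[of L i d a] by auto
qed

end

section \<open>Flipping an orbit of diagonals\<close>

locale orbit_flip = symmetric_polygon N r for N r +
  fixes L :: "'n \<Rightarrow> nat \<times> nat" and k :: 'n and a b c d :: nat
  assumes L: "labelled_tri L" and q: "quad (chords L) a b c d" and Lk: "L k = (a, c)"
begin

definition L' :: "'n \<Rightarrow> nat \<times> nat" where "L' = L(k := (b, d))"

lemmas T = ltri_tri[OF L]
lemmas lt = quad_less[OF T q]

lemma L'_other: "i \<noteq> k \<Longrightarrow> L' i = L i" and L'_k: "L' k = (b, d)"
  by (auto simp: L'_def)

lemma new_crossing: "orb (b, d) x y \<Longrightarrow> \<exists>u v. orb (L k) u v \<and> crosses x y u v"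
  using quad_diagonals_cross[OF q] quad_diagonals_cross[OF quad_r[OF L q]] crs_swap(1)
  unfolding orb_def same_chord_def Lk by (metis eqc_refl(1) fst_conv snd_conv)

lemma new_not_chord: "orb (b, d) x y \<Longrightarrow> \<not> chords L x y"
  using new_crossing tri_noncrossing[OF T] chords_orb by metis

lemma chords_L': "chords L' x y \<longleftrightarrow> chords L x y \<and> \<not> orb (L k) x y \<or> orb (b, d) x y"
proof -
  have "chords L' x y \<longleftrightarrow> bdry N x y \<or> (\<exists>i. i \<noteq> k \<and> orb (L i) x y) \<or> orb (b, d) x y"
    unfolding chords_def using L'_other L'_k by metis
  moreover have "\<not> orb (L k) x y" if "bdry N x y \<or> (\<exists>i. i \<noteq> k \<and> orb (L i) x y)"
    using that ltri_orb_nbdry[OF L] ltri_inj[OF L] by blast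
  moreover have "(\<exists>i. orb (L i) x y) \<longleftrightarrow> (\<exists>i. i \<noteq> k \<and> orb (L i) x y) \<or> orb (L k) x y"
    by auto
  ultimately show ?thesis unfolding chords_def by auto
qed

lemma quad_side_not_orb:
  assumes q': "quad (chords L) x y z w" and o: "orb (L k) x z"
  shows "\<not> orb (L k) x y" "\<not> orb (L k) y z" "\<not> orb (L k) z w" "\<not> orb (L k) w x"
  using orb_adjacent[OF ltri_less[OF L]] quad_distinct[OF q'] o orb_swap by metis+

text \<open>If the diagonal is its own image, the orbit is changed by a single flip. Otherwise the
  image quadrilateral survives the first flip and is flipped afterwards.\<close>

lemma tri_L': "triangulation N (chords L')"
proof -
  let ?T1 = "flip (chords L) a b c d"
  have T1: "triangulation N ?T1" by (rule tri_flip[OF T q])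
  show ?thesis
  proof (cases "same_chord (r a) (r c) a c")
    case True
    have o: "orb (a, c) x y \<longleftrightarrow> same_chord x y a c" for x y
      using True unfolding orb_def same_chord_def by auto
    have "r b = b \<and> r d = d \<or> r b = d \<and> r d = b"
    proof -
      consider "r a = a" "r c = c" | "r a = c" "r c = a" using True by (auto simp: same_chord_def)
      then show ?thesis
      proof cases
        case 1
        then have "quad (chords L) a (r b) c (r d)" using quad_r[OF L q] by simp
        then show ?thesis using quad_unique[OF T q] by metis
      next
        case 2
        then have "quad (chords L) c (r b) a (r d)" using quad_r[OF L q] by simp
        then show ?thesis using quad_unique[OF T quad_swap[OF L q]] by metis
      qed
    qed
    then have "orb (b, d) x y \<longleftrightarrow> same_chord x y b d" for x y
      unfolding orb_def same_chord_def by auto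
    then have "chords L' x y \<longleftrightarrow> ?T1 x y" for x y
      by (simp add: chords_L' flip_def o Lk)
    then have "chords L' = ?T1" by (intro ext) simp
    then show ?thesis using T1 by simp
  next
    case False
    note s = quad_side_not_orb[OF quad_r[OF L q]] 
    have or: "orb (L k) (r a) (r c)" "orb (L k) x y \<longleftrightarrow> same_chord x y a c \<or> same_chord x y (r a) (r c)" for x y
      by (simp_all add: orb_def Lk)
    have q1: "quad ?T1 (r a) (r b) (r c) (r d)"
      using quad_r[OF L q] s[OF or(1)] False unfolding quad_def flip_def or(2) by blast
    have n: "\<not> same_chord x y (r a) (r c)" if "same_chord x y b d" for x y
      using new_not_chord[of x y] chords_orb[of L k x y] that by (auto simp: orb_def Lk)
    have "chords L' x y \<longleftrightarrow> flip ?T1 (r a) (r b) (r c) (r d) x y" for x y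
      using n[of x y] by (auto simp: chords_L' flip_def or(2) orb_def[of "(b, d)"])
    then have "chords L' = flip ?T1 (r a) (r b) (r c) (r d)" by (intro ext) simp
    then show ?thesis using tri_flip[OF T1 q1] by simp
  qed
qed

lemma labelled_tri_L': "labelled_tri L'"
  unfolding labelled_tri_def
proof (intro conjI allI impI tri_L')
  fix i j x y assume o: "orb (L' i) x y" "orb (L' j) x y"
  have *: "False" if "orb (L i) x y" "orb (b, d) x y" for i
    using that new_not_chord[of x y] chords_orb[of L i x y] by blast
  show "i = j"
  proof (cases "i = k \<or> j = k")
    case True
    then show ?thesis using o *[of i] *[of j] L'_k L'_other[of i] L'_other[of j] by (cases "i = j") auto
  next
    case False
    then show ?thesis using o ltri_inj[OF L, of i x y j] L'_other[of i] L'_other[of j] by simp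
  qed
next
  fix i
  show "\<not> bdry N (fst (L' i)) (snd (L' i))"
  proof (cases "i = k")
    case True
    have "\<not> bdry N b d"
      using quad_diagonals_cross[OF q] lt unfolding bdry_def by auto
    then show ?thesis using True L'_k by simp
  next
    case False
    then show ?thesis using ltri_nbdry[OF L] L'_other by simp
  qed
qed

lemma ind_L'_other: "i \<noteq> k \<Longrightarrow> ind L' i x y = ind L i x y"
  by (simp add: ind_def L'_other)

lemma quad_orb_flip:
  assumes q': "quad (chords L) x y z w" and o: "orb (L k) x z"
  shows "orb (b, d) y w"
  using quad_orb_unique[OF L q q'] o unfolding Lk by (auto simp: orb_def)

text \<open>One triangle at a time: \<open>u v\<close> survives the flip and has apex
  \<open>w\<close> before and \<open>w'\<close> after it. If no side of the triangle is flipped,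
  nothing changes; otherwise the triangle is half of a flipped quadrilateral and the new apex is the
  fourth vertex.\<close>

lemma side_change:
  assumes E: "exchange_matrix L \<beta>"
    and w: "ccw u w v" "chords L u w" "chords L w v"
    and w': "ccw u w' v" "chords L' u w'" "chords L' w' v"
    and uv: "chords L u v" "chords L' u v"
  shows "i \<noteq> k \<Longrightarrow> ind L i u w' - ind L i w' v = ind L i u w - ind L i w v
      + pos_part (\<beta> i k) * ind L k u w - pos_part (- \<beta> i k) * ind L k w v" (is "_ \<Longrightarrow> ?A")
    and "ind L' k u w' - ind L' k w' v = - (ind L k u w - ind L k w v)" (is ?B)
proof -
  have uvk: "\<not> orb (L k) u v"
    using uv new_not_chord by (auto simp: chords_L')
  have uvN: "u < N" "v < N" "w < N" using tri_edge[OF T] uv(1) w by blast+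
  note ck = ltri_less[OF L, of k]
  have uniq: "w' = e" if "ccw u e v" "chords L' u e" "chords L' e v" for e
    using tri_apex_unique[OF tri_L' w' that] .
  have zero: "ind L' k x y = 0" if "chords L x y" for x y
    using that new_not_chord[of x y] by (auto simp: ind_def L'_k)
  have zero': "ind L i x y = 0" if "orb (b, d) x y" for i x y
    using new_not_chord[OF that] chords_orb[of L i x y] by (auto simp: ind_def)
  have other: "ind L i x y = 0" if "orb (L k) x y" "i \<noteq> k" for i x y
    using ltri_inj[OF L] that by (auto simp: ind_def)
  consider "\<not> orb (L k) u w" "\<not> orb (L k) w v" | "orb (L k) u w" | "orb (L k) w v" by blast
  then have "(i \<noteq> k \<longrightarrow> ?A) \<and> ?B"
  proof cases
    case 1
    then have "w' = w" using uniq w by (simp add: chords_L')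
    then show ?thesis using 1 zero w by (auto simp: ind_def)
  next
    case 2
    obtain e f where ef: "quad (chords L) u e w f"
      using quad_exists[OF T w(2) ltri_orb_nbdry[OF L 2]] .
    \<comment> \<open>The given triangle is the one on this side of the flipped chord
      \<open>u w\<close>, and apexes are unique.\<close>
    have fv: "f = v"
      by (rule tri_apex_unique[OF T, of w _ u])
        (use ef w uv tri_sym[OF T] in \<open>auto simp: quad_def ccw_def\<close>)
    note ef = ef[unfolded fv]
    note s = quad_side_not_orb[OF ef 2]
    have ev: "orb (b, d) e v" by (rule quad_orb_flip[OF ef 2])
    have we: "w' = e"
    proof (rule uniq)
      show "ccw u e v" using ef w(1) unfolding quad_def ccw_def by (smt (z3))
      show "chords L' u e" "chords L' e v"
        using ef s ev by (auto simp: chords_L' quad_def)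
    qed
    have ue: "chords L u e" using ef by (simp add: quad_def)
    have k: "ind L k u w = 1" "ind L k w v = 0" "ind L' k e v = 1" "ind L' k u e = 0"
      using 2 s ev zero[OF ue] by (auto simp: ind_def L'_k)
    have "ind L i u w = 0" if "i \<noteq> k" using other[OF 2 that] .
    then show ?thesis
      using exchange_matrix_parts(1)[OF L E ef 2, of i] zero'[OF ev, of i] k
      by (auto simp: we)
  next
    case 3
    obtain e f where ef: "quad (chords L) w e v f"
      using quad_exists[OF T w(3) ltri_orb_nbdry[OF L 3]] .
    have fu: "f = u"
      by (rule tri_apex_unique[OF T, of v _ w])
        (use ef w uv tri_sym[OF T] in \<open>auto simp: quad_def ccw_def\<close>)
    note ef = ef[unfolded fu]
    note s = quad_side_not_orb[OF ef 3]
    have eu: "orb (b, d) u e" using quad_orb_flip[OF ef 3] orb_swap by blast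
    have we: "w' = e"
    proof (rule uniq)
      show "ccw u e v" using ef w(1) unfolding quad_def ccw_def by (smt (z3))
      show "chords L' u e" "chords L' e v"
        using ef s eu by (auto simp: chords_L' quad_def)
    qed
    have ue: "chords L e v" using ef by (simp add: quad_def)
    have k: "ind L k w v = 1" "ind L k u w = 0" "ind L' k u e = 1" "ind L' k e v = 0"
      using 3 s eu zero[OF ue] orb_swap by (auto simp: ind_def L'_k)
    have "ind L i w v = 0" if "i \<noteq> k" using other[OF 3 that] .
    then show ?thesis
      using exchange_matrix_parts(2)[OF L E ef 3, of i] zero'[OF eu, of i] k
      by (auto simp: we)
  qed
  then show "i \<noteq> k \<Longrightarrow> ?A" "?B" by blast+
qed

lemma quad_new: "quad (chords L') b c d a"
  using q quad_side_not_orb[OF q] tri_sym[OF tri_L'] unfolding quad_def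
  by (auto simp: chords_L' Lk ccw_def)

text \<open>Away from column k, a column is the sum of \<open>side_change\<close> over the two
  triangles at its diagonal. In column k the quadrilateral is read from \<open>b\<close> instead of
  \<open>a\<close>, which reverses all signs.\<close>

lemma exchange_matrix_L':
  assumes E: "exchange_matrix L \<beta>"
  shows "exchange_matrix L' (mutate_fun k \<beta>)"
proof (rule exchange_matrixI[OF labelled_tri_L'])
  fix j
  have T': "triangulation N (chords L')" by (rule tri_L')
  show "\<exists>x y z w. quad (chords L') x y z w \<and> orb (x, z) (fst (L' j)) (snd (L' j)) \<and>
       (\<forall>i. mutate_fun k \<beta> i j = quad_sum L' i x y z w)"
  proof (cases "j = k")
    case True
    have "mutate_fun k \<beta> i k = quad_sum L' i b c d a" for i
    proof -
      have b: "\<beta> i k = quad_sum L i a b c d"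
        using E q Lk unfolding exchange_matrix_def by auto
      have "quad_sum L' i b c d a = - quad_sum L i a b c d"
      proof (cases "i = k")
        case True
        have "ind L k a b = 0" "ind L k b c = 0" "ind L k c d = 0" "ind L k d a = 0"
          using quad_side_not_orb[OF q] Lk by (auto simp: ind_def)
        moreover have "ind L' k a b = 0" "ind L' k b c = 0" "ind L' k c d = 0" "ind L' k d a = 0"
          using q new_not_chord unfolding ind_def L'_k quad_def by metis+
        ultimately show ?thesis using True by (simp add: quad_sum_def)
      qed (simp add: quad_sum_def ind_L'_other)
      then show ?thesis using b by (simp add: mutate_fun_def)
    qed
    then show ?thesis using True quad_new L'_k by (intro exI[of _ b] exI[of _ c] exI[of _ d] exI[of _ a]) auto
  next
    case False
    define u v where "u = fst (L j)" and "v = snd (L j)"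
    have Lj: "L' j = (u, v)" "L j = (u, v)" using False L'_other by (auto simp: u_def v_def)
    have oj: "orb (L j) u v" "orb (L' j) u v" using Lj by auto
    have nb: "\<not> bdry N u v" using ltri_orb_nbdry[OF L oj(1)] .
    obtain w x where wx: "quad (chords L) u w v x" using quad_exists[OF T chords_orb[of L, OF oj(1)] nb] .
    obtain w' x' where wx': "quad (chords L') u w' v x'"
      using quad_exists[OF T' chords_orb[of L', OF oj(2)] nb] .
    have uv: "chords L u v" "chords L' u v" "chords L v u" "chords L' v u"
      using wx wx' tri_sym[OF T] tri_sym[OF T'] by (auto simp: quad_def)
    have s1: "i \<noteq> k \<Longrightarrow> ind L i u w' - ind L i w' v = ind L i u w - ind L i w v
      + pos_part (\<beta> i k) * ind L k u w - pos_part (- \<beta> i k) * ind L k w v"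
      "ind L' k u w' - ind L' k w' v = - (ind L k u w - ind L k w v)"  for i
      using side_change(1)[OF E, of u w v w' i] side_change(2)[OF E, of u w v w'] wx wx' uv
      by (auto simp: quad_def)
    have s2: "i \<noteq> k \<Longrightarrow> ind L i v x' - ind L i x' u = ind L i v x - ind L i x u
      + pos_part (\<beta> i k) * ind L k v x - pos_part (- \<beta> i k) * ind L k x u"
      "ind L' k v x' - ind L' k x' u = - (ind L k v x - ind L k x u)"  for i
      using side_change(1)[OF E, of v x u x' i] side_change(2)[OF E, of v x u x'] wx wx' uv
      by (auto simp: quad_def)
    have b: "\<beta> i j = quad_sum L i u w v x" for i
      using E wx oj unfolding exchange_matrix_def by auto
    note p = exchange_matrix_parts[OF L E wx oj(1), of k]
    have "mutate_fun k \<beta> i j = quad_sum L' i u w' v x'" for i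
    proof (cases "i = k")
      case True
      then show ?thesis using s1(2) s2(2) b[of k] by (simp add: mutate_fun_def quad_sum_def)
    next
      case i: False
      then show ?thesis using s1(1)[OF i] s2(1)[OF i] b[of i] False
        by (simp add: mutate_fun_alt p quad_sum_def ind_L'_other algebra_simps)
    qed
    then show ?thesis using wx' Lj by (intro exI[of _ u] exI[of _ w'] exI[of _ v] exI[of _ x']) auto
  qed
qed

end

section \<open>Crossing numbers under a flip\<close>

text \<open>The crossing number of a noncrossing family of curves with the second diagonal of a
  quadrilateral, in terms of those with its sides and its first diagonal; negative values count
  copies of the side or diagonal itself. For \<open>k \<ge> 0\<close> the entries of the maximum are lower bounds;
  the first two are attained unless curves fan out of a corner across both opposite sides, and
  each of the other four is attained in one of the four fan cases.\<close>

definition flip_count :: "int \<Rightarrow> int \<Rightarrow> int \<Rightarrow> int \<Rightarrow> int \<Rightarrow> int" where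
  "flip_count a' b' c' d' k = (let a = max a' 0; b = max b' 0; c = max c' 0; d = max d' 0 in
     if k < 0 then max a b + max c d - k
     else Max {a + c - k, b + d - k, b + c - 2 * k, a + d - 2 * k,
       min (c + d - k) ((c + d - k) div 2), min (a + b - k) ((a + b - k) div 2)})"

text \<open>The even labels \<open>0, 2, 4, 6\<close> stand for the corners of a quadrilateral, the odd labels for
  the regions cut off by its sides; \<open>W l m\<close> counts the curves joining \<open>l\<close> and \<open>m\<close>.\<close>

lemma flip_count_eq:
  fixes W :: "nat \<Rightarrow> nat \<Rightarrow> int"
  assumes nonneg: "\<And>l m. W l m \<ge> 0"
    and excl: "\<And>l m l' m'. crosses l m l' m' \<Longrightarrow> W l m = 0 \<or> W l' m' = 0"
    and a: "a = W 1 3 + W 1 4 + W 1 5 + W 1 6 + W 1 7 - W 0 2"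
    and b: "b = W 0 3 + W 1 3 + W 3 5 + W 3 6 + W 3 7 - W 2 4"
    and c: "c = W 0 5 + W 1 5 + W 2 5 + W 3 5 + W 5 7 - W 4 6"
    and d: "d = W 1 7 + W 2 7 + W 3 7 + W 4 7 + W 5 7 - W 0 6"
    and k: "k = W 1 5 + W 1 6 + W 1 7 + W 2 5 + W 2 6 + W 2 7 + W 3 5 + W 3 6 + W 3 7 - W 0 4"
    and k': "k' = W 0 3 + W 0 4 + W 0 5 + W 1 3 + W 1 4 + W 1 5 + W 3 7 + W 4 7 + W 5 7 - W 2 6"
  shows "k' = flip_count a b c d k"
proof -
  have zero: "W l' m' = 0" if "W l m \<noteq> 0" "crosses l m l' m'" for l m l' m'
    using excl that by blast
  note cd = crosses_def ccw_def
  \<comment> \<open>A copy of the side excludes every curve crossing it, so the positive part is the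
    number of true crossings. The same holds for the other sides.\<close>
  have a': "max a 0 = W 1 3 + W 1 4 + W 1 5 + W 1 6 + W 1 7"
  proof (cases "W 0 2 = 0")
    case False
    have "W 1 3 = 0 \<and> W 1 4 = 0 \<and> W 1 5 = 0 \<and> W 1 6 = 0 \<and> W 1 7 = 0"
      by (intro conjI zero[OF False]) (simp_all add: cd)
    then show ?thesis using a nonneg[of 0 2] by simp
  qed (use a nonneg[of 1 3] nonneg[of 1 4] nonneg[of 1 5] nonneg[of 1 6] nonneg[of 1 7] in simp)
  have b': "max b 0 = W 0 3 + W 1 3 + W 3 5 + W 3 6 + W 3 7"
  proof (cases "W 2 4 = 0")
    case False
    have "W 0 3 = 0 \<and> W 1 3 = 0 \<and> W 3 5 = 0 \<and> W 3 6 = 0 \<and> W 3 7 = 0"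
      by (intro conjI zero[OF False]) (simp_all add: cd)
    then show ?thesis using b nonneg[of 2 4] by simp
  qed (use b nonneg[of 0 3] nonneg[of 1 3] nonneg[of 3 5] nonneg[of 3 6] nonneg[of 3 7] in simp)
  have c': "max c 0 = W 0 5 + W 1 5 + W 2 5 + W 3 5 + W 5 7"
  proof (cases "W 4 6 = 0")
    case False
    have "W 0 5 = 0 \<and> W 1 5 = 0 \<and> W 2 5 = 0 \<and> W 3 5 = 0 \<and> W 5 7 = 0"
      by (intro conjI zero[OF False]) (simp_all add: cd)
    then show ?thesis using c nonneg[of 4 6] by simp
  qed (use c nonneg[of 0 5] nonneg[of 1 5] nonneg[of 2 5] nonneg[of 3 5] nonneg[of 5 7] in simp)
  have d': "max d 0 = W 1 7 + W 2 7 + W 3 7 + W 4 7 + W 5 7"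
  proof (cases "W 0 6 = 0")
    case False
    have "W 1 7 = 0 \<and> W 2 7 = 0 \<and> W 3 7 = 0 \<and> W 4 7 = 0 \<and> W 5 7 = 0"
      by (intro conjI zero[OF False]) (simp_all add: cd)
    then show ?thesis using d nonneg[of 0 6] by simp
  qed (use d nonneg[of 1 7] nonneg[of 2 7] nonneg[of 3 7] nonneg[of 4 7] nonneg[of 5 7] in simp)
  note nn = nonneg[of 0 3] nonneg[of 0 5] nonneg[of 1 3] nonneg[of 1 4] nonneg[of 1 5] nonneg[of 1 6]
    nonneg[of 1 7] nonneg[of 2 5] nonneg[of 2 6] nonneg[of 2 7] nonneg[of 3 5] nonneg[of 3 6]
    nonneg[of 3 7] nonneg[of 4 7] nonneg[of 5 7]
  show ?thesis
  proof (cases "W 0 4 = 0")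
    case False
    have z: "W 1 5 = 0 \<and> W 1 6 = 0 \<and> W 1 7 = 0 \<and> W 2 5 = 0 \<and> W 2 6 = 0 \<and> W 2 7 = 0 \<and> W 3 5 = 0
        \<and> W 3 6 = 0 \<and> W 3 7 = 0"
      by (intro conjI zero[OF False]) (simp_all add: cd)
    have "W 0 3 = 0 \<or> W 1 4 = 0" "W 0 5 = 0 \<or> W 4 7 = 0"
      by (rule excl; simp add: cd)+
    then show ?thesis
      using z False k k' nonneg[of 0 4] nn by (auto simp: flip_count_def Let_def a' b' c' d')
  next
    case t0: True
    define h1 h2 h3 h4 h5 h6 where "h1 = max a 0 + max c 0 - k" and "h2 = max b 0 + max d 0 - k"
      and "h3 = max b 0 + max c 0 - 2 * k" and "h4 = max a 0 + max d 0 - 2 * k"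
      and "h5 = max c 0 + max d 0 - k" and "h6 = max a 0 + max b 0 - k"
    note h = h1_def[unfolded a' c'] h2_def[unfolded b' d'] h3_def[unfolded b' c'] h4_def[unfolded a' d']
      h5_def[unfolded c' d'] h6_def[unfolded a' b']
    note lin = k k' t0 nn
    have k0: "\<not> k < 0" using k t0 nn by linarith
    have le1: "h1 \<le> k'" using h(1) lin by linarith
    have le2: "h2 \<le> k'" using h(2) lin by linarith
    have le3: "h3 \<le> k'" using h(3) lin by linarith
    have le4: "h4 \<le> k'" using h(4) lin by linarith
    have BD: "W 0 3 = 0 \<and> W 0 5 = 0 \<and> W 1 3 = 0 \<and> W 1 4 = 0 \<and> W 1 5 = 0 \<and> W 3 7 = 0 \<and> W 4 7 = 0
        \<and> W 5 7 = 0" if "W 2 6 \<noteq> 0"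
      by (intro conjI zero[OF that]) (simp_all add: cd)
    \<comment> \<open>\<open>min h (h div 2)\<close> is \<open>h div 2\<close> for
      \<open>h \<ge> 0\<close> and \<open>h\<close> for \<open>h < 0\<close>. A negative
      \<open>k'\<close> occurs only with copies of the second diagonal \<open>2 6\<close>, which
      remove all its crossings.\<close>
    have le5: "min h5 (h5 div 2) \<le> k'"
    proof (cases "W 2 6 = 0")
      case True
      then have "h5 \<le> 2 * k'" using h(5) lin by linarith
      then show ?thesis by linarith
    next
      case False
      then have "h5 \<le> k'" using h(5) lin BD by linarith
      then show ?thesis by linarith
    qed
    have le6: "min h6 (h6 div 2) \<le> k'"
    proof (cases "W 2 6 = 0")
      case True
      then have "h6 \<le> 2 * k'" using h(6) lin by linarith
      then show ?thesis by linarith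
    next
      case False
      then have "h6 \<le> k'" using h(6) lin BD by linarith
      then show ?thesis by linarith
    qed
    have "k' = h1 \<or> k' = h2 \<or> k' = h3 \<or> k' = h4 \<or> k' = min h5 (h5 div 2) \<or> k' = min h6 (h6 div 2)"
    proof -
      consider "W 0 3 \<noteq> 0" "W 0 5 \<noteq> 0" | "W 2 5 \<noteq> 0" "W 2 7 \<noteq> 0" | "W 4 7 \<noteq> 0" "W 1 4 \<noteq> 0"
        | "W 1 6 \<noteq> 0" "W 3 6 \<noteq> 0" | "W 0 3 = 0 \<or> W 0 5 = 0" "W 2 5 = 0 \<or> W 2 7 = 0"
          "W 4 7 = 0 \<or> W 1 4 = 0" "W 1 6 = 0 \<or> W 3 6 = 0" by blast
      then show ?thesis
      proof cases
        case 1
        have "W 1 4 = 0 \<and> W 1 5 = 0 \<and> W 1 6 = 0 \<and> W 1 7 = 0 \<and> W 2 5 = 0 \<and> W 2 6 = 0 \<and> W 2 7 = 0"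
          by (intro conjI zero[OF 1(1)]) (simp_all add: cd)
        moreover have "W 3 6 = 0 \<and> W 3 7 = 0 \<and> W 4 7 = 0"
          by (intro conjI zero[OF 1(2)]) (simp_all add: cd)
        ultimately have "k' = h3" using h(3) lin by linarith
        then show ?thesis by blast
      next
        case 2
        have "W 0 3 = 0 \<and> W 0 4 = 0 \<and> W 1 3 = 0 \<and> W 1 4 = 0 \<and> W 3 6 = 0 \<and> W 3 7 = 0 \<and> W 4 7 = 0"
          by (intro conjI zero[OF 2(1)]) (simp_all add: cd)
        moreover have "W 0 5 = 0 \<and> W 1 5 = 0 \<and> W 1 6 = 0"
          by (intro conjI zero[OF 2(2)]) (simp_all add: cd)
        ultimately have e: "k' = W 5 7 - W 2 6" "h5 = 2 * W 5 7 - W 2 6" using h(5) lin by linarith+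
        have "W 5 7 = 0 \<or> W 2 6 = 0" by (rule excl) (simp add: cd)
        then have "k' = min h5 (h5 div 2)" using e nn by auto
        then show ?thesis by blast
      next
        case 3
        have "W 0 5 = 0 \<and> W 1 5 = 0 \<and> W 1 6 = 0 \<and> W 2 5 = 0 \<and> W 2 6 = 0 \<and> W 3 5 = 0 \<and> W 3 6 = 0"
          by (intro conjI zero[OF 3(1)]) (simp_all add: cd)
        moreover have "W 0 3 = 0 \<and> W 2 7 = 0 \<and> W 3 7 = 0"
          by (intro conjI zero[OF 3(2)]) (simp_all add: cd)
        ultimately have "k' = h4" using h(4) lin by linarith
        then show ?thesis by blast
      next
        case 4
        have "W 0 3 = 0 \<and> W 0 5 = 0 \<and> W 2 7 = 0 \<and> W 3 7 = 0 \<and> W 4 7 = 0 \<and> W 5 7 = 0"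
          by (intro conjI zero[OF 4(1)]) (simp_all add: cd)
        moreover have "W 1 4 = 0 \<and> W 1 5 = 0 \<and> W 2 5 = 0"
          by (intro conjI zero[OF 4(2)]) (simp_all add: cd)
        ultimately have e: "k' = W 1 3 - W 2 6" "h6 = 2 * W 1 3 - W 2 6" using h(6) lin by linarith+
        have "W 1 3 = 0 \<or> W 2 6 = 0" by (rule excl) (simp add: cd)
        then have "k' = min h6 (h6 div 2)" using e nn by auto
        then show ?thesis by blast
      next
        case 5
        \<comment> \<open>Without fans the tropical Ptolemy relation holds: the five kinds tested
          here exclude the kinds \<open>1 5\<close>, \<open>0 5\<close>, \<open>2 5\<close>,
          \<open>1 6\<close>, \<open>1 4\<close>, some by crossing and some by the absence of fans.
          One of the two sums of opposite sides is therefore attained.\<close>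
        show ?thesis
        proof (cases "W 3 7 = 0 \<and> W 0 3 = 0 \<and> W 3 6 = 0 \<and> W 4 7 = 0 \<and> W 2 7 = 0")
          case t: True
          then have "k' = h1" using h(1) lin by linarith
          then show ?thesis by blast
        next
          case False
          then consider "W 3 7 \<noteq> 0" | "W 0 3 \<noteq> 0" | "W 3 6 \<noteq> 0" | "W 4 7 \<noteq> 0" | "W 2 7 \<noteq> 0" by blast
          then have "W 1 5 = 0 \<and> W 0 5 = 0 \<and> W 2 5 = 0 \<and> W 1 6 = 0 \<and> W 1 4 = 0"
          proof cases
            case 1 show ?thesis by (intro conjI zero[OF 1]) (simp_all add: cd)
          next
            case 2
            then have "W 0 5 = 0" using 5 by blast
            moreover have "W 1 5 = 0 \<and> W 2 5 = 0 \<and> W 1 6 = 0 \<and> W 1 4 = 0"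
              by (intro conjI zero[OF 2]) (simp_all add: cd)
            ultimately show ?thesis by blast
          next
            case 3
            then have "W 1 6 = 0" using 5 by blast
            moreover have "W 1 5 = 0 \<and> W 2 5 = 0 \<and> W 0 5 = 0 \<and> W 1 4 = 0"
              by (intro conjI zero[OF 3]) (simp_all add: cd)
            ultimately show ?thesis by blast
          next
            case 4
            then have "W 1 4 = 0" using 5 by blast
            moreover have "W 1 5 = 0 \<and> W 2 5 = 0 \<and> W 1 6 = 0 \<and> W 0 5 = 0"
              by (intro conjI zero[OF 4]) (simp_all add: cd)
            ultimately show ?thesis by blast
          next
            case t: 5
            then have "W 2 5 = 0" using 5 by blast
            moreover have "W 1 5 = 0 \<and> W 0 5 = 0 \<and> W 1 6 = 0 \<and> W 1 4 = 0"
              by (intro conjI zero[OF t]) (simp_all add: cd)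
            ultimately show ?thesis by blast
          qed
          then have "k' = h2" using h(2) lin by linarith
          then show ?thesis by blast
        qed
      qed
    qed
    then have "Max {h1, h2, h3, h4, min h5 (h5 div 2), min h6 (h6 div 2)} = k'"
      by (intro Max_eqI) (use le1 le2 le3 le4 le5 le6 in auto)
    then show ?thesis
      using k0 by (simp only: flip_count_def Let_def if_False h1_def h2_def h3_def h4_def h5_def h6_def)
  qed
qed

text \<open>The value - 1 at the chord itself matches the denominator vector of an initial
  variable.\<close>

definition crossing_number :: "nat \<Rightarrow> nat \<Rightarrow> nat \<Rightarrow> nat \<Rightarrow> int" where
  "crossing_number a b p q = (if same_chord a b p q then - 1 else if crosses a b p q then 1 else 0)"

text \<open>Collapses positions counted from the corner \<open>a\<close> to the eight labels; the
  parameters are the positions of the other corners.\<close>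

definition loc :: "nat \<Rightarrow> nat \<Rightarrow> nat \<Rightarrow> nat \<Rightarrow> nat" where
  "loc kb kc kd x = (if x = 0 then 0 else if x < kb then 1 else if x = kb then 2 else if x < kc then 3
     else if x = kc then 4 else if x < kd then 5 else if x = kd then 6 else 7)"

lemma loc_less_iff:
  assumes "0 < kb" "kb < kc" "kc < kd" "loc kb kc kd x \<noteq> loc kb kc kd y"
  shows "loc kb kc kd x < loc kb kc kd y \<longleftrightarrow> x < y"
  using assms unfolding loc_def by (auto split: if_splits)

lemma ccw_imp_distinct: "ccw x y z \<Longrightarrow> x \<noteq> y \<and> y \<noteq> z \<and> z \<noteq> x"
  by (auto simp: ccw_def)

lemma ccw_loc:
  assumes "0 < kb" "kb < kc" "kc < kd"
    and "loc kb kc kd x \<noteq> loc kb kc kd y" "loc kb kc kd y \<noteq> loc kb kc kd z" "loc kb kc kd z \<noteq> loc kb kc kd x"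
  shows "ccw (loc kb kc kd x) (loc kb kc kd y) (loc kb kc kd z) \<longleftrightarrow> ccw x y z"
  unfolding ccw_def using loc_less_iff[OF assms(1-3)] assms(4-6) by metis

lemma cr_loc:
  assumes k: "0 < kb" "kb < kc" "kc < kd" and e: "e \<in> {0, kb, kc, kd}" "f \<in> {0, kb, kc, kd}" "e \<noteq> f"
  defines "l \<equiv> loc kb kc kd"
  shows "crossing_number e f p q = crossing_number (l e) (l f) (l p) (l q)"
proof -
  have inj: "l x = l u \<longleftrightarrow> x = u" if "u \<in> {0, kb, kc, kd}" for x u
    using that k unfolding l_def loc_def by auto
  have c: "ccw e x f \<longleftrightarrow> ccw (l e) (l x) (l f)" "ccw f x e \<longleftrightarrow> ccw (l f) (l x) (l e)" for x
  proof -
    have "(ccw e x f \<longleftrightarrow> ccw (l e) (l x) (l f)) \<and> (ccw f x e \<longleftrightarrow> ccw (l f) (l x) (l e))"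
    proof (cases "x = e \<or> x = f")
      case True then show ?thesis by (auto simp: ccw_def)
    next
      case False
      then have "l x \<noteq> l e" "l x \<noteq> l f" "l e \<noteq> l f"
        using inj[OF e(1), of x] inj[OF e(2), of x] inj[OF e(2), of e] e(3) by simp_all
      then show ?thesis using ccw_loc[OF k] unfolding l_def by metis
    qed
    then show "ccw e x f \<longleftrightarrow> ccw (l e) (l x) (l f)" "ccw f x e \<longleftrightarrow> ccw (l f) (l x) (l e)" by blast+
  qed
  have "crosses e f p q \<longleftrightarrow> crosses (l e) (l f) (l p) (l q)"
    unfolding crosses_def by (simp only: c[symmetric])
  moreover have "same_chord e f p q \<longleftrightarrow> same_chord (l e) (l f) (l p) (l q)"
    unfolding same_chord_def using inj e by metis
  ultimately show ?thesis by (simp add: crossing_number_def)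
qed

section \<open>Weighted noncrossing families of chords\<close>

locale chord_family =
  fixes N :: nat and A :: "'a set" and P Q :: "'a \<Rightarrow> nat" and \<kappa> :: "'a \<Rightarrow> int"
  assumes fin: "finite A" and less: "x \<in> A \<Longrightarrow> P x < N" "x \<in> A \<Longrightarrow> Q x < N"
    and nonneg: "x \<in> A \<Longrightarrow> \<kappa> x \<ge> 0"
    and compat: "x \<in> A \<Longrightarrow> y \<in> A \<Longrightarrow> \<kappa> x \<noteq> 0 \<Longrightarrow> \<kappa> y \<noteq> 0 \<Longrightarrow> \<not> crosses (P x) (Q x) (P y) (Q y)"
begin

definition count :: "nat \<Rightarrow> nat \<Rightarrow> int" where
  "count a b = (\<Sum>x\<in>A. \<kappa> x * crossing_number a b (P x) (Q x))"

text \<open>The labels of the ends decide how a curve meets the chords between corners, so curves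
  are sorted by labels. Crossing labels force crossing curves, which is the exclusion hypothesis of
  \<open>flip_count_eq\<close>.\<close>

lemma count_flip:
  assumes abcd: "a < N" "b < N" "c < N" "d < N" "ccw a b c" "ccw c d a"
  shows "count b d = flip_count (count a b) (count b c) (count c d) (count d a) (count a c)"
proof -
  let ?K = "key N a"
  define kb kc kd where "kb = ?K b" and "kc = ?K c" and "kd = ?K d"
  have k: "0 < kb" "kb < kc" "kc < kd"
    using abcd ccw_key_from[of a N b c] ccw_key_from[of a N c d] ccw_rotate
    unfolding kb_def kc_def kd_def by auto
  define l where "l = (\<lambda>x. loc kb kc kd (?K x))"
  have le: "l a = 0" "l b = 2" "l c = 4" "l d = 6"
    using k by (auto simp: l_def loc_def kb_def kc_def kd_def)
  have l8: "l x < 8" for x by (simp add: l_def loc_def)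
  define w where "w = (\<lambda>i j. \<Sum>x | x \<in> A \<and> l (P x) = i \<and> l (Q x) = j. \<kappa> x)"
  define W where "W = (\<lambda>i j. w i j + w j i)"
  have crkey: "crosses (?K x) (?K y) (?K z) (?K u) \<longleftrightarrow> crosses x y z u" if "x < N" "y < N" "z < N" "u < N" for x y z u
    unfolding crosses_def using ccw_key abcd(1) that by simp
  have crossing_number: "crossing_number e f p q = crossing_number (l e) (l f) (l p) (l q)"
    if "e \<in> {a, b, c, d}" "f \<in> {a, b, c, d}" "e \<noteq> f" "p < N" "q < N" for e f p q
  proof -
    have ef: "e < N" "f < N" using that abcd by auto
    have "crossing_number e f p q = crossing_number (?K e) (?K f) (?K p) (?K q)"
      unfolding crossing_number_def same_chord_def using crkey ef that(4,5) key_eq_iff abcd(1) by simp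
    also have "\<dots> = crossing_number (l e) (l f) (l p) (l q)"
      unfolding l_def
      by (rule cr_loc[OF k]) (use that ef key_eq_iff[of a N e f] abcd(1) in \<open>auto simp: kb_def kc_def kd_def\<close>)
    finally show ?thesis .
  qed
  have count: "count e f = (\<Sum>i<8. \<Sum>j<8. w i j * crossing_number (l e) (l f) i j)"
    if "e \<in> {a, b, c, d}" "f \<in> {a, b, c, d}" "e \<noteq> f" for e f
  proof -
    let ?h = "\<lambda>x. \<kappa> x * crossing_number (l e) (l f) (l (P x)) (l (Q x))"
    have "count e f = (\<Sum>x\<in>A. ?h x)"
      unfolding count_def by (intro sum.cong refl) (use crossing_number that less in simp)
    also have "\<dots> = (\<Sum>ij\<in>{..<8} \<times> {..<8}. \<Sum>x | x \<in> A \<and> (l (P x), l (Q x)) = ij. ?h x)"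
      by (rule sum.group[symmetric]) (use fin l8 in auto)
    also have "\<dots> = (\<Sum>ij\<in>{..<8} \<times> {..<8}. w (fst ij) (snd ij) * crossing_number (l e) (l f) (fst ij) (snd ij))"
      by (intro sum.cong refl) (auto simp: w_def sum_distrib_right intro!: sum.cong)
    finally show ?thesis by (simp add: sum.cartesian_product case_prod_beta)
  qed
  have wn: "w i j \<ge> 0" for i j
    unfolding w_def by (rule sum_nonneg) (use nonneg in auto)
  have wpos: "\<exists>x\<in>A. \<kappa> x \<noteq> 0 \<and> l (P x) = i \<and> l (Q x) = j" if "w i j \<noteq> 0" for i j
  proof -
    obtain x where "x \<in> {x. x \<in> A \<and> l (P x) = i \<and> l (Q x) = j}" "\<kappa> x \<noteq> 0"
      using \<open>w i j \<noteq> 0\<close> unfolding w_def by (rule sum.not_neutral_contains_not_neutral)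
    then show ?thesis by auto
  qed
  \<comment> \<open>\<open>ccw\<close> compares only distinct labels, and on these the labels are
    ordered like the vertices.\<close>
  have crl: "crosses p q p' q'" if "crosses (l p) (l q) (l p') (l q')" "p < N" "q < N" "p' < N" "q' < N" for p q p' q'
  proof -
    let ?l = "loc kb kc kd"
    have "crosses (?K p) (?K q) (?K p') (?K q')"
      using that(1) ccw_loc[OF k] ccw_imp_distinct unfolding crosses_def l_def by metis
    then show ?thesis using crkey that by blast
  qed
  have excl: "w i j = 0 \<or> w i' j' = 0" if "crosses i j i' j'" for i j i' j'
  proof (rule ccontr)
    assume "\<not> ?thesis"
    then obtain x y where x: "x \<in> A" "\<kappa> x \<noteq> 0" "l (P x) = i" "l (Q x) = j"
      and y: "y \<in> A" "\<kappa> y \<noteq> 0" "l (P y) = i'" "l (Q y) = j'"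
      using wpos by blast
    then have "crosses (P x) (Q x) (P y) (Q y)" using crl that less by simp
    then show False using compat x y by blast
  qed
  have Wn: "W i j \<ge> 0" for i j using wn by (simp add: W_def)
  have We: "W i j = 0 \<or> W i' j' = 0" if "crosses i j i' j'" for i j i' j'
  proof -
    have "w i j = 0 \<or> w i' j' = 0" "w i j = 0 \<or> w j' i' = 0" "w j i = 0 \<or> w i' j' = 0" "w j i = 0 \<or> w j' i' = 0"
      using that crs_swap excl by blast+
    then show ?thesis by (auto simp: W_def)
  qed
  have ne: "a \<noteq> b" "b \<noteq> c" "c \<noteq> d" "d \<noteq> a" "a \<noteq> c" "b \<noteq> d"
    using abcd unfolding ccw_def by auto
  have 8: "{..<8::nat} = {0,1,2,3,4,5,6,7}" by auto
  note ev = 8 crossing_number_def same_chord_def crosses_def ccw_def W_def le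
  have c1: "count a b = W 1 3 + W 1 4 + W 1 5 + W 1 6 + W 1 7 - W 0 2"
    by (subst count) (use ne in \<open>simp_all add: ev\<close>)
  have c2: "count b c = W 0 3 + W 1 3 + W 3 5 + W 3 6 + W 3 7 - W 2 4"
    by (subst count) (use ne in \<open>simp_all add: ev\<close>)
  have c3: "count c d = W 0 5 + W 1 5 + W 2 5 + W 3 5 + W 5 7 - W 4 6"
    by (subst count) (use ne in \<open>simp_all add: ev\<close>)
  have c4: "count d a = W 1 7 + W 2 7 + W 3 7 + W 4 7 + W 5 7 - W 0 6"
    by (subst count) (use ne in \<open>simp_all add: ev\<close>)
  have c5: "count a c = W 1 5 + W 1 6 + W 1 7 + W 2 5 + W 2 6 + W 2 7 + W 3 5 + W 3 6 + W 3 7 - W 0 4"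
    by (subst count) (use ne in \<open>simp_all add: ev\<close>)
  have c6: "count b d = W 0 3 + W 0 4 + W 0 5 + W 1 3 + W 1 4 + W 1 5 + W 3 7 + W 4 7 + W 5 7 - W 2 6"
    by (subst count) (use ne in \<open>simp_all add: ev\<close>)
  show ?thesis
    by (rule flip_count_eq[of W, OF Wn _ c1 c2 c3 c4 c5 c6]) (rule We)
qed

end

section \<open>Mutation of seeds\<close>

text \<open>The vanishing diagonal entry keeps variable k out of the exchange polynomial, whose
  value is therefore the same at both clusters.\<close>

lemma alg_indep_mutate:
  assumes x: "alg_indep x" and B: "B $ k $ k = 0"
  shows "alg_indep (mutate_cluster k B x)"
proof (rule alg_indep_exchange[OF x])
  define E where "E = monomial (\<lambda>i. nat (pos_part (B $ i $ k))) + monomial (\<lambda>i. nat (pos_part (- B $ i $ k)))"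
  have E: "eval_poly \<phi> E = (\<Prod>i\<in>UNIV. \<phi> i ^ nat (pos_part (B $ i $ k))) +
      (\<Prod>i\<in>UNIV. \<phi> i ^ nat (pos_part (- B $ i $ k)))" for \<phi> :: "'a \<Rightarrow> 'b::comm_ring_1"
    by (simp add: E_def eval_poly_add eval_monomial)
  show "mutate_cluster k B x $ i = x $ i" if "i \<noteq> k" for i
    using that by (simp add: mutate_cluster_def)
  show "mutate_cluster k B x $ k = inverse (x $ k) * eval_poly (($) x) E"
    by (simp add: mutate_cluster_def E)
  have "mutate_cluster k B x $ i ^ nat (pos_part (c * B $ i $ k)) = x $ i ^ nat (pos_part (c * B $ i $ k))" for i c
    using B by (cases "i = k") (auto simp: mutate_cluster_def pos_part_def)
  from this[of _ 1] this[of _ "- 1"]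
  show "eval_poly (($) (mutate_cluster k B x)) E = eval_poly (($) x) E"
    by (simp add: E)
  \<comment> \<open>At the point with all coordinates 1 the exchange polynomial is 2.\<close>
  show "eval_poly (($) x) E \<noteq> 0"
    by (rule alg_indep_eval_nonzero[OF x]) (simp add: E)
qed

definition skew_by :: "('n \<Rightarrow> int) \<Rightarrow> 'n::finite int_matrix \<Rightarrow> bool" where
  "skew_by s B \<longleftrightarrow> (\<forall>i. s i > 0) \<and> (\<forall>i j. s i * B $ i $ j = - (s j * B $ j $ i))"

lemma skew_symmetrizable_imp_skew_by:
  fixes B :: "'n::finite int_matrix"
  assumes "skew_symmetrizable B"
  shows "\<exists>s. skew_by s B"
proof -
  obtain S :: "'n int_matrix" where S: "\<And>i. S $ i $ i > 0" "\<And>i j. i \<noteq> j \<Longrightarrow> S $ i $ j = 0"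
    "transpose (S ** B) = - (S ** B)"
    using assms unfolding skew_symmetrizable_def by blast
  have SB: "(S ** B) $ i $ j = S $ i $ i * B $ i $ j" for i j
  proof -
    have "(S ** B) $ i $ j = (\<Sum>k\<in>UNIV. S $ i $ k * B $ k $ j)"
      by (simp add: matrix_matrix_mult_def)
    also have "\<dots> = (\<Sum>k\<in>UNIV. if k = i then S $ i $ i * B $ i $ j else 0)"
      by (rule sum.cong) (auto simp: S(2))
    finally show ?thesis by simp
  qed
  have "S $ i $ i * B $ i $ j = - (S $ j $ j * B $ j $ i)" for i j
  proof -
    have "transpose (S ** B) $ j $ i = - (S ** B) $ j $ i" using S(3) by simp
    then show ?thesis by (simp add: transpose_def SB)
  qed
  then show ?thesis using S(1) unfolding skew_by_def by (intro exI[of _ "\<lambda>i. S $ i $ i"]) blast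
qed

lemma skew_by_diag: "skew_by s B \<Longrightarrow> B $ i $ i = 0"
  unfolding skew_by_def by (metis eq_neg_iff_add_eq_0 mult_eq_0_iff double_zero less_irrefl)

lemma pos_part_scale: "(c::int) \<ge> 0 \<Longrightarrow> c * pos_part b = pos_part (c * b)"
  by (auto simp: pos_part_def max_def mult_le_0_iff zero_le_mult_iff)

lemma pos_part_diff: "pos_part b - pos_part (- b) = b"
  by (auto simp: pos_part_def)

lemma pos_part_mixed:
  "pos_part u * v + u * pos_part (- v) = pos_part u * pos_part v - pos_part (- u) * pos_part (- v)"
  by (auto simp: pos_part_def max_def algebra_simps)

text \<open>In the form of \<open>pos_part_mixed\<close> the correction is a difference of two
  products, and after scaling by \<open>s\<close> a transposition exchanges them.\<close>

lemma skew_by_mutate: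
  assumes "skew_by s B"
  shows "skew_by s (mutate_matrix k B)"
proof -
  have s: "s i > 0" and B: "s i * B $ i $ j = - (s j * B $ j $ i)" for i j
    using assms unfolding skew_by_def by blast+
  have "s i * mutate_matrix k B $ i $ j = - (s j * mutate_matrix k B $ j $ i)" for i j
  proof (cases "i = k \<or> j = k")
    case True
    then show ?thesis using B[of i j] by (auto simp: mutate_matrix_def)
  next
    case False
    have p: "s k * (s i * pos_part (c * B $ i $ k)) = s k * (s k * pos_part (- (c * B $ k $ i)))" for c i
    proof -
      have "s i * (c * B $ i $ k) = s k * (- (c * B $ k $ i))"
        using B[of i k] by (simp add: algebra_simps)
      then show ?thesis using s[of i] s[of k] by (simp add: pos_part_scale)
    qed
    let ?t = "\<lambda>i j. pos_part (B $ i $ k) * B $ k $ j + B $ i $ k * pos_part (- B $ k $ j)"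
    have pb: "s i * pos_part (B $ i $ k) = s k * pos_part (- B $ k $ i)"
      "s i * pos_part (- B $ i $ k) = s k * pos_part (B $ k $ i)" for i
      using p[of i 1] p[of i "-1"] s[of k] by simp_all
    have t: "s i * ?t i j = s k * (pos_part (- B $ k $ i) * pos_part (B $ k $ j)
       - pos_part (B $ k $ i) * pos_part (- B $ k $ j))" for i j
      unfolding pos_part_mixed using pb[of i] by (simp add: right_diff_distrib mult.assoc[symmetric])
    have "s i * ?t i j = - (s j * ?t j i)"
      unfolding t by (simp add: algebra_simps)
    then show ?thesis using False B[of i j] by (simp add: mutate_matrix_def algebra_simps)
  qed
  then show ?thesis using s unfolding skew_by_def by blast
qed

definition good_seed :: "'n::{finite,linorder} seed \<Rightarrow> bool" where
  "good_seed \<Sigma> \<longleftrightarrow> alg_indep (snd \<Sigma>) \<and> (\<exists>s. skew_by s (fst \<Sigma>))"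

lemma labeled_seed_imp_good_seed: "labeled_seed \<Sigma> \<Longrightarrow> good_seed \<Sigma>"
  by (simp add: labeled_seed_def good_seed_def free_generating_imp_alg_indep skew_symmetrizable_imp_skew_by)

lemma good_seed_mutate: "good_seed \<Sigma> \<Longrightarrow> good_seed (mutate k \<Sigma>)"
  unfolding good_seed_def mutate_def using alg_indep_mutate skew_by_mutate skew_by_diag by fastforce

lemma mutate_matrix_involutive: "mutate_matrix k (mutate_matrix k B) = B"
proof -
  have "mutate_matrix k (mutate_matrix k B) $ i $ j = B $ i $ j" for i j
    using pos_part_diff[of "B $ i $ k"] pos_part_diff[of "B $ k $ j"]
    by (auto simp: mutate_matrix_def algebra_simps)
  then show ?thesis by (simp add: vec_eq_iff)
qed

lemma mutate_involutive:
  assumes "good_seed \<Sigma>"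
  shows "mutate k (mutate k \<Sigma>) = \<Sigma>"
proof -
  obtain B x where \<Sigma>: "\<Sigma> = (B, x)" by (cases \<Sigma>)
  have x: "alg_indep x" and B: "B $ k $ k = 0"
    using assms skew_by_diag unfolding \<Sigma> good_seed_def by auto
  let ?B = "mutate_matrix k B" and ?y = "mutate_cluster k B x"
  have Bk: "?B $ i $ k = - B $ i $ k" for i by (simp add: mutate_matrix_def)
  have yp: "?y $ i ^ nat (pos_part (c * B $ i $ k)) = x $ i ^ nat (pos_part (c * B $ i $ k))" for i c
    using B by (cases "i = k") (auto simp: mutate_cluster_def pos_part_def)
  let ?p = "\<Prod>i\<in>UNIV. x $ i ^ nat (pos_part (B $ i $ k))"
  let ?n = "\<Prod>i\<in>UNIV. x $ i ^ nat (pos_part (- B $ i $ k))"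
  have "mutate_cluster k ?B ?y $ k = inverse (?y $ k) * (?n + ?p)"
    using yp[of _ 1] yp[of _ "- 1"] by (simp add: mutate_cluster_def[of k ?B] Bk)
  moreover have yk: "?y $ k = inverse (x $ k) * (?p + ?n)" by (simp add: mutate_cluster_def)
  moreover have "?y $ k \<noteq> 0" "x $ k \<noteq> 0"
    using alg_indep_nonzero alg_indep_mutate[OF x B] x by blast+
  ultimately have "mutate_cluster k ?B ?y $ k = x $ k"
    by (simp add: add.commute)
  then have "mutate_cluster k ?B ?y = x"
    by (auto simp: vec_eq_iff mutate_cluster_def)
  then show ?thesis by (simp add: \<Sigma> mutate_def mutate_matrix_involutive)
qed

lemma good_seed_fold: "good_seed \<Sigma> \<Longrightarrow> good_seed (fold mutate v \<Sigma>)"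
  by (induction v arbitrary: \<Sigma>) (auto simp: good_seed_mutate)

text \<open>Walking back along a path makes every seed available as the root.\<close>

lemma fold_mutate_rev: "good_seed \<Sigma> \<Longrightarrow> fold mutate (rev v) (fold mutate v \<Sigma>) = \<Sigma>"
  by (induction v arbitrary: \<Sigma>) (auto simp: good_seed_mutate mutate_involutive)

section \<open>Seeds from triangulations\<close>

lemma cr_swap: "crossing_number a b p q = crossing_number b a p q" "crossing_number a b p q = crossing_number a b q p"
  unfolding crossing_number_def using eqc_swap(1,2)[of a b p q] crs_swap(1,2)[of a b p q] by simp_all

context symmetric_polygon
begin

lemma r_cr: "a < N \<Longrightarrow> b < N \<Longrightarrow> c < N \<Longrightarrow> d < N \<Longrightarrow> crossing_number (r a) (r b) (r c) (r d) = crossing_number a b c d"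
  by (simp add: crossing_number_def r_crs r_eqc)

lemma cr_r: "a < N \<Longrightarrow> b < N \<Longrightarrow> c < N \<Longrightarrow> d < N \<Longrightarrow> crossing_number (r a) (r b) c d = crossing_number a b (r c) (r d)"
  using r_cr[of a b "r c" "r d"] by (simp add: r_r r_less)

definition diagonal_pattern :: "'n set \<Rightarrow> ('n \<Rightarrow> nat \<times> nat) \<Rightarrow> bool" where
  "diagonal_pattern \<Delta> L \<longleftrightarrow> (\<forall>i. r (fst (L i)) = snd (L i) \<longleftrightarrow> i \<in> \<Delta>)"

end

text \<open>The quadrilateral around a diameter is mapped to itself by \<open>r\<close>, so its
  other diagonal is a diameter too; the converse is the same argument after the flip. Labels of
  diameters thus remain labels of diameters.\<close>

lemma (in orbit_flip) diameter_flip: "r b = d \<longleftrightarrow> r a = c"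
proof
  assume "r a = c"
  then have "r c = a" using lt r_r by auto
  then have "quad (chords L) c (r b) a (r d)" using quad_r[OF L q] \<open>r a = c\<close> by simp
  then show "r b = d" using quad_unique(1)[OF T quad_swap[OF L q]] by metis
next
  assume "r b = d"
  then have "r d = b" using lt r_r by auto
  then have "quad (chords L') d (r c) b (r a)"
    using quad_r[OF labelled_tri_L' quad_new] \<open>r b = d\<close> by simp
  then have "r c = a"
    using quad_unique(1)[OF tri_L' quad_swap[OF labelled_tri_L' quad_new]] by metis
  then show "r a = c" using lt r_r by auto
qed

text \<open>The property by which equality of two functions on chords spreads from one triangulation
  to the others.\<close>

definition flippable :: "nat \<Rightarrow> (nat \<Rightarrow> nat \<Rightarrow> int) \<Rightarrow> bool" where
  "flippable N C \<longleftrightarrow> (\<forall>a b. C a b = C b a) \<and>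
     (\<forall>a<N. \<forall>b<N. \<forall>c<N. \<forall>d<N. ccw a b c \<longrightarrow> ccw c d a \<longrightarrow>
        C b d = flip_count (C a b) (C b c) (C c d) (C d a) (C a c))"

text \<open>The indices in \<open>\<Delta>\<close> label diameters. The exchange matrix is rescaled by \<open>W\<close> at a diameter,
  whose length is the \<open>W\<close>-th power of its cluster variable, and \<open>D\<close> converts denominators into
  crossing numbers summed over orbits.\<close>

locale cluster_model = symmetric_polygon N r for N r +
  fixes Y :: "nat \<Rightarrow> nat \<Rightarrow> 'n::{finite,linorder} ratfun" and \<Delta> :: "'n set" and W :: nat and D :: "'n \<Rightarrow> int"
  assumes W: "W = 1 \<or> W = 2"
    and Y_swap: "a < N \<Longrightarrow> b < N \<Longrightarrow> Y a b = Y b a"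
    and Y_r: "a < N \<Longrightarrow> b < N \<Longrightarrow> Y (r a) (r b) = Y a b"
    and Y_bdry: "bdry N a b \<Longrightarrow> Y a b = 1"
    and exchange: "labelled_tri L \<Longrightarrow> diagonal_pattern \<Delta> L \<Longrightarrow> quad (chords L) a b c d \<Longrightarrow> L k = (a, c) \<Longrightarrow>
      Y a c * Y b d =
        (if W = 2 \<and> k \<in> \<Delta> then Y a b ^ (if r a = b then W else 1) + Y b c ^ (if r b = c then W else 1)
         else Y a b ^ (if r a = b then W else 1) * Y c d ^ (if r c = d then W else 1) +
              Y b c ^ (if r b = c then W else 1) * Y d a ^ (if r d = a then W else 1))"
    and denominator: "labelled_tri L \<Longrightarrow> diagonal_pattern \<Delta> L \<Longrightarrow> alg_indep x \<Longrightarrow>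
      (\<And>i. x $ i = Y (fst (L i)) (snd (L i))) \<Longrightarrow> edge N p q \<Longrightarrow> \<not> bdry N p q \<Longrightarrow>
      \<exists>e. laurent_denom x (Y p q) e \<and>
        (\<forall>i. e i * D i * int (if r p = q then W else 1) =
           crossing_number (fst (L i)) (snd (L i)) p q + crossing_number (r (fst (L i))) (r (snd (L i))) p q)"
begin

definition wt :: "nat \<Rightarrow> nat \<Rightarrow> nat" where "wt a b = (if r a = b then W else 1)"

definition X :: "nat \<Rightarrow> nat \<Rightarrow> 'n ratfun" where "X a b = Y a b ^ wt a b"

definition wn :: "'n \<Rightarrow> nat" where "wn i = (if i \<in> \<Delta> then W else 1)"

lemma wt_swap: "a < N \<Longrightarrow> b < N \<Longrightarrow> wt a b = wt b a"
  unfolding wt_def using r_r by metis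

lemma wt_r: "a < N \<Longrightarrow> b < N \<Longrightarrow> wt (r a) (r b) = wt a b"
  by (simp add: wt_def r_eq_iff r_less)

lemma X_swap: "a < N \<Longrightarrow> b < N \<Longrightarrow> X a b = X b a"
  unfolding X_def using Y_swap wt_swap by metis

lemma X_r: "a < N \<Longrightarrow> b < N \<Longrightarrow> X (r a) (r b) = X a b"
  by (simp add: X_def Y_r wt_r)

lemma orb_invariant:
  assumes "orb c x y" "fst c < N" "snd c < N"
    and "\<And>a b. a < N \<Longrightarrow> b < N \<Longrightarrow> f a b = f b a" "\<And>a b. a < N \<Longrightarrow> b < N \<Longrightarrow> f (r a) (r b) = f a b"
  shows "f x y = f (fst c) (snd c)"
proof -
  have "f (r (snd c)) (r (fst c)) = f (fst c) (snd c)"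
    using assms(2-) by simp
  then show ?thesis
    using assms(1) assms(4)[OF assms(2,3)] assms(5)[OF assms(2,3)] unfolding orb_def same_chord_def by auto
qed

text \<open>The integers \<open>\<beta>\<close> carry a factor 2 in the column of a diameter.
  Rescaling by \<open>wn\<close> leaves it there for \<open>W = 1\<close>, as in type B, and moves
  it to the row for \<open>W = 2\<close>, as in type C.\<close>

definition seed_tri :: "('n \<Rightarrow> nat \<times> nat) \<Rightarrow> 'n seed \<Rightarrow> bool" where
  "seed_tri L \<Sigma> \<longleftrightarrow> labelled_tri L \<and> diagonal_pattern \<Delta> L \<and>
     (\<exists>\<beta>. exchange_matrix L \<beta> \<and> (\<forall>i k. fst \<Sigma> $ i $ k * int (wn k) = int (wn i) * \<beta> i k)) \<and>
     (\<forall>i. snd \<Sigma> $ i = Y (fst (L i)) (snd (L i))) \<and> alg_indep (snd \<Sigma>)"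

lemma prod_chord:
  assumes L: "labelled_tri L" "diagonal_pattern \<Delta> L" and xy: "chords L x y"
  shows "(\<Prod>i\<in>UNIV. Y (fst (L i)) (snd (L i)) ^ (wn i * nat (ind L i x y))) = X x y"
proof (cases "bdry N x y")
  case True
  then have "ind L i x y = 0" for i using ltri_orb_nbdry[OF L(1)] by (auto simp: ind_def)
  then show ?thesis using True by (simp add: X_def Y_bdry)
next
  case False
  then obtain j where j: "orb (L j) x y" using xy unfolding chords_def by blast
  have "ind L i x y = (if i = j then 1 else 0)" for i
    using j ltri_inj[OF L(1), of i x y j] by (cases "i = j") (auto simp: ind_def)
  then have "Y (fst (L i)) (snd (L i)) ^ (wn i * nat (ind L i x y)) =
      (if i = j then Y (fst (L j)) (snd (L j)) ^ wn j else 1)" for i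
    by simp
  then have "(\<Prod>i\<in>UNIV. Y (fst (L i)) (snd (L i)) ^ (wn i * nat (ind L i x y))) = Y (fst (L j)) (snd (L j)) ^ wn j"
    by simp
  also have "\<dots> = X (fst (L j)) (snd (L j))"
    using L(2) by (simp add: X_def wt_def wn_def diagonal_pattern_def)
  also have "\<dots> = X x y"
    by (rule orb_invariant[of _ _ _ X, OF j ltri_less[OF L(1)] X_swap X_r, symmetric])
  finally show ?thesis .
qed

lemma ind_sum_nat: "nat (int w * (ind L i x y + ind L i z u)) = w * nat (ind L i x y) + w * nat (ind L i z u)"
  by (simp add: ind_def nat_mult_distrib)

text \<open>\<open>exchange\<close> is a relation between lengths; \<open>prod_chord\<close>
  replaces each side by a power of its cluster variable, with the exponent prescribed by
  \<open>B\<close>.\<close>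

lemma exchange_product:
  assumes \<Sigma>: "seed_tri L (B, x)" and q: "quad (chords L) a b c d" and k: "L k = (a, c)"
  shows "Y a c * Y b d = (\<Prod>i\<in>UNIV. x $ i ^ nat (pos_part (B $ i $ k))) +
      (\<Prod>i\<in>UNIV. x $ i ^ nat (pos_part (- B $ i $ k)))"
proof -
  have L: "labelled_tri L" "diagonal_pattern \<Delta> L" and x: "\<And>i. x $ i = Y (fst (L i)) (snd (L i))"
    using \<Sigma> unfolding seed_tri_def by auto
  obtain \<beta> where E: "exchange_matrix L \<beta>" and \<beta>: "\<And>i k. B $ i $ k * int (wn k) = int (wn i) * \<beta> i k"
    using \<Sigma> unfolding seed_tri_def by auto
  have ac: "orb (L k) a c" using k by simp
  note parts = exchange_matrix_parts[OF L(1) E q ac]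
  have ch: "chords L a b" "chords L b c" "chords L c d" "chords L d a"
    using q by (auto simp: quad_def)
  note P = prod_chord[OF L]
  note lt = quad_less[OF ltri_tri[OF L(1)] q]
  note ex = exchange[OF L q k, folded wt_def, folded X_def]
  show ?thesis
  proof (cases "W = 2 \<and> k \<in> \<Delta>")
    case False
    then have "wn k = 1" using W by (auto simp: wn_def)
    then have B: "B $ i $ k = int (wn i) * \<beta> i k" for i using \<beta>[of i k] by simp
    have "pos_part (B $ i $ k) = int (wn i) * (ind L i a b + ind L i c d)"
      "pos_part (- B $ i $ k) = int (wn i) * (ind L i b c + ind L i d a)" for i
      using pos_part_scale[of "int (wn i)" "\<beta> i k"] pos_part_scale[of "int (wn i)" "- \<beta> i k"] parts[of i]
      by (simp_all add: B)
    then show ?thesis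
      using ex False ch by (simp add: ind_sum_nat x power_add prod.distrib P)
  next
    case True
    then have wk: "wn k = 2" unfolding wn_def by simp
    have "r a = c" using L(2) True k unfolding diagonal_pattern_def by (metis fst_conv snd_conv)
    then have rc: "r c = a" using lt r_r by auto
    interpret orbit_flip N r L k a b c d
      by unfold_locales (use L q k in auto)
    have rb: "r b = d" "r d = b" using diameter_flip \<open>r a = c\<close> lt r_r by auto
    \<comment> \<open>\<open>r\<close> preserves the quadrilateral of a diameter, so opposite sides
      have one label. The column of \<open>B\<close> is half that of \<open>\<beta>\<close> up to
      the row factor \<open>wn\<close>, which leaves one factor for each pair of sides.\<close>
    have i2: "ind L i c d = ind L i a b" "ind L i d a = ind L i b c" for i
      using ind_r[OF L(1) lt(1,2), of i] ind_r[OF L(1) lt(2,3), of i] rb rc \<open>r a = c\<close> by auto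
    have B2: "B $ i $ k = int (wn i) * (ind L i a b - ind L i b c)" for i
      using \<beta>[of i k] E q ac i2 unfolding exchange_matrix_def quad_sum_def by (simp add: wk algebra_simps)
    have b: "\<beta> i k = 2 * (ind L i a b - ind L i b c)" for i
      using E q ac i2 unfolding exchange_matrix_def quad_sum_def by simp
    have "pos_part (ind L i a b - ind L i b c) = ind L i a b" "pos_part (- (ind L i a b - ind L i b c)) = ind L i b c" for i
      using parts[of i] pos_part_scale[of 2 "ind L i a b - ind L i b c"]
        pos_part_scale[of 2 "- (ind L i a b - ind L i b c)"] by (simp_all add: b i2)
    then have "pos_part (B $ i $ k) = int (wn i) * ind L i a b"
      "pos_part (- B $ i $ k) = int (wn i) * ind L i b c" for i
      using pos_part_scale[of "int (wn i)" "ind L i a b - ind L i b c"]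
        pos_part_scale[of "int (wn i)" "- (ind L i a b - ind L i b c)"]
      by (simp_all add: B2 flip: mult_minus_right)
    then show ?thesis
      unfolding ex if_P[OF True] using ch by (simp add: x nat_mult_distrib P)
  qed
qed

lemma seed_tri_mutate:
  assumes \<Sigma>: "seed_tri L \<Sigma>"
  obtains a b c d where "quad (chords L) a b c d" "L k = (a, c)" "seed_tri (L(k := (b, d))) (mutate k \<Sigma>)"
proof -
  obtain B x where Bx: "\<Sigma> = (B, x)" by (cases \<Sigma>)
  have LL: "labelled_tri L" "diagonal_pattern \<Delta> L" and x: "\<And>i. x $ i = Y (fst (L i)) (snd (L i))"
    and indep: "alg_indep x"
    using \<Sigma> unfolding seed_tri_def Bx by auto
  obtain \<beta> where E: "exchange_matrix L \<beta>" and \<beta>: "\<And>i k. B $ i $ k * int (wn k) = int (wn i) * \<beta> i k"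
    using \<Sigma> unfolding seed_tri_def Bx by auto
  define a c where "a = fst (L k)" and "c = snd (L k)"
  have k: "L k = (a, c)" by (simp add: a_def c_def)
  obtain b d where q: "quad (chords L) a b c d"
    using quad_exists[OF ltri_tri[OF LL(1)], of a c] chords_orb[of L k a c] ltri_nbdry[OF LL(1), of k]
    by (auto simp: k)
  interpret orbit_flip N r L k a b c d
    by unfold_locales (use LL q k in auto)
  have wpos: "int (wn i) > 0" for i using W by (auto simp: wn_def)
  \<comment> \<open>Positive parts commute with the positive factors \<open>wn\<close>, so rescaling
    commutes with mutation.\<close>
  have Bmut: "mutate_matrix k B $ i $ j * int (wn j) = int (wn i) * mutate_fun k \<beta> i j" for i j
  proof (cases "i = k \<or> j = k")
    case True then show ?thesis using \<beta>[of i j] by (auto simp: mutate_matrix_def mutate_fun_def)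
  next
    case False
    have e: "pos_part (B $ i $ k) * B $ k $ j * int (wn j) = int (wn i) * (pos_part (\<beta> i k) * \<beta> k j)"
    proof -
      have "pos_part (B $ i $ k) * B $ k $ j * int (wn j) = (int (wn k) * pos_part (B $ i $ k)) * \<beta> k j"
        using \<beta>[of k j] by (simp add: mult_ac)
      also have "int (wn k) * pos_part (B $ i $ k) = int (wn i) * pos_part (\<beta> i k)"
        using \<beta>[of i k] pos_part_scale[of "int (wn k)" "B $ i $ k"] pos_part_scale[of "int (wn i)" "\<beta> i k"]
        by (simp add: mult.commute)
      finally show ?thesis by (simp add: mult_ac)
    qed
    have f: "B $ i $ k * pos_part (- B $ k $ j) * int (wn j) = int (wn i) * (\<beta> i k * pos_part (- \<beta> k j))"
    proof -
      have "int (wn j) * pos_part (- B $ k $ j) = int (wn k) * pos_part (- \<beta> k j)"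
        using \<beta>[of k j] pos_part_scale[of "int (wn j)" "- B $ k $ j"] pos_part_scale[of "int (wn k)" "- \<beta> k j"]
        by (simp add: mult.commute)
      then have "B $ i $ k * pos_part (- B $ k $ j) * int (wn j) = (B $ i $ k * int (wn k)) * pos_part (- \<beta> k j)"
        by (simp add: mult_ac)
      then show ?thesis using \<beta>[of i k] by (simp add: mult_ac)
    qed
    show ?thesis
      using e f \<beta>[of i j] False by (simp add: mutate_matrix_def mutate_fun_def distrib_left distrib_right)
  qed
  have "\<beta> k k = 0"
    using E q k quad_side_not_orb[OF q] unfolding exchange_matrix_def quad_sum_def ind_def by auto
  then have "B $ k $ k = 0" using \<beta>[of k k] wpos[of k] by auto
  then have indep': "alg_indep (mutate_cluster k B x)" by (rule alg_indep_mutate[OF indep])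
  have "Y a c \<noteq> 0" using alg_indep_nonzero[OF indep, of k] x[of k] k by simp
  then have "Y b d = inverse (Y a c) * (Y a c * Y b d)" by simp
  also have "\<dots> = mutate_cluster k B x $ k"
    using exchange_product[OF \<Sigma>[unfolded Bx] q k] x[of k] k by (simp add: mutate_cluster_def)
  finally have yk: "mutate_cluster k B x $ k = Y b d" ..
  have "seed_tri L' (mutate_matrix k B, mutate_cluster k B x)"
    unfolding seed_tri_def
  proof (intro conjI labelled_tri_L' allI)
    show "diagonal_pattern \<Delta> L'"
      unfolding diagonal_pattern_def
    proof
      fix i
      have "r (fst (L i)) = snd (L i) \<longleftrightarrow> i \<in> \<Delta>" using LL(2) unfolding diagonal_pattern_def by blast
      then show "r (fst (L' i)) = snd (L' i) \<longleftrightarrow> i \<in> \<Delta>"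
        using diameter_flip k by (cases "i = k") (auto simp: L'_def)
    qed
    show "\<exists>\<beta>. exchange_matrix L' \<beta> \<and> (\<forall>i k'. fst (mutate_matrix k B, mutate_cluster k B x) $ i $ k' * int (wn k') = int (wn i) * \<beta> i k')"
      using exchange_matrix_L'[OF E] Bmut by auto
    show "snd (mutate_matrix k B, mutate_cluster k B x) $ i = Y (fst (L' i)) (snd (L' i))" for i
      using yk x by (cases "i = k") (auto simp: L'_def mutate_cluster_def)
    show "alg_indep (snd (mutate_matrix k B, mutate_cluster k B x))" using indep' by simp
  qed
  then show thesis using that[OF q k] by (simp add: Bx mutate_def L'_def)
qed

text \<open>A flip adds only the orbit of \<open>b d\<close>, where both functions are
  \<open>flip_count\<close> of five values on old chords. The final triangulation does not depend on
  the pair of functions, so the crossing numbers of any two monomials can be inserted.\<close>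

lemma seed_tri_transfer:
  assumes "seed_tri L \<Sigma>"
  shows "\<exists>L'. seed_tri L' (fold mutate v \<Sigma>) \<and>
    (\<forall>C C'. flippable N C \<longrightarrow> flippable N C' \<longrightarrow> (\<forall>x y. chords L x y \<longrightarrow> C x y = C' x y) \<longrightarrow>
      (\<forall>x y. chords L' x y \<longrightarrow> C x y = C' x y))"
  using assms
proof (induction v arbitrary: L \<Sigma>)
  case Nil
  then show ?case by auto
next
  case (Cons k v)
  obtain a b c d where q: "quad (chords L) a b c d" and k: "L k = (a, c)"
    and S: "seed_tri (L(k := (b, d))) (mutate k \<Sigma>)"
    using seed_tri_mutate[OF Cons.prems] .
  have LL: "labelled_tri L" using Cons.prems unfolding seed_tri_def by blast
  interpret orbit_flip N r L k a b c d
    by unfold_locales (use LL q k in auto)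
  have step: "C x y = C' x y" if C: "flippable N C" "flippable N C'"
    and e: "\<And>x y. chords L x y \<Longrightarrow> C x y = C' x y" and xy: "chords L' x y" for C C' x y
  proof -
    have eq: "C g h = C' g h" if "quad (chords L) e g f h" for e g f h
      using that C quad_less[OF T that] e unfolding quad_def flippable_def by metis
    have sw: "C g h = C h g" "C' g h = C' h g" for g h using C unfolding flippable_def by blast+
    show ?thesis
      using xy eq[OF q] eq[OF quad_r[OF L q]] e[of x y] sw[of b d] sw[of "r b" "r d"]
      unfolding chords_L' orb_def same_chord_def by auto
  qed
  obtain L2 where L2: "seed_tri L2 (fold mutate v (mutate k \<Sigma>))"
    and t: "\<And>C C'. flippable N C \<Longrightarrow> flippable N C' \<Longrightarrow> (\<And>x y. chords L' x y \<Longrightarrow> C x y = C' x y) \<Longrightarrow>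
      (\<forall>x y. chords L2 x y \<longrightarrow> C x y = C' x y)"
    using Cons.IH[OF S] unfolding L'_def by blast
  show ?case
  proof (intro exI conjI allI impI)
    show "seed_tri L2 (fold mutate (k # v) \<Sigma>)" using L2 by simp
    fix C C' :: "nat \<Rightarrow> nat \<Rightarrow> int" and x y
    assume C: "flippable N C" "flippable N C'" and e: "\<forall>x y. chords L x y \<longrightarrow> C x y = C' x y"
      and xy: "chords L2 x y"
    have "\<And>x y. chords L' x y \<Longrightarrow> C x y = C' x y" using step[OF C] e by blast
    then show "C x y = C' x y" using t[OF C] xy by blast
  qed
qed

end

section \<open>Monomials are determined by crossing numbers\<close>

lemma (in chord_family) flippable_count: "flippable N count"
  unfolding flippable_def
proof (intro conjI allI impI)
  show "count a b = count b a" for a b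
    unfolding count_def by (intro sum.cong refl) (simp add: cr_swap(1)[of a b])
  show "count b d = flip_count (count a b) (count b c) (count c d) (count d a) (count a c)"
    if "a < N" "b < N" "c < N" "d < N" "ccw a b c" "ccw c d a" for a b c d
    using count_flip that by blast
qed

context symmetric_polygon
begin

lemma orb_sym:
  assumes "orb c (fst c') (snd c')" "fst c < N" "snd c < N"
  shows "orb c' x y \<longleftrightarrow> orb c x y"
proof -
  consider "fst c' = fst c" "snd c' = snd c" | "fst c' = snd c" "snd c' = fst c"
    | "fst c' = r (fst c)" "snd c' = r (snd c)" | "fst c' = r (snd c)" "snd c' = r (fst c)"
    using assms(1) unfolding orb_def same_chord_def by blast
  then show ?thesis
    by cases (use assms(2,3) r_r eqc_swap(2)[of x y] in \<open>auto simp: orb_def\<close>)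
qed

lemma ltri_orb_edge: "labelled_tri L \<Longrightarrow> orb (L i) x y \<Longrightarrow> edge N x y"
  using tri_edge[OF ltri_tri chords_orb[of L i x y]] by (simp add: edge_def)

lemma ltri_orb_noncrossing: "labelled_tri L \<Longrightarrow> orb (L i) x y \<Longrightarrow> orb (L j) u v \<Longrightarrow> \<not> crosses x y u v"
  using tri_noncrossing[OF ltri_tri chords_orb[of L i x y] chords_orb[of L j u v]] .

lemma ltri_orb_not_eqc: "labelled_tri L \<Longrightarrow> orb (L i) x y \<Longrightarrow> orb (L j) u v \<Longrightarrow> i \<noteq> j \<Longrightarrow> \<not> same_chord x y u v"
  using ltri_inj[of L i x y j] orb_swap[of "L j"] unfolding same_chord_def by blast

end

context cluster_model
begin

text \<open>Doubling the exponents at chords of weight 1, rather than halving those at diameters of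
  weight 2, keeps multiplicities integral: \<open>mult\<close> times \<open>wt\<close> is always
  twice the exponent.\<close>

definition mult :: "('n \<Rightarrow> nat \<times> nat) \<Rightarrow> (nat, 'n) vec \<Rightarrow> 'n \<Rightarrow> int" where
  "mult L k j = int (if wt (fst (L j)) (snd (L j)) = 1 then 2 * k $ j else k $ j)"

definition crossings :: "('n \<Rightarrow> nat \<times> nat) \<Rightarrow> (nat, 'n) vec \<Rightarrow> nat \<Rightarrow> nat \<Rightarrow> int" where
  "crossings L k a b = (\<Sum>j\<in>UNIV. mult L k j *
     (crossing_number a b (fst (L j)) (snd (L j)) + crossing_number a b (r (fst (L j))) (r (snd (L j)))))"

lemma mult_nonneg: "mult L k j \<ge> 0"
  by (simp add: mult_def)

lemma mult_eq_0_iff: "mult L k j = 0 \<longleftrightarrow> k $ j = 0"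
  by (simp add: mult_def)

lemma mult_wt: "mult L k j * int (wt (fst (L j)) (snd (L j))) = 2 * int (k $ j)"
  using W by (auto simp: mult_def wt_def)

lemma flippable_crossings:
  assumes L: "labelled_tri L"
  shows "flippable N (crossings L k)"
proof -
  \<comment> \<open>Every orbit is listed as a chord and its image; a chord that is its own image
    occurs twice, as it does in \<open>crossings\<close>.\<close>
  define P Q where "P = (\<lambda>(j, s). if s then r (fst (L j)) else fst (L j))"
    and "Q = (\<lambda>(j, s). if s then r (snd (L j)) else snd (L j))"
  have ch: "chords L (P x) (Q x)" for x
    using chords_orb[of L "fst x"] by (cases x) (auto simp: P_def Q_def orb_def)
  interpret chord_family N UNIV P Q "\<lambda>x. mult L k (fst x)"
    by unfold_locales
      (use tri_edge[OF ltri_tri[OF L] ch] tri_noncrossing[OF ltri_tri[OF L] ch ch] in \<open>auto simp: mult_nonneg\<close>)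
  have "count a b = crossings L k a b" for a b
  proof -
    have "count a b = (\<Sum>j\<in>UNIV. \<Sum>s\<in>UNIV. mult L k j * crossing_number a b (P (j, s)) (Q (j, s)))"
      by (simp add: count_def sum.cartesian_product case_prod_beta)
    then show ?thesis
      by (simp add: crossings_def UNIV_bool P_def Q_def distrib_left add.commute)
  qed
  then have "count = crossings L k" by (intro ext) simp
  then show ?thesis using flippable_count by simp
qed

text \<open>\<open>denominator\<close> sums over the orbit of the initial chord,
  \<open>crossings\<close> over the orbit of the chord in the monomial; invariance of crossing
  numbers under \<open>r\<close> identifies the two sums.\<close>

lemma crossings_denominator:
  assumes \<Sigma>0: "seed_tri L0 (B0, x)" and \<Sigma>: "seed_tri L (B, y)"
  shows "crossings L k (fst (L0 i)) (snd (L0 i)) = 2 * D i * monomial_denominator_vector x y k $ i"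
proof -
  have L0: "labelled_tri L0" "diagonal_pattern \<Delta> L0" "alg_indep x" "\<And>i. x $ i = Y (fst (L0 i)) (snd (L0 i))"
    using \<Sigma>0 unfolding seed_tri_def by auto
  have L: "labelled_tri L" "\<And>i. y $ i = Y (fst (L i)) (snd (L i))"
    using \<Sigma> unfolding seed_tri_def by auto
  have "mult L k j * (crossing_number (fst (L0 i)) (snd (L0 i)) (fst (L j)) (snd (L j))
      + crossing_number (fst (L0 i)) (snd (L0 i)) (r (fst (L j))) (r (snd (L j)))) =
      2 * D i * (int (k $ j) * denominator_vector x (y $ j) $ i)" for j
  proof -
    let ?p = "fst (L j)" and ?q = "snd (L j)"
    have pq: "edge N ?p ?q" "?p < N" "?q < N"
      using tri_edge[OF ltri_tri[OF L(1)] chords_orb[of L j ?p ?q]] by (auto simp: edge_def)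
    obtain e where e: "laurent_denom x (Y ?p ?q) e"
      "\<And>i. e i * D i * int (wt ?p ?q) = crossing_number (fst (L0 i)) (snd (L0 i)) ?p ?q + crossing_number (r (fst (L0 i))) (r (snd (L0 i))) ?p ?q"
      using denominator[OF L0(1,2,3) L0(4) pq(1) ltri_nbdry[OF L(1)]] unfolding wt_def by blast
    have d: "denominator_vector x (y $ j) $ i = e i"
      using denominator_vector_eq[OF L0(3) e(1)] by (simp add: L(2))
    have m: "mult L k j * (e i * D i * int (wt ?p ?q)) = 2 * int (k $ j) * (e i * D i)"
      unfolding mult_wt[symmetric, of k j L] by (simp only: mult_ac)
    have c: "crossing_number (fst (L0 i)) (snd (L0 i)) ?p ?q + crossing_number (fst (L0 i)) (snd (L0 i)) (r ?p) (r ?q) = e i * D i * int (wt ?p ?q)"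
      using e(2)[of i] cr_r[of "fst (L0 i)" "snd (L0 i)" ?p ?q] ltri_less[OF L0(1)] pq by simp
    show ?thesis unfolding c d by (rule trans[OF m]) (simp only: mult_ac)
  qed
  then show ?thesis
    by (simp add: crossings_def monomial_denominator_vector_def sum_distrib_left)
qed

lemma crossings_r:
  assumes L: "labelled_tri L" and ab: "a < N" "b < N"
  shows "crossings L k (r a) (r b) = crossings L k a b"
  unfolding crossings_def
  by (intro sum.cong refl)
    (use cr_r[OF ab] r_cr[OF ab] ltri_less[OF L] r_r r_less in \<open>simp add: add.commute\<close>)

lemma crossings_bdry:
  assumes L: "labelled_tri L" and ab: "bdry N a b"
  shows "crossings L k a b = 0"
proof -
  have z: "crossing_number a b x y = 0" if "orb (L j) x y" for j x y
  proof -
    have "\<not> crosses a b x y" using ab ltri_orb_edge[OF L that] by (simp add: bdry_def edge_def)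
    moreover have "\<not> same_chord a b x y"
      using ab bdry_swap[of N a b] ltri_orb_nbdry[OF L that] by (auto simp: same_chord_def)
    ultimately show ?thesis by (simp add: crossing_number_def)
  qed
  have "crossing_number a b (fst (L j)) (snd (L j)) = 0" "crossing_number a b (r (fst (L j))) (r (snd (L j))) = 0" for j
    by (rule z[of j]; simp add: orb_def)+
  then show ?thesis by (simp add: crossings_def)
qed

lemma crossings_eq_on_chords:
  assumes L0: "labelled_tri L0" and L: "labelled_tri L" "labelled_tri L'"
    and e: "\<And>i. crossings L k (fst (L0 i)) (snd (L0 i)) = crossings L' l (fst (L0 i)) (snd (L0 i))"
    and xy: "chords L0 x y"
  shows "crossings L k x y = crossings L' l x y"
proof (cases "bdry N x y")
  case True then show ?thesis by (simp add: crossings_bdry L)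
next
  case False
  then obtain i where i: "orb (L0 i) x y" using xy unfolding chords_def by blast
  have sw: "crossings L k a b = crossings L k b a" if "labelled_tri L" for L k a b
    using flippable_crossings[OF that] unfolding flippable_def by blast
  note inv = orb_invariant[OF i ltri_less[OF L0]]
  show ?thesis
    using inv[of "crossings L k"] inv[of "crossings L' l"] crossings_r L sw e by metis
qed

text \<open>The other chords of the triangulation contribute nothing. The chord itself contributes -
  1, and its image another - 1 if it is the same chord.\<close>

lemma crossings_self:
  assumes L: "labelled_tri L"
  shows "crossings L k (fst (L i)) (snd (L i)) =
    - (mult L k i * (if same_chord (fst (L i)) (snd (L i)) (r (fst (L i))) (r (snd (L i))) then 2 else 1))"
proof -
  have z: "crossing_number (fst (L i)) (snd (L i)) x y = 0" if "orb (L j) x y" "j \<noteq> i" for j x y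
  proof -
    show ?thesis
      using ltri_orb_not_eqc[OF L orb_self(1) that(1)] ltri_orb_noncrossing[OF L orb_self(1) that(1)] that(2)
      by (auto simp: crossing_number_def)
  qed
  have "\<not> crosses (fst (L i)) (snd (L i)) (r (fst (L i))) (r (snd (L i)))"
    by (rule ltri_orb_noncrossing[OF L, of i _ _ i]) (auto simp: orb_def)
  then have "crossing_number (fst (L i)) (snd (L i)) (fst (L i)) (snd (L i)) +
      crossing_number (fst (L i)) (snd (L i)) (r (fst (L i))) (r (snd (L i))) =
      - (if same_chord (fst (L i)) (snd (L i)) (r (fst (L i))) (r (snd (L i))) then 2 else 1)"
    by (simp add: crossing_number_def)
  then have "mult L k j * (crossing_number (fst (L i)) (snd (L i)) (fst (L j)) (snd (L j)) +
      crossing_number (fst (L i)) (snd (L i)) (r (fst (L j))) (r (snd (L j)))) =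
      (if j = i then - (mult L k i * (if same_chord (fst (L i)) (snd (L i)) (r (fst (L i))) (r (snd (L i))) then 2 else 1))
       else 0)" for j
    using z[of j "fst (L j)" "snd (L j)"] z[of j "r (fst (L j))" "r (snd (L j))"]
    by (cases "j = i") (simp_all add: orb_def)
  then show ?thesis by (simp add: crossings_def)
qed

text \<open>At the cluster of the first monomial all its own crossing numbers are non-positive. A curve
  of the second monomial outside the triangulation would make one of them positive.\<close>

lemma monomial_support:
  assumes L: "labelled_tri L" and M: "labelled_tri M"
    and e: "\<And>x y. chords L x y \<Longrightarrow> crossings L k x y = crossings M l x y"
    and j: "l $ j \<noteq> 0"
  shows "\<exists>i. orb (L i) (fst (M j)) (snd (M j))"
proof (rule ccontr)
  assume n: "\<not> ?thesis"
  let ?p = "fst (M j)" and ?q = "snd (M j)"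
  have nc: "\<not> chords L ?p ?q" using n ltri_nbdry[OF M] unfolding chords_def by blast
  have "edge N ?p ?q" using tri_edge[OF ltri_tri[OF M] chords_orb[of M j ?p ?q]] by (auto simp: edge_def)
  then obtain x y where xy: "chords L x y" "crosses ?p ?q x y"
    using nc tri_maximal[OF ltri_tri[OF L]] by blast
  have xyN: "x < N" "y < N" using tri_edge[OF ltri_tri[OF L] xy(1)] by auto
  have "\<not> bdry N x y" using xy(2) crs_swap(3) ltri_less[OF M] unfolding bdry_def by metis
  then obtain i where i: "orb (L i) x y" using xy(1) unfolding chords_def by blast
  have sw: "crossings L k a b = crossings L k b a" for a b
    using flippable_crossings[OF L] unfolding flippable_def by blast
  have "crossings L k x y = crossings L k (fst (L i)) (snd (L i))"
    by (rule orb_invariant[of _ _ _ "crossings L k", OF i ltri_less[OF L] sw crossings_r[OF L]])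
  also have "\<dots> \<le> 0" using crossings_self[OF L] mult_nonneg[of L k i] by simp
  finally have le: "crossings M l x y \<le> 0" using e[OF xy(1)] by simp
  have cp: "crossing_number x y ?p ?q = 1"
    using xy(2) crs_swap(3) crs_irrefl by (auto simp: crossing_number_def)
  have nn: "crossing_number x y a b \<ge> 0" if "orb (M j') a b" for j' a b
  proof -
    have "\<not> same_chord x y a b"
    proof
      assume "same_chord x y a b"
      then have "crosses ?p ?q a b" using xy(2) crs_eqc by blast
      then show False
        using ltri_orb_noncrossing[OF M orb_self(1) that] by blast
    qed
    then show ?thesis by (simp add: crossing_number_def)
  qed
  have t: "mult M l j' * (crossing_number x y (fst (M j')) (snd (M j')) + crossing_number x y (r (fst (M j'))) (r (snd (M j')))) \<ge> 0" for j'
    using nn[of j' "fst (M j')" "snd (M j')"] nn[of j' "r (fst (M j'))" "r (snd (M j'))"] mult_nonneg[of M l j']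
    by (simp add: orb_def)
  have "mult M l j * (crossing_number x y ?p ?q + crossing_number x y (r ?p) (r ?q)) > 0"
    using cp nn[of j "r ?p" "r ?q"] mult_nonneg[of M l j] mult_eq_0_iff[of M l j] j
    by (intro mult_pos_pos) (auto simp: orb_def)
  then have "crossings M l x y > 0"
    unfolding crossings_def using t by (intro sum_pos2[of UNIV j]) auto
  then show False using le by simp
qed

text \<open>By \<open>monomial_support\<close> the chords used by the second monomial all belong to
  \<open>L\<close>, so its crossing number at \<open>L i\<close> sees only copies of that orbit.
  Comparison with \<open>crossings_self\<close> cancels the common factor 1 or 2.\<close>

lemma monomial_multiplicity:
  assumes L: "labelled_tri L" and M: "labelled_tri M"
    and e: "\<And>x y. chords L x y \<Longrightarrow> crossings L k x y = crossings M l x y"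
  shows "(k $ i \<noteq> 0 \<longrightarrow> (\<exists>j. l $ j \<noteq> 0 \<and> orb (L i) (fst (M j)) (snd (M j)))) \<and>
    (\<forall>j. l $ j \<noteq> 0 \<longrightarrow> orb (L i) (fst (M j)) (snd (M j)) \<longrightarrow> k $ i = l $ j)"
proof -
  let ?p = "fst (L i)" and ?q = "snd (L i)"
  let ?\<mu> = "if same_chord ?p ?q (r ?p) (r ?q) then 2 else 1 :: int"
  define S where "S = {j. l $ j \<noteq> 0 \<and> orb (L i) (fst (M j)) (snd (M j))}"
  note li = ltri_less[OF L, of i]
  have summand: "mult M l j * (crossing_number ?p ?q (fst (M j)) (snd (M j)) + crossing_number ?p ?q (r (fst (M j))) (r (snd (M j)))) =
      (if j \<in> S then - (mult M l j * ?\<mu>) else 0)" for j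
  proof (cases "l $ j = 0")
    case True then show ?thesis using mult_eq_0_iff[of M l j] by (simp add: S_def)
  next
    case False
    obtain i' where i': "orb (L i') (fst (M j)) (snd (M j))"
      using monomial_support[OF L M e False] by blast
    have o: "orb (L i') (r (fst (M j))) (r (snd (M j)))"
      using i' orb_r ltri_less[OF L] ltri_less[OF M] by blast
    have nc: "\<not> crosses ?p ?q x y" if "orb (L i') x y" for x y
      by (rule ltri_orb_noncrossing[OF L orb_self(1) that])
    show ?thesis
    proof (cases "i' = i")
      case t: True
      then have "j \<in> S" using False i' by (simp add: S_def)
      moreover have "crossing_number ?p ?q (fst (M j)) (snd (M j)) + crossing_number ?p ?q (r (fst (M j))) (r (snd (M j))) = - ?\<mu>"
      proof -
        define g where "g = (\<lambda>a b. crossing_number ?p ?q a b + crossing_number ?p ?q (r a) (r b))"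
        have "g (fst (M j)) (snd (M j)) = g ?p ?q"
          by (rule orb_invariant[of _ _ _ g, OF i'[unfolded t] li])
            (auto simp: g_def r_r cr_swap(2)[of ?p ?q a b for a b] intro: arg_cong2[of _ _ _ _ "(+)"] cr_swap(2))
        also have "\<dots> = - ?\<mu>"
          using nc[of "r ?p" "r ?q"] t by (simp add: g_def crossing_number_def orb_def)
        finally show ?thesis by (simp add: g_def)
      qed
      ultimately show ?thesis by simp
    next
      case f: False
      then have "j \<notin> S" using i' ltri_inj[OF L] unfolding S_def by blast
      moreover have "\<not> same_chord ?p ?q x y" if "orb (L i') x y" for x y
        using ltri_orb_not_eqc[OF L orb_self(1) that, of i] f by auto
      ultimately show ?thesis using nc i' o by (simp add: crossing_number_def)
    qed
  qed
  have "crossings M l ?p ?q = (\<Sum>j\<in>S. - (mult M l j * ?\<mu>))"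
    unfolding crossings_def summand by (simp add: sum.If_cases)
  then have eq: "mult L k i * ?\<mu> = (\<Sum>j\<in>S. mult M l j) * ?\<mu>"
    using e[OF chords_orb[of L i ?p ?q]] crossings_self[OF L, of k i] by (simp add: sum_negf sum_distrib_right)
  then have eq: "mult L k i = (\<Sum>j\<in>S. mult M l j)" by (auto split: if_splits)
  have one: "j = j'" if "j \<in> S" "j' \<in> S" for j j'
  proof -
    have "orb (M j) (fst (M j')) (snd (M j'))"
      using that orb_sym[of "L i" "M j"] li by (simp add: S_def)
    then show ?thesis using ltri_inj[OF M] orb_self(1) by blast
  qed
  show ?thesis
  proof (intro conjI impI allI)
    assume "k $ i \<noteq> 0"
    then have "S \<noteq> {}" using eq mult_eq_0_iff[of L k i] by auto
    then show "\<exists>j. l $ j \<noteq> 0 \<and> orb (L i) (fst (M j)) (snd (M j))" by (auto simp: S_def)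
  next
    fix j assume "l $ j \<noteq> 0" and o: "orb (L i) (fst (M j)) (snd (M j))"
    then have "S = {j}" using one by (auto simp: S_def)
    then have m: "mult L k i = mult M l j" using eq by simp
    have "wt (fst (M j)) (snd (M j)) = wt ?p ?q"
      by (rule orb_invariant[of _ _ _ wt, OF o li wt_swap wt_r])
    then show "k $ i = l $ j" using m by (auto simp: mult_def split: if_splits)
  qed
qed

text \<open>A variable common to both clusters may carry different labels in them, so the exponents
  are compared through a bijection between the labels in use.\<close>

theorem denominator_injective:
  assumes \<Sigma>: "seed_tri L0 \<Sigma>"
    and d: "monomial_denominator_vector (snd \<Sigma>) (snd (fold mutate v \<Sigma>)) k =
            monomial_denominator_vector (snd \<Sigma>) (snd (fold mutate u \<Sigma>)) l"
  shows "cluster_monomial (snd (fold mutate v \<Sigma>)) k = cluster_monomial (snd (fold mutate u \<Sigma>)) l"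
proof -
  obtain B0 x where Bx: "\<Sigma> = (B0, x)" by (cases \<Sigma>)
  obtain L where L: "seed_tri L (fold mutate v \<Sigma>)"
    and tr: "\<And>C C'. flippable N C \<Longrightarrow> flippable N C' \<Longrightarrow> \<forall>x y. chords L0 x y \<longrightarrow> C x y = C' x y \<Longrightarrow>
      \<forall>x y. chords L x y \<longrightarrow> C x y = C' x y"
    using seed_tri_transfer[OF \<Sigma>, of v] by blast
  obtain M where M: "seed_tri M (fold mutate u \<Sigma>)" using seed_tri_transfer[OF \<Sigma>, of u] by blast
  have lt: "labelled_tri L0" "labelled_tri L" "labelled_tri M"
    and y: "\<And>i. snd (fold mutate v \<Sigma>) $ i = Y (fst (L i)) (snd (L i))"
    and z: "\<And>i. snd (fold mutate u \<Sigma>) $ i = Y (fst (M i)) (snd (M i))"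
    using \<Sigma> L M unfolding seed_tri_def by auto
  have "crossings L k (fst (L0 i)) (snd (L0 i)) = crossings M l (fst (L0 i)) (snd (L0 i))" for i
    using crossings_denominator[of L0 B0 x L "fst (fold mutate v \<Sigma>)" "snd (fold mutate v \<Sigma>)" k i]
      crossings_denominator[of L0 B0 x M "fst (fold mutate u \<Sigma>)" "snd (fold mutate u \<Sigma>)" l i]
      \<Sigma> L M d by (simp add: Bx)
  then have "\<forall>x y. chords L0 x y \<longrightarrow> crossings L k x y = crossings M l x y"
    using crossings_eq_on_chords[OF lt] by blast
  then have e: "crossings L k x y = crossings M l x y" if "chords L x y" for x y
    using tr flippable_crossings lt that by blast
  note mm = monomial_multiplicity[OF lt(2,3) e]
  define I J where "I = {i. k $ i \<noteq> 0}" and "J = {j. l $ j \<noteq> 0}"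
  define f where "f = (\<lambda>j. SOME i. orb (L i) (fst (M j)) (snd (M j)))"
  have f: "orb (L (f j)) (fst (M j)) (snd (M j))" if "j \<in> J" for j
    using monomial_support[OF lt(2,3) e, of j] that unfolding f_def J_def by (auto intro: someI_ex)
  have kf: "k $ f j = l $ j" if "j \<in> J" for j
    using mm[of "f j"] f[OF that] that unfolding J_def by blast
  have "inj_on f J"
  proof (rule inj_onI)
    fix j j' assume j: "j \<in> J" "j' \<in> J" "f j = f j'"
    then have "orb (M j) (fst (M j')) (snd (M j'))"
      using orb_sym[OF f[OF j(1)] ltri_less[OF lt(2)]] f[OF j(2)] by simp
    then show "j = j'" using ltri_inj[OF lt(3)] orb_self(1) by blast
  qed
  moreover have "f ` J = I"
  proof
    show "f ` J \<subseteq> I" using kf by (auto simp: I_def J_def)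
    show "I \<subseteq> f ` J"
    proof
      fix i assume "i \<in> I"
      then obtain j where j: "j \<in> J" "orb (L i) (fst (M j)) (snd (M j))"
        using mm[of i] unfolding I_def J_def by auto
      then have "i = f j" using f ltri_inj[OF lt(2)] by blast
      then show "i \<in> f ` J" using j by blast
    qed
  qed
  ultimately have bij: "bij_betw f J I" by (simp add: bij_betw_def)
  have "cluster_monomial (snd (fold mutate v \<Sigma>)) k = (\<Prod>i\<in>I. Y (fst (L i)) (snd (L i)) ^ (k $ i))"
    unfolding cluster_monomial_def y by (rule prod.mono_neutral_right) (auto simp: I_def)
  also have "\<dots> = (\<Prod>j\<in>J. Y (fst (L (f j))) (snd (L (f j))) ^ (k $ f j))"
    by (rule prod.reindex_bij_betw[OF bij, symmetric])
  also have "\<dots> = (\<Prod>j\<in>J. Y (fst (M j)) (snd (M j)) ^ (l $ j))"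
  proof (intro prod.cong refl)
    fix j assume j: "j \<in> J"
    have "Y (fst (M j)) (snd (M j)) = Y (fst (L (f j))) (snd (L (f j)))"
      by (rule orb_invariant[of _ _ _ Y, OF f[OF j] ltri_less[OF lt(2)] Y_swap Y_r])
    then show "Y (fst (L (f j))) (snd (L (f j))) ^ (k $ f j) = Y (fst (M j)) (snd (M j)) ^ (l $ j)"
      using kf[OF j] by simp
  qed
  also have "\<dots> = cluster_monomial (snd (fold mutate u \<Sigma>)) l"
    unfolding cluster_monomial_def z by (rule prod.mono_neutral_left) (auto simp: J_def)
  finally show ?thesis .
qed

end

section \<open>Lengths as Laurent polynomials\<close>

lemma crs_linear:
  assumes "a < c"
  shows "crosses f g a c \<longleftrightarrow> (a < f \<and> f < c \<and> (g < a \<or> c < g)) \<or> (a < g \<and> g < c \<and> (f < a \<or> c < f))"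
  using assms unfolding crosses_def ccw_def by (smt (z3))

text \<open>Here one chord \<open>f g\<close> is measured against all six chords of a quadrilateral.
  For a single chord with the value - 1 at itself there are no fans, and the tropical relation is
  exact; each end of \<open>f g\<close> has nine possible positions.\<close>

lemma cr_tropical:
  assumes "a < b" "b < c" "c < d"
  shows "crossing_number f g a c + crossing_number f g b d = max (crossing_number f g a b + crossing_number f g c d) (crossing_number f g b c + crossing_number f g a d)"
proof -
  have "a < c" "b < d" "a < d" using assms by auto
  note l = crs_linear[OF \<open>a < b\<close>] crs_linear[OF \<open>b < c\<close>] crs_linear[OF \<open>c < d\<close>]
    crs_linear[OF \<open>a < c\<close>] crs_linear[OF \<open>b < d\<close>] crs_linear[OF \<open>a < d\<close>]
  have pos: "u < a \<or> u = a \<or> a < u \<and> u < b \<or> u = b \<or> b < u \<and> u < c \<or> u = c \<or> c < u \<and> u < d \<or> u = d \<or> d < u"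
    for u by linarith
  consider "f < a" | "f = a" | "a < f" "f < b" | "f = b" | "b < f" "f < c" | "f = c" | "c < f" "f < d"
    | "f = d" | "d < f" by linarith
  then show ?thesis
  proof cases
    case 1
    then show ?thesis
      using pos[of g] assms unfolding crossing_number_def l same_chord_def by (elim disjE conjE; simp)
  next
    case 2
    then show ?thesis
      using pos[of g] assms unfolding crossing_number_def l same_chord_def by (elim disjE conjE; simp)
  next
    case 3
    then show ?thesis
      using pos[of g] assms unfolding crossing_number_def l same_chord_def by (elim disjE conjE; simp)
  next
    case 4
    then show ?thesis
      using pos[of g] assms unfolding crossing_number_def l same_chord_def by (elim disjE conjE; simp)
  next
    case 5
    then show ?thesis
      using pos[of g] assms unfolding crossing_number_def l same_chord_def by (elim disjE conjE; simp)
  next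
    case 6
    then show ?thesis
      using pos[of g] assms unfolding crossing_number_def l same_chord_def by (elim disjE conjE; simp)
  next
    case 7
    then show ?thesis
      using pos[of g] assms unfolding crossing_number_def l same_chord_def by (elim disjE conjE; simp)
  next
    case 8
    then show ?thesis
      using pos[of g] assms unfolding crossing_number_def l same_chord_def by (elim disjE conjE; simp)
  next
    case 9
    then show ?thesis
      using pos[of g] assms unfolding crossing_number_def l same_chord_def by (elim disjE conjE; simp)
  qed
qed

definition crossing_set :: "(nat \<Rightarrow> nat \<Rightarrow> bool) \<Rightarrow> nat \<Rightarrow> nat \<Rightarrow> (nat \<times> nat) set" where
  "crossing_set T p q = {(g, h). T g h \<and> crosses p q g h}"

lemma finite_crossing_set: "triangulation N T \<Longrightarrow> finite (crossing_set T p q)"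
  by (rule finite_subset[of _ "{..<N} \<times> {..<N}"]) (auto simp: crossing_set_def dest: tri_edge)

text \<open>Makes the crossing sets in \<open>laurent_denom_window\<close> shrink: a chord that
  crosses no side of the triangle \<open>p a b\<close> and enters through \<open>a q\<close> or
  \<open>q b\<close> can leave only through \<open>p q\<close>.\<close>

lemma crs_away:
  assumes "\<not> crosses p a g h" "\<not> crosses a b g h" "\<not> crosses b p g h"
    and o: "p < a" "a < q" "b < p \<or> q < b"
    and n: "g = p \<Longrightarrow> a < h \<Longrightarrow> h < q \<Longrightarrow> False" "h = p \<Longrightarrow> a < g \<Longrightarrow> g < q \<Longrightarrow> False"
    and c: "crosses a q g h \<or> crosses q b g h"
  shows "crosses p q g h"
  using assms unfolding crosses_def ccw_def by (smt (z3))

text \<open>A run of consecutive vertices closed by a chord \<open>s e\<close>: the whole polygon in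
  type A, the half under the diameter in types B and C. The base is kept out of
  \<open>interior\<close> because the length of a diameter can be the square of a variable.\<close>

locale laurent_window =
  fixes N s e :: nat and T :: "nat \<Rightarrow> nat \<Rightarrow> bool" and X :: "nat \<Rightarrow> nat \<Rightarrow> 'n::{finite,linorder} ratfun"
    and x :: "'n tuple" and E :: "'n \<Rightarrow> nat \<Rightarrow> nat \<Rightarrow> int"
  assumes T: "triangulation N T" and se: "s < e" "e < N" "T s e"
    and succ: "s \<le> u \<Longrightarrow> u < e \<Longrightarrow> T u (Suc u)"
    and ptolemy: "s \<le> a \<Longrightarrow> a < b \<Longrightarrow> b < c \<Longrightarrow> c < d \<Longrightarrow> d \<le> e \<Longrightarrow>
      X a c * X b d = X a b * X c d + X b c * X a d"
    and tropical: "s \<le> a \<Longrightarrow> a < b \<Longrightarrow> b < c \<Longrightarrow> c < d \<Longrightarrow> d \<le> e \<Longrightarrow>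
      E i a c + E i b d = max (E i a b + E i c d) (E i b c + E i a d)"
    and x: "alg_indep x"
    and chord: "s \<le> a \<Longrightarrow> a < b \<Longrightarrow> b \<le> e \<Longrightarrow> T a b \<Longrightarrow> laurent_denom x (X a b) (\<lambda>i. E i a b)"
    and interior: "s \<le> a \<Longrightarrow> a < b \<Longrightarrow> b \<le> e \<Longrightarrow> T a b \<Longrightarrow> \<not> bdry N a b \<Longrightarrow> (a, b) \<noteq> (s, e) \<Longrightarrow>
      \<exists>k. X a b = x $ k \<and> (\<forall>i. E i a b = (if i = k then - 1 else 0))"
begin

text \<open>\<open>u v\<close> is the diagonal whose length is a cluster variable,
  \<open>p q\<close> the one to be computed; leaving them symbolic covers both assignments to
  \<open>a c\<close> and \<open>b d\<close>.\<close>

lemma exchange_step: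
  assumes o: "s \<le> a" "a < b" "b < c" "c < d" "d \<le> e"
    and sides: "laurent_denom x (X a b) (\<lambda>i. E i a b)" "laurent_denom x (X c d) (\<lambda>i. E i c d)"
      "laurent_denom x (X b c) (\<lambda>i. E i b c)" "laurent_denom x (X a d) (\<lambda>i. E i a d)"
    and k: "X u v = x $ k" "\<And>i. E i u v = (if i = k then - 1 else 0)"
    and pq: "X p q * X u v = X a b * X c d + X b c * X a d" "\<And>i. E i p q + E i u v = E i a c + E i b d"
  shows "laurent_denom x (X p q) (\<lambda>i. E i p q)"
proof -
  have "laurent_denom x (X a b * X c d + X b c * X a d) (\<lambda>i. max (E i a b + E i c d) (E i b c + E i a d))"
    by (intro laurent_denom_add laurent_denom_mult x sides)
  then have xk: "laurent_denom x (X p q * x $ k) (\<lambda>i. E i p q + E i u v)"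
    using pq tropical[OF o] by (simp add: k(1))
  show ?thesis
  proof -
    have "(\<lambda>i. E i p q + E i u v + (if i = k then int 1 else 0)) = (\<lambda>i. E i p q)"
      by (intro ext) (simp add: k(2))
    then show ?thesis
      using laurent_denom_divide_power[OF x xk, of k 1] alg_indep_nonzero[OF x, of k] by simp
  qed
qed

text \<open>Let \<open>p a b\<close> be the triangle of \<open>T\<close> in which \<open>p q\<close>
  starts. The Ptolemy relation for p, a, q, b divides by the cluster variable of \<open>a b\<close>;
  \<open>p a\<close> and \<open>p b\<close> are chords of \<open>T\<close>, while \<open>a q\<close>
  and \<open>q b\<close> cross fewer chords than \<open>p q\<close>, since they miss
  \<open>a b\<close>.\<close>

lemma laurent_denom_window:
  assumes "s \<le> p" "p < q" "q \<le> e"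
  shows "laurent_denom x (X p q) (\<lambda>i. E i p q)"
  using assms
proof (induction "card (crossing_set T p q)" arbitrary: p q rule: less_induct)
  case (less p q)
  show ?case
  proof (cases "T p q")
    case True
    then show ?thesis using chord less.prems by blast
  next
    case False
    define S where "S = {a. p < a \<and> a < q \<and> T p a}"
    have "Suc p \<noteq> q" using False succ[of p] less.prems by auto
    then have "Suc p \<in> S" using succ[of p] less.prems by (simp add: S_def)
    moreover have fS: "finite S" by (simp add: S_def)
    ultimately have "Max S \<in> S" using Max_in by blast
    define a where "a = Max S"
    have a: "p < a" "a < q" "T p a" using \<open>Max S \<in> S\<close> by (auto simp: S_def a_def)
    have amax: "y \<le> a" if "p < y" "y < q" "T p y" for y
      using Max_ge[OF fS, of y] that by (simp add: S_def a_def)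
    have "T a p" using tri_sym[OF T a(3)] .
    moreover have "q < N" "ccw a q p" using less.prems se a by (auto simp: ccw_def)
    ultimately obtain b where b: "b < N" "ccw a b p" "T a b" "T b p"
      using tri_apex[OF T, of a p q] by blast
    have pb: "T p b" "T b a" using tri_sym[OF T] b by auto
    \<comment> \<open>The base \<open>s e\<close> belongs to \<open>T\<close>, so \<open>a b\<close>
      cannot cross it and leave the window.\<close>
    have inside: "s \<le> b" "b \<le> e"
      using tri_noncrossing[OF T b(3) se(3)] a less.prems b(2) unfolding crosses_def ccw_def by auto
    have bq: "b < p \<or> q < b"
    proof (rule ccontr)
      assume "\<not> ?thesis"
      then have "a < b" "b \<le> q" using b(2) a(1) unfolding ccw_def by auto
      then show False using amax[of b] False pb(1) a(1) by (cases "b = q") auto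
    qed
    have away: "crosses p q g h" if gh: "T g h" "crosses a q g h \<or> crosses q b g h" for g h
    proof (rule crs_away[OF _ _ _ a(1,2) bq _ _ gh(2)])
      show "\<not> crosses p a g h" "\<not> crosses a b g h" "\<not> crosses b p g h"
        using tri_noncrossing[OF T] a(3) b gh(1) by blast+
      show "g = p \<Longrightarrow> a < h \<Longrightarrow> h < q \<Longrightarrow> False" using amax[of h] gh(1) a(1) by auto
      show "h = p \<Longrightarrow> a < g \<Longrightarrow> g < q \<Longrightarrow> False" using amax[of g] tri_sym[OF T gh(1)] a(1) by auto
    qed
    have ab: "crosses p q a b" using a bq unfolding crosses_def ccw_def by auto
    have nbd: "\<not> bdry N a b" "\<not> bdry N b a"
      using ab crs_swap less.prems se b(1) a unfolding bdry_def
      by (meson dual_order.strict_trans le_less_trans)+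
    have sub: "card (crossing_set T a q) < card (crossing_set T p q)"
      "card (crossing_set T q b) < card (crossing_set T p q)"
    proof -
      have "crossing_set T a q \<subseteq> crossing_set T p q" "crossing_set T q b \<subseteq> crossing_set T p q"
        using away by (auto simp: crossing_set_def)
      moreover have "(a, b) \<in> crossing_set T p q"
        using b(3) ab by (simp add: crossing_set_def)
      moreover have "(a, b) \<notin> crossing_set T a q" "(a, b) \<notin> crossing_set T q b"
        by (auto simp: crossing_set_def crosses_def ccw_def)
      ultimately have "crossing_set T a q \<subset> crossing_set T p q" "crossing_set T q b \<subset> crossing_set T p q"
        by blast+
      then show "card (crossing_set T a q) < card (crossing_set T p q)"
        "card (crossing_set T q b) < card (crossing_set T p q)"
        using psubset_card_mono[OF finite_crossing_set[OF T, of p q]] by blast+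
    qed
    have cs: "crossing_set T q b = crossing_set T b q"
      unfolding crossing_set_def using crs_swap(1) by blast
    have aq: "laurent_denom x (X a q) (\<lambda>i. E i a q)"
      using less.hyps[OF sub(1)] a less.prems by simp
    have pa: "laurent_denom x (X p a) (\<lambda>i. E i p a)"
      using chord a less.prems by simp
    show ?thesis using bq
    proof
      assume bp: "b < p"
      have "laurent_denom x (X b q) (\<lambda>i. E i b q)"
        using less.hyps[of b q] sub(2) cs bp inside less.prems by simp
      moreover have "laurent_denom x (X b p) (\<lambda>i. E i b p)"
        using chord b bp inside less.prems by simp
      moreover obtain k where k: "X b a = x $ k" "\<And>i. E i b a = (if i = k then - 1 else 0)"
        using interior[of b a] pb nbd a bp inside less.prems by auto
      ultimately show ?thesis
        using exchange_step[of b p a q, OF _ _ _ _ _ _ aq pa _ k] ptolemy[of b p a q] a bp inside less.prems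
        by (simp add: mult.commute)
    next
      assume bq: "q < b"
      have "laurent_denom x (X q b) (\<lambda>i. E i q b)"
        using less.hyps[of q b] sub(2) bq inside less.prems by simp
      moreover have "laurent_denom x (X p b) (\<lambda>i. E i p b)"
        using chord[of p b] pb bq inside less.prems by simp
      moreover obtain k where k: "X a b = x $ k" "\<And>i. E i a b = (if i = k then - 1 else 0)"
        using interior[of a b] b nbd a bq inside less.prems by auto
      ultimately show ?thesis
        using exchange_step[of p a q b, OF _ _ _ _ _ pa _ aq _ k] ptolemy[of p a q b] a bq inside less.prems
        by simp
    qed
  qed
qed

end

text \<open>The three-term Pluecker relation for the minors of a matrix with two rows.\<close>

lemma ptolemy_det:
  fixes a b :: "nat \<Rightarrow> 'a::comm_ring_1"
  shows "(a i * b k - b i * a k) * (a j * b l - b j * a l) =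
    (a i * b j - b i * a j) * (a k * b l - b k * a l) + (a j * b k - b j * a k) * (a i * b l - b i * a l)"
  by (simp add: algebra_simps)

section \<open>Type A\<close>

text \<open>Vectors \<open>(\<alpha>\<^sub>j, \<beta>\<^sub>j)\<close> in the plane with \<open>U 0 j = f j\<close> and unit determinants of neighbours:
  the lambda lengths of a fan at the vertex \<open>0\<close>.\<close>

locale fan_vectors =
  fixes K :: nat and f :: "nat \<Rightarrow> 'a::field"
  assumes K: "K \<ge> 2" and f_1: "f 1 = 1" and f_nonzero: "1 \<le> j \<Longrightarrow> j \<le> K \<Longrightarrow> f j \<noteq> 0"
begin

text \<open>For positive i and j the determinant \<open>U i j\<close> becomes f_i f_j (h_j - h_i).
  These increments are the ones that give neighbours determinant 1.\<close>

definition h :: "nat \<Rightarrow> 'a" where "h j = (\<Sum>l\<in>{1..<j}. 1 / (f l * f (Suc l)))"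

definition \<alpha> :: "nat \<Rightarrow> 'a" where "\<alpha> j = (if j = 0 then 1 else f j * (h K - h j))"

definition \<beta> :: "nat \<Rightarrow> 'a" where "\<beta> j = (if j = 0 then 0 else f j / f K)"

definition U :: "nat \<Rightarrow> nat \<Rightarrow> 'a" where "U i j = f K * (\<alpha> i * \<beta> j - \<beta> i * \<alpha> j)"

lemma fK: "f K \<noteq> 0" using f_nonzero K by simp

lemma U_0: "0 < j \<Longrightarrow> U 0 j = f j"
  using fK by (simp add: U_def \<alpha>_def \<beta>_def)

text \<open>The end vertices carry the standard basis; in types B and C the half turn sends the
  first basis vector to the second.\<close>

lemma ends: "\<alpha> 0 = 1" "\<beta> 0 = 0" "\<alpha> K = 0" "\<beta> K = 1"
  using K fK by (simp_all add: \<alpha>_def \<beta>_def)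

lemma U_Suc: "j < K \<Longrightarrow> U j (Suc j) = 1"
proof (cases "j = 0")
  case True then show ?thesis using U_0[of 1] f_1 by simp
next
  case False
  assume j: "j < K"
  have "h (Suc j) = h j + 1 / (f j * f (Suc j))" using False by (simp add: h_def)
  moreover have "f j \<noteq> 0" "f (Suc j) \<noteq> 0" using False j f_nonzero by auto
  ultimately show ?thesis using False fK by (simp add: U_def \<alpha>_def \<beta>_def field_simps)
qed

lemma U_ptolemy: "U a c * U b d = U a b * U c d + U b c * U a d"
  unfolding U_def using ptolemy_det[of \<alpha> a \<beta> c b d] by (simp add: algebra_simps)

end

lemma ccw_quad_cases:
  assumes "ccw a b c" "ccw c d a"
  obtains "a < b" "b < c" "c < d" | "b < c" "c < d" "d < a" | "c < d" "d < a" "a < b" | "d < a" "a < b" "b < c"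
  using assms unfolding ccw_def by (smt (z3))

lemma ptolemy_ccw:
  fixes X :: "nat \<Rightarrow> nat \<Rightarrow> 'a::comm_ring_1"
  assumes "ccw a b c" "ccw c d a" and sym: "\<And>u v. X u v = X v u"
    and pt: "\<And>u v w z. u < v \<Longrightarrow> v < w \<Longrightarrow> w < z \<Longrightarrow> {u, v, w, z} = {a, b, c, d} \<Longrightarrow>
      X u w * X v z = X u v * X w z + X v w * X u z"
  shows "X a c * X b d = X a b * X c d + X b c * X d a"
  using assms(1,2)
proof (cases rule: ccw_quad_cases)
  case 1
  have "X a c * X b d = X a b * X c d + X b c * X a d" by (rule pt) (use 1 in auto)
  then show ?thesis using sym[of a d] by simp
next
  case 2
  have "X b d * X c a = X b c * X d a + X c d * X b a" by (rule pt) (use 2 in auto)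
  then show ?thesis using sym[of a c] sym[of a b] by (simp add: algebra_simps)
next
  case 3
  have "X c a * X d b = X c d * X a b + X d a * X c b" by (rule pt) (use 3 in auto)
  then show ?thesis using sym[of a c] sym[of d b] sym[of c b] by (simp add: algebra_simps)
next
  case 4
  have "X d b * X a c = X d a * X b c + X a b * X d c" by (rule pt) (use 4 in auto)
  then show ?thesis using sym[of d b] sym[of d c] by (simp add: algebra_simps)
qed

lemma crs_shared: "a = c \<or> a = d \<or> b = c \<or> b = d \<Longrightarrow> \<not> crosses a b c d"
  unfolding crosses_def ccw_def by (smt (z3))

lemma bdry_cases:
  assumes "bdry N a b" "a < b"
  shows "b = Suc a \<or> a = 0 \<and> b = N - 1"
proof (rule ccontr)
  assume n: "\<not> ?thesis"
  have ab: "a < N" "b < N" using assms by (auto simp: bdry_def edge_def)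
  have nc: "\<not> crosses a b c d" if "c < N" "d < N" for c d using assms that by (auto simp: bdry_def)
  show False
  proof (cases "a = 0")
    case True
    then have "Suc b < N" using n ab by auto
    then show False using nc[of "Suc a" "Suc b"] n assms(2) by (auto simp: crosses_def ccw_def)
  next
    case False
    moreover have "a - 1 < N" using ab by simp
    ultimately show False using nc[of "Suc a" "a - 1"] n assms(2) ab by (auto simp: crosses_def ccw_def)
  qed
qed

lemma bdry_Suc: "Suc a < N \<Longrightarrow> bdry N a (Suc a)"
  by (auto simp: bdry_def edge_def crosses_def ccw_def)

lemma bdry_last: "N \<ge> 2 \<Longrightarrow> bdry N 0 (N - 1)"
  by (auto simp: bdry_def edge_def crosses_def ccw_def)

definition linear_quiver :: "('n \<Rightarrow> nat) \<Rightarrow> 'n \<Rightarrow> 'n \<Rightarrow> int" where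
  "linear_quiver \<sigma> i k = (if Suc (\<sigma> i) = \<sigma> k then 1 else if \<sigma> i = Suc (\<sigma> k) then - 1 else 0)"

locale numbered_cluster =
  fixes \<sigma> :: "'n::{finite,linorder} \<Rightarrow> nat" and x :: "'n tuple"
  assumes \<sigma>: "bij_betw \<sigma> UNIV {1..CARD('n)}" and x: "alg_indep x"
begin

lemma \<sigma>_range: "1 \<le> \<sigma> i" "\<sigma> i \<le> CARD('n)"
  using \<sigma> bij_betwE by fastforce+

lemma \<sigma>_inj: "\<sigma> i = \<sigma> j \<longleftrightarrow> i = j"
  using \<sigma> by (auto simp: bij_betw_def inj_on_def)

definition \<tau> :: "nat \<Rightarrow> 'n" where "\<tau> = inv_into UNIV \<sigma>"

lemma \<sigma>_\<tau>: "1 \<le> k \<Longrightarrow> k \<le> CARD('n) \<Longrightarrow> \<sigma> (\<tau> k) = k"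
  unfolding \<tau>_def using \<sigma> by (intro f_inv_into_f) (auto simp: bij_betw_def)

lemma \<tau>_\<sigma>: "\<tau> (\<sigma> i) = i"
  unfolding \<tau>_def using \<sigma> by (simp add: bij_betw_def)

text \<open>Number j goes to the diagonal from 0 to j + 1, because the chord from 0 to 1 is a
  side.\<close>

definition fan :: "'n \<Rightarrow> nat \<times> nat" where "fan i = (0, Suc (\<sigma> i))"

end

locale type_A = numbered_cluster \<sigma> x for \<sigma> :: "'n::{finite,linorder} \<Rightarrow> nat" and x :: "'n tuple"
begin

text \<open>The vertices are 0 to \<open>K\<close>, so the polygon has n + 3 of them.\<close>

definition K :: nat where "K = CARD('n) + 2"

definition f :: "nat \<Rightarrow> 'n ratfun" where "f j = (if 2 \<le> j \<and> j < K then x $ \<tau> (j - 1) else 1)"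

sublocale fan_vectors K f
  by unfold_locales (auto simp: K_def f_def alg_indep_nonzero[OF x])

sublocale symmetric_polygon "Suc K" id
  by unfold_locales auto

definition Y :: "nat \<Rightarrow> nat \<Rightarrow> 'n ratfun" where "Y a b = U (min a b) (max a b)"

lemma Y_sym: "Y a b = Y b a"
  by (simp add: Y_def min.commute max.commute)

lemma Y_on_bdry:
  assumes "bdry (Suc K) a b" shows "Y a b = 1"
proof -
  have *: "Y a b = 1" if "bdry (Suc K) a b" "a < b" for a b
  proof -
    have "b < Suc K" using that by (auto simp: bdry_def edge_def)
    moreover have "f K = 1" by (simp add: f_def)
    ultimately show ?thesis
      using bdry_cases[OF that] that(2) U_Suc[of a] U_0[of K] K by (auto simp: Y_def)
  qed
  have "a \<noteq> b" using assms by (auto simp: bdry_def edge_def)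
  then show ?thesis using *[of a b] *[of b a] assms bdry_swap[of "Suc K" a b] Y_sym[of a b] by force
qed

lemma Y_ptolemy: "a < b \<Longrightarrow> b < c \<Longrightarrow> c < d \<Longrightarrow> Y a c * Y b d = Y a b * Y c d + Y b c * Y a d"
  using U_ptolemy[of a c b d] by (simp add: Y_def)

lemma orb_id: "orb c a b \<longleftrightarrow> same_chord a b (fst c) (snd c)"
  by (simp add: orb_def)

lemma denominators:
  assumes L: "labelled_tri L" and y: "alg_indep y" "\<And>i. y $ i = Y (fst (L i)) (snd (L i))"
    and pq: "p < q" "q < Suc K"
  shows "laurent_denom y (Y p q) (\<lambda>i. crossing_number (fst (L i)) (snd (L i)) p q)"
proof -
  \<comment> \<open>The window is the whole polygon, and its base is the side
    \<open>0 K\<close>.\<close>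
  interpret laurent_window "Suc K" 0 K "chords L" Y y "\<lambda>i. crossing_number (fst (L i)) (snd (L i))"
  proof
    show "triangulation (Suc K) (chords L)" by (rule ltri_tri[OF L])
    show "0 < K" "K < Suc K" using K by auto
    show "chords L 0 K" using bdry_last[of "Suc K"] K by (simp add: chords_def)
    show "chords L u (Suc u)" if "u < K" for u using bdry_Suc[of u "Suc K"] that by (simp add: chords_def)
    show "Y a c * Y b d = Y a b * Y c d + Y b c * Y a d" if "a < b" "b < c" "c < d" for a b c d
      using Y_ptolemy that .
    show "crossing_number (fst (L i)) (snd (L i)) a c + crossing_number (fst (L i)) (snd (L i)) b d =
      max (crossing_number (fst (L i)) (snd (L i)) a b + crossing_number (fst (L i)) (snd (L i)) c d)
          (crossing_number (fst (L i)) (snd (L i)) b c + crossing_number (fst (L i)) (snd (L i)) a d)"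
      if "a < b" "b < c" "c < d" for i a b c d
      using cr_tropical[OF that] .
    show "alg_indep y" by (rule y(1))
    have int: "Y a b = y $ k \<and> (\<forall>i. crossing_number (fst (L i)) (snd (L i)) a b = (if i = k then - 1 else 0))"
      if k: "orb (L k) a b" for a b k
    proof
      show "Y a b = y $ k" using k Y_sym unfolding orb_id same_chord_def y(2) by auto
      show "\<forall>i. crossing_number (fst (L i)) (snd (L i)) a b = (if i = k then - 1 else 0)"
      proof
        fix i
        show "crossing_number (fst (L i)) (snd (L i)) a b = (if i = k then - 1 else 0)"
          using k ltri_orb_not_eqc[OF L orb_self(1) k, of i] ltri_orb_noncrossing[OF L orb_self(1) k, of i]
            eqc_swap(3)[of a b] by (auto simp: crossing_number_def orb_id)
      qed
    qed
    show "\<exists>k. Y a b = y $ k \<and> (\<forall>i. crossing_number (fst (L i)) (snd (L i)) a b = (if i = k then - 1 else 0))"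
      if "chords L a b" "\<not> bdry (Suc K) a b" for a b
      using that int unfolding chords_def by blast
    show "laurent_denom y (Y a b) (\<lambda>i. crossing_number (fst (L i)) (snd (L i)) a b)" if ab: "chords L a b" for a b
    proof (cases "bdry (Suc K) a b")
      case True
      have "crossing_number (fst (L i)) (snd (L i)) a b = 0" for i
      proof -
        have "\<not> same_chord (fst (L i)) (snd (L i)) a b"
          using True bdry_swap[of "Suc K"] ltri_nbdry[OF L, of i] by (auto simp: same_chord_def)
        moreover have "\<not> crosses (fst (L i)) (snd (L i)) a b"
          using tri_noncrossing[OF ltri_tri[OF L] chords_orb[of L i] ab] by simp
        ultimately show ?thesis by (simp add: crossing_number_def)
      qed
      then show ?thesis using laurent_denom_1[OF y(1)] Y_on_bdry[OF True] by simp
    next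
      case False
      then obtain k where "orb (L k) a b" using ab unfolding chords_def by blast
      then show ?thesis
        using int[of k a b] laurent_denom_var_power[OF y(1), of k 1] by simp
    qed
  qed
  show ?thesis using laurent_denom_window[of p q] pq by simp
qed

text \<open>Under the identity each chord is its own image, so crossing numbers summed over orbits
  are doubled; this is the constant 2.\<close>

sublocale cluster_model "Suc K" id Y "{}" 1 "\<lambda>_. 2"
proof
  show "Y a b = Y b a" for a b by (rule Y_sym)
  show "bdry (Suc K) a b \<Longrightarrow> Y a b = 1" for a b by (rule Y_on_bdry)
  fix L :: "'n \<Rightarrow> nat \<times> nat"
  assume L: "labelled_tri L"
  show "Y a c * Y b d = (if (1::nat) = 2 \<and> k \<in> {} then Y a b ^ (if id a = b then 1 else 1) + Y b c ^ (if id b = c then 1 else 1)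
      else Y a b ^ (if id a = b then 1 else 1) * Y c d ^ (if id c = d then 1 else 1) +
           Y b c ^ (if id b = c then 1 else 1) * Y d a ^ (if id d = a then 1 else 1))"
    if "quad (chords L) a b c d" for a b c d k
    using that ptolemy_ccw[of a b c d Y] Y_sym Y_ptolemy by (simp add: quad_def)
  show "\<exists>e. laurent_denom y (Y p q) e \<and> (\<forall>i. e i * 2 * int (if id p = q then 1 else 1) =
      crossing_number (fst (L i)) (snd (L i)) p q + crossing_number (id (fst (L i))) (id (snd (L i))) p q)"
    if y: "alg_indep y" "\<And>i. y $ i = Y (fst (L i)) (snd (L i))" and pq: "edge (Suc K) p q" for y p q
  proof -
    have "laurent_denom y (Y p q) (\<lambda>i. crossing_number (fst (L i)) (snd (L i)) p q)"
    proof (cases "p < q")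
      case True then show ?thesis using denominators[OF L y] pq by (simp add: edge_def)
    next
      case False
      then have "q < p" using pq by (auto simp: edge_def)
      then show ?thesis
        using denominators[OF L y, of q p] pq Y_sym[of p q] cr_swap(2)[of _ _ p q] by (simp add: edge_def)
    qed
    then show ?thesis by (intro exI[of _ "\<lambda>i. crossing_number (fst (L i)) (snd (L i)) p q"]) simp
  qed
qed (auto simp: id_def)

section \<open>The fan seed in type A\<close>

lemma fan_orb: "orb (fan i) a b \<longleftrightarrow> a = 0 \<and> b = Suc (\<sigma> i) \<or> a = Suc (\<sigma> i) \<and> b = 0"
  by (auto simp: orb_id fan_def same_chord_def)

lemma fan_chord: "2 \<le> j \<Longrightarrow> j < K \<Longrightarrow> orb (fan (\<tau> (j - 1))) 0 j"
  using \<sigma>_\<tau>[of "j - 1"] by (simp add: fan_orb K_def)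

text \<open>For maximality, a chord from \<open>a > 0\<close> to some \<open>b > a + 1\<close>
  crosses the fan diagonal ending at \<open>a + 1\<close>.\<close>

lemma fan_tri: "labelled_tri fan"
  unfolding labelled_tri_def
proof (intro conjI allI impI)
  let ?T = "chords fan"
  have nc: "\<not> crosses a b c d" if ab: "?T a b" and cd: "?T c d" for a b c d
  proof -
    have o: "c < Suc K \<and> d < Suc K" if "orb (fan i) c d" for c d i
      using that \<sigma>_range(2)[of i] by (auto simp: fan_orb K_def)
    have b: "\<not> crosses a b c d" if "bdry (Suc K) a b" "?T c d" for a b c d
      using that o unfolding chords_def bdry_def edge_def by blast
    consider "bdry (Suc K) a b" | "bdry (Suc K) c d" | i j where "orb (fan i) a b" "orb (fan j) c d"
      using ab cd unfolding chords_def by blast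
    then show ?thesis
    proof cases
      case 1 then show ?thesis using b cd by blast
    next
      case 2 then show ?thesis using b[of c d a b] ab crs_swap(3) by blast
    next
      case 3 then show ?thesis by (intro crs_shared) (auto simp: fan_orb)
    qed
  qed
  have sw: "?T a b \<longleftrightarrow> ?T b a" for a b
    unfolding chords_def using bdry_swap orb_swap by blast
  have max: "?T a b" if ab: "a < b" "b < Suc K" and n: "\<And>c d. ?T c d \<Longrightarrow> \<not> crosses a b c d" for a b
  proof (cases "a = 0")
    case True
    show ?thesis
    proof (cases "b = 1 \<or> b = K")
      case True
      then show ?thesis using \<open>a = 0\<close> bdry_Suc[of 0 "Suc K"] bdry_last[of "Suc K"] K by (auto simp: chords_def)
    next
      case False
      then have "orb (fan (\<tau> (b - 1))) 0 b" using ab \<open>a = 0\<close> by (intro fan_chord) auto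
      then show ?thesis using \<open>a = 0\<close> unfolding chords_def by blast
    qed
  next
    case False
    show ?thesis
    proof (cases "b = Suc a")
      case True
      then show ?thesis using bdry_Suc ab by (simp add: chords_def)
    next
      case b: False
      then have "?T 0 (Suc a)" using fan_chord[of "Suc a"] ab False unfolding chords_def by auto
      then have "\<not> crosses a b 0 (Suc a)" by (rule n)
      then show ?thesis using b ab False by (auto simp: crosses_def ccw_def)
    qed
  qed
  have edge: "edge (Suc K) a b" if "?T a b" for a b
  proof -
    have "edge (Suc K) a b" if "orb (fan i) a b" for i
      using that \<sigma>_range(2)[of i] by (auto simp: fan_orb edge_def K_def)
    then show ?thesis using that by (auto simp: chords_def bdry_def)
  qed
  show "triangulation (Suc K) ?T"
    unfolding triangulation_def
  proof (intro allI iffI)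
    fix a b assume "?T a b"
    then show "edge (Suc K) a b \<and> (\<forall>c d. ?T c d \<longrightarrow> \<not> crosses a b c d)" using nc edge by blast
  next
    fix a b assume ab: "edge (Suc K) a b \<and> (\<forall>c d. ?T c d \<longrightarrow> \<not> crosses a b c d)"
    then consider "a < b" | "b < a" unfolding edge_def by linarith
    then show "?T a b"
    proof cases
      case 1 then show ?thesis using max[of a b] ab by (simp add: edge_def)
    next
      case 2 then show ?thesis using max[of b a] ab crs_swap(1)[of a b] sw[of a b] by (simp add: edge_def)
    qed
  qed
next
  fix i j a b assume "orb (fan i) a b" "orb (fan j) a b"
  then show "i = j" using \<sigma>_inj[of i j] by (auto simp: fan_orb)
next
  fix i
  show "\<not> bdry (Suc K) (fst (fan i)) (snd (fan i))"
    using bdry_cases[of "Suc K" 0 "Suc (\<sigma> i)"] \<sigma>_range[of i] by (auto simp: fan_def K_def)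
qed

lemma fan_seed:
  assumes "\<And>i k. B $ i $ k = linear_quiver \<sigma> i k"
  shows "seed_tri fan (B, x)"
  unfolding seed_tri_def
proof (intro conjI allI fan_tri)
  show "diagonal_pattern {} fan" by (simp add: diagonal_pattern_def fan_def)
  have "exchange_matrix fan (linear_quiver \<sigma>)"
  proof (rule exchange_matrixI[OF fan_tri])
    fix k
    let ?k = "\<sigma> k"
    have k: "1 \<le> ?k" "?k < K - 1" using \<sigma>_range[of k] by (auto simp: K_def)
    have ch: "chords fan 0 j" if "1 \<le> j" "j \<le> K" for j
      using that fan_chord[of j] bdry_Suc[of 0 "Suc K"] bdry_last[of "Suc K"] unfolding chords_def
      by (cases "j = 1 \<or> j = K") auto
    have sc: "chords fan j (Suc j)" if "j < K" for j
      using that bdry_Suc[of j "Suc K"] by (simp add: chords_def)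
    have "quad (chords fan) 0 ?k (Suc ?k) (Suc (Suc ?k))"
      unfolding quad_def using k ch[of ?k] ch[of "Suc ?k"] ch[of "Suc (Suc ?k)"] sc[of ?k] sc[of "Suc ?k"]
        tri_sym[OF ltri_tri[OF fan_tri]] by (auto simp: ccw_def)
    moreover have "linear_quiver \<sigma> i k = quad_sum fan i 0 ?k (Suc ?k) (Suc (Suc ?k))" for i
      using k by (auto simp: quad_sum_def ind_def fan_orb linear_quiver_def)
    ultimately show "\<exists>a b c d. quad (chords fan) a b c d \<and> orb (a, c) (fst (fan k)) (snd (fan k)) \<and>
       (\<forall>i. linear_quiver \<sigma> i k = quad_sum fan i a b c d)"
      by (intro exI[of _ 0] exI[of _ ?k] exI[of _ "Suc ?k"] exI[of _ "Suc (Suc ?k)"]) (simp add: fan_def)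
  qed
  moreover have W1: "wn i = 1" for i unfolding wn_def by simp
  ultimately show "\<exists>\<beta>. exchange_matrix fan \<beta> \<and> (\<forall>i k. fst (B, x) $ i $ k * int (wn k) = int (wn i) * \<beta> i k)"
    using assms W1 by (intro exI[of _ "linear_quiver \<sigma>"]) simp
  show "snd (B, x) $ i = Y (fst (fan i)) (snd (fan i))" for i
    using \<sigma>_range[of i] \<tau>_\<sigma>[of i] U_0[of "Suc (\<sigma> i)"] by (simp add: Y_def fan_def f_def K_def)
  show "alg_indep (snd (B, x))" using x by simp
qed

end

section \<open>Types B and C\<close>

text \<open>Meant for the trace term of type C: an integer multiple of a product whose denominators
  are no larger adds nothing to the exponents.\<close>

lemma laurent_denom_add_nat:
  assumes x: "alg_indep x" and "laurent_denom x z d" "laurent_denom x w e" "\<And>i. e i \<le> d i"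
  shows "laurent_denom x (z + of_nat n * w) d"
proof (induction n)
  case 0
  then show ?case using assms(2) by simp
next
  case (Suc n)
  have "laurent_denom x ((z + of_nat n * w) + w) (\<lambda>i. max (d i) (e i))"
    by (rule laurent_denom_add[OF x Suc assms(3)])
  moreover have "(\<lambda>i. max (d i) (e i)) = d" by (intro ext max_absorb1 assms(4))
  ultimately show ?case by (simp add: algebra_simps)
qed

text \<open>Crossing numbers of a chord \<open>g h\<close> in the half polygon \<open>{s..e}\<close> with curves that leave it
  through the diameter \<open>s e\<close>.\<close>

lemma cr_leaving:
  assumes "s \<le> g" "g < h" "h \<le> e" "(g, h) \<noteq> (s, e)" "s < j" "j \<le> i" "i < e"
  shows "max (crossing_number g h i e + crossing_number g h j e) (crossing_number g h s i + crossing_number g h s j) =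
      (if g < i \<and> i < h then 1 else 0) + (if g < j \<and> j < h then 1 else 0)"
    and "crossing_number g h i e + crossing_number g h s j \<le> (if g < i \<and> i < h then 1 else 0) + (if g < j \<and> j < h then 1 else 0)"
proof -
  have "j < e" "s < i" using assms by auto
  note l = crs_linear[OF \<open>i < e\<close>] crs_linear[OF \<open>j < e\<close>] crs_linear[OF \<open>s < i\<close>] crs_linear[OF \<open>s < j\<close>]
  have c: "crossing_number g h u e = (if g = u \<and> h = e then - 1 else if g < u \<and> u < h \<and> h < e then 1 else 0)"
    if "u < e" "s < u" for u
    using that assms(1-3) unfolding crossing_number_def same_chord_def crs_linear[OF that(1)] by auto
  have d: "crossing_number g h s u = (if g = s \<and> h = u then - 1 else if s < g \<and> g < u \<and> u < h then 1 else 0)"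
    if "u < e" "s < u" for u
    using that assms(1-3) unfolding crossing_number_def same_chord_def crs_linear[OF that(2)] by auto
  note ci = c[OF \<open>i < e\<close> \<open>s < i\<close>] and cj = c[OF \<open>j < e\<close> \<open>s < j\<close>]
  note di = d[OF \<open>i < e\<close> \<open>s < i\<close>] and dj = d[OF \<open>j < e\<close> \<open>s < j\<close>]
  show "max (crossing_number g h i e + crossing_number g h j e) (crossing_number g h s i + crossing_number g h s j) =
      (if g < i \<and> i < h then 1 else 0) + (if g < j \<and> j < h then 1 else 0)"
    unfolding ci cj di dj using assms by (cases "g = s"; cases "h = e") auto
  show "crossing_number g h i e + crossing_number g h s j \<le> (if g < i \<and> i < h then 1 else 0) + (if g < j \<and> j < h then 1 else 0)"
    unfolding ci cj di dj using assms by (cases "g = s"; cases "h = e") auto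
qed

text \<open>For \<open>W = 1\<close> this is type B, with lengths in the \<open>2m\<close>-gon modulo the half turn. For \<open>W = 2\<close>
  it is type C: the monodromy of the half turn has trace 2 instead of 0, and the length of a
  diameter is the square of the corresponding cluster variable.\<close>

locale type_BC = numbered_cluster \<sigma> x for \<sigma> :: "'n::{finite,linorder} \<Rightarrow> nat" and x :: "'n tuple" +
  fixes W :: nat
  assumes W12: "W = 1 \<or> W = 2"
begin

text \<open>A triangulation of the 2m-gon invariant under the half turn has one diameter and m - 2
  pairs of other diagonals, hence n orbits.\<close>

definition m :: nat where "m = Suc CARD('n)"

definition last :: 'n where "last = \<tau> CARD('n)"

definition f :: "nat \<Rightarrow> 'n ratfun" where
  "f j = (if j = m then x $ last ^ W else if 2 \<le> j \<and> j < m then x $ \<tau> (j - 1) else 1)"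

definition is_C :: bool where "is_C \<longleftrightarrow> W = 2"

lemma W_cases: "is_C \<Longrightarrow> W = 2" "\<not> is_C \<Longrightarrow> W = 1"
  using W12 by (auto simp: is_C_def)

definition t :: "'n ratfun" where "t = of_nat (2 * (W - 1))"

lemma m2: "m \<ge> 2"
  using zero_less_card_finite[where 'a='n] by (simp add: m_def)

sublocale fan_vectors m f
  using m2 by unfold_locales (auto simp: f_def alg_indep_nonzero[OF x])

text \<open>The second half of the polygon carries the images of the first under the map from (a, b)
  to (- b, a + t b), of determinant 1 and trace \<open>t\<close>.\<close>

definition A :: "nat \<Rightarrow> 'n ratfun" where "A j = (if j < m then \<alpha> j else - \<beta> (j - m))"

definition B :: "nat \<Rightarrow> 'n ratfun" where "B j = (if j < m then \<beta> j else \<alpha> (j - m) + t * \<beta> (j - m))"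

definition r :: "nat \<Rightarrow> nat" where "r i = (if i < m then i + m else i - m)"

definition UU :: "nat \<Rightarrow> nat \<Rightarrow> 'n ratfun" where "UU i j = f m * (A i * B j - B i * A j)"

text \<open>Determinant of the vector at \<open>i\<close> with the half turn image of the vector at
  \<open>j\<close>. For \<open>i = j\<close> it gives the length of a diameter.\<close>

definition V :: "nat \<Rightarrow> nat \<Rightarrow> 'n ratfun" where "V i j = f m * (A i * (A j + t * B j) + B i * B j)"

text \<open>For \<open>t = 2\<close> a full turn does not act as a sign, so determinants are taken
  only across at most half a turn; a wider chord is replaced by its half turn image.\<close>

definition X0 :: "nat \<Rightarrow> nat \<Rightarrow> 'n ratfun" where
  "X0 a b = (if b \<le> a + m then UU a b else UU (b - m) (a + m))"

definition X :: "nat \<Rightarrow> nat \<Rightarrow> 'n ratfun" where "X a b = X0 (min a b) (max a b)"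

text \<open>In type C \<open>f m\<close> is the square of \<open>x $ last\<close>, which makes this
  product a square root of the length of the diameter.\<close>

definition Y :: "nat \<Rightarrow> nat \<Rightarrow> 'n ratfun" where
  "Y a b = (if r a = b \<and> is_C then x $ last * (A a + B a) else X a b)"

lemma AB_shift: "j < m \<Longrightarrow> A (j + m) = - B j" "j < m \<Longrightarrow> B (j + m) = A j + t * B j"
  by (simp_all add: A_def B_def)

lemma UU_shift: "i < m \<Longrightarrow> j < m \<Longrightarrow> UU (i + m) (j + m) = UU i j"
  by (simp add: UU_def AB_shift algebra_simps)

lemma V_shift: "i < m \<Longrightarrow> j < m \<Longrightarrow> V (i + m) (j + m) = V i j"
  by (simp add: V_def AB_shift algebra_simps)

lemma UU_V: "j < m \<Longrightarrow> UU i (j + m) = V i j"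
  by (simp add: UU_def V_def AB_shift)

lemma UU_U: "i \<le> m \<Longrightarrow> j \<le> m \<Longrightarrow> UU i j = U i j"
  using ends by (auto simp: UU_def U_def A_def B_def)

lemma UU_ptolemy: "UU a c * UU b d = UU a b * UU c d + UU b c * UU a d"
  unfolding UU_def using ptolemy_det[of A a B c b d] by (simp add: algebra_simps)

lemma r_half: "i < m \<Longrightarrow> r i = i + m" "r (i + m) = i"
  by (simp_all add: r_def)

sublocale symmetric_polygon "2 * m" r
proof
  show "r (r i) = i" if "i < 2 * m" for i using that by (auto simp: r_def)
  show "r i < 2 * m" if "i < 2 * m" for i using that by (auto simp: r_def)
  show "ccw (r a) (r b) (r c) \<longleftrightarrow> ccw a b c" if "a < 2 * m" "b < 2 * m" "c < 2 * m" for a b c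
    using that unfolding ccw_def r_def by (smt (z3))
  show "(\<forall>i<2 * m. r i = i) \<or> (\<forall>i<2 * m. r i \<noteq> i)" using m2 by (auto simp: r_def)
qed

lemma X_swap: "X a b = X b a"
  by (simp add: X_def min.commute max.commute)

lemma X_direct: "a < b \<Longrightarrow> b \<le> a + m \<Longrightarrow> X a b = UU a b"
  by (simp add: X_def X0_def)

lemma X_opposite:
  assumes "j \<le> i" "i < j + m" "i < 2 * m" shows "X i (r j) = V i j"
proof (cases "j < m")
  case True
  then show ?thesis using assms X_direct[of i "j + m"] by (simp add: r_half UU_V)
next
  case False
  define j' where "j' = j - m"
  have j: "j = j' + m" "j' < m" using False assms by (auto simp: j'_def)
  have rj: "r j = j'" using j by (simp add: r_half)
  define i' where "i' = i - m"
  have i: "i = i' + m" "i' < m" "j' \<le> i'" using assms j by (auto simp: i'_def)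
  show ?thesis
  proof (cases "i = j")
    case True
    then have "X i (r j) = UU j' (j' + m)" using X_direct[of j' "j' + m"] m2 X_swap rj j by simp
    then show ?thesis using True j V_shift[of j' j'] by (simp add: UU_V)
  next
    case n: False
    then have "X i (r j) = UU i' (j' + m)"
      using i j assms rj by (simp add: X_def X0_def)
    then show ?thesis using i j V_shift[of i' j'] by (simp add: UU_V)
  qed
qed

lemma X_half_turn:
  assumes "a < 2 * m" "b < 2 * m" shows "X (r a) (r b) = X a b"
proof -
  have *: "X (r a) (r b) = X a b" if ab: "a \<le> b" "b < 2 * m" for a b
  proof -
    consider "b < m" | "a < m" "m \<le> b" "b \<le> a + m" | "a < m" "a + m < b" | "m \<le> a" by linarith
    then show ?thesis
    proof cases
      case 1
      then show ?thesis using ab UU_shift[of a b] by (simp add: r_half X_def X0_def)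
    next
      case 2
      define b' where "b' = b - m"
      have b: "b = b' + m" "b' \<le> a" "b' < m" using 2 ab by (auto simp: b'_def)
      show ?thesis
      proof (cases "b' = a")
        case True
        then show ?thesis using b 2 by (simp add: r_half X_def min_def max_def)
      next
        case False
        then show ?thesis using b 2 by (simp add: r_half X_def X0_def min_def max_def)
      qed
    next
      case 3
      define b' where "b' = b - m"
      have b: "b = b' + m" "a < b'" "b' < m" using 3 ab by (auto simp: b'_def)
      show ?thesis using 3 b by (simp add: r_half X_def X0_def min_def max_def)
    next
      case 4
      define a' b' where "a' = a - m" and "b' = b - m"
      have b: "a = a' + m" "b = b' + m" "a' \<le> b'" "b' < m" using 4 ab by (auto simp: a'_def b'_def)
      then show ?thesis using UU_shift[of a' b'] by (simp add: r_half X_def X0_def min_def max_def)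
    qed
  qed
  show ?thesis
    using *[of a b] *[of b a] assms X_swap[of a b] X_swap[of "r a" "r b"] by (cases "a \<le> b") auto
qed

lemma trace: "is_C \<Longrightarrow> t = 2" "\<not> is_C \<Longrightarrow> t = 0"
  unfolding is_C_def t_def using W12 by auto

lemma f_m: "f m = x $ last ^ W"
  by (simp add: f_def)

lemma Y_power:
  assumes "a < 2 * m" "b < 2 * m"
  shows "Y a b ^ (if r a = b then W else 1) = X a b"
proof (cases "r a = b \<and> is_C")
  case True
  have t2: "t = 2" and fm: "f m = x $ last * x $ last"
    using trace(1) True f_m W_cases(1) by (simp_all add: power2_eq_square)
  have "X a b = V a a" using X_opposite[of a a] m2 assms True by simp
  also have "\<dots> = (x $ last * (A a + B a)) ^ 2"
    by (simp add: V_def t2 fm power2_eq_square algebra_simps)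
  finally have "X a b = (x $ last * (A a + B a)) ^ 2" .
  moreover have "Y a b = x $ last * (A a + B a)" using True by (simp add: Y_def)
  moreover have "(if r a = b then W else 1) = 2" using True W_cases(1) by auto
  ultimately show ?thesis by (simp only:)
next
  case False
  then show ?thesis using W_cases(2) by (auto simp: Y_def)
qed

lemma Y_half_turn:
  assumes "a < 2 * m" "b < 2 * m" shows "Y (r a) (r b) = Y a b"
proof (cases "r a = b \<and> is_C")
  case True
  have t2: "t = 2" using trace(1) True by simp
  have "A (r a) + B (r a) = A a + B a"
  proof (cases "a < m")
    case True then show ?thesis by (simp add: r_half AB_shift t2)
  next
    case False
    define a' where "a' = a - m"
    have "a = a' + m" "a' < m" using False assms by (auto simp: a'_def)
    then show ?thesis by (simp add: r_half AB_shift t2)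
  qed
  then show ?thesis using True assms r_r[of a] by (simp add: Y_def)
next
  case False
  then have "\<not> (r (r a) = r b \<and> is_C)" using r_r assms by metis
  then show ?thesis
    unfolding Y_def if_not_P[OF False] using X_half_turn[OF assms] by (simp only: if_not_P if_False)
qed

lemma Y_swap': 
  assumes "a < 2 * m" "b < 2 * m" shows "Y a b = Y b a"
proof (cases "r a = b")
  case True
  then have "Y b a = Y (r a) (r b)" using r_r assms by auto
  then show ?thesis using Y_half_turn[OF assms] by simp
next
  case False
  then have "r b \<noteq> a" using r_r assms by auto
  then show ?thesis using False X_swap by (simp add: Y_def)
qed

lemma bdry_not_diameter: "bdry (2 * m) a b \<Longrightarrow> r a \<noteq> b"
proof
  assume b: "bdry (2 * m) a b" and ab: "r a = b"
  have lt: "a < 2 * m" "b < 2 * m" using b by (auto simp: bdry_def edge_def)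
  show False
  proof (cases "a < m")
    case True
    then show False using b ab bdry_cases[of "2 * m" a b] m2 by (auto simp: r_half)
  next
    case False
    then have "b < a" "a = b + m" using ab lt m2 by (auto simp: r_def)
    then show False using bdry_cases[of "2 * m" b a] b bdry_swap[of "2 * m" a b] m2 lt by auto
  qed
qed

lemma X_on_bdry:
  assumes "bdry (2 * m) a b" shows "X a b = 1"
proof -
  have small: "X a (Suc a) = 1" if "a < m" for a
    using that X_direct[of a "Suc a"] UU_U[of a "Suc a"] U_Suc[of a] m2 by simp
  have *: "X a b = 1" if ab: "bdry (2 * m) a b" "a < b" for a b
  proof -
    have b: "b < 2 * m" using ab by (auto simp: bdry_def edge_def)
    consider "b = Suc a" "a < m" | "b = Suc a" "m \<le> a" | "a = 0" "b = 2 * m - 1"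
      using bdry_cases[OF ab] by linarith
    then show ?thesis
    proof cases
      case 1 then show ?thesis using small by simp
    next
      case 2
      then have "r a = a - m" "r b = Suc (a - m)" by (auto simp: r_def)
      then show ?thesis using X_half_turn[of a b] small[of "a - m"] 2 b by simp
    next
      case 3
      then have "r a = m" "r b = m - 1" using m2 by (auto simp: r_def)
      then have "X a b = X m (m - 1)" using X_half_turn[of a b] 3 b by simp
      also have "\<dots> = X (m - 1) (Suc (m - 1))" using X_swap m2 by simp
      finally show ?thesis using small[of "m - 1"] m2 by simp
    qed
  qed
  have "a \<noteq> b" using assms by (auto simp: bdry_def edge_def)
  then show ?thesis using *[of a b] *[of b a] assms bdry_swap[of "2 * m" a b] X_swap[of a b] by force
qed

lemma X_ptolemy:
  "s \<le> a \<Longrightarrow> a < b \<Longrightarrow> b < c \<Longrightarrow> c < d \<Longrightarrow> d \<le> s + m \<Longrightarrow> X a c * X b d = X a b * X c d + X b c * X a d"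
  using UU_ptolemy[of a c b d] by (simp add: X_direct)

text \<open>Opposite sides of the quadrilateral have equal length. For trace 0 the Ptolemy relation
  is a sum of two squares; for trace 2 the two lengths multiply to the square of a sum, and the
  relation between the roots is linear.\<close>

definition diameter_relation :: "nat \<Rightarrow> nat \<Rightarrow> bool" where
  "diameter_relation a b \<longleftrightarrow> Y a (r a) * Y b (r b) =
     (if is_C then X a b + X b (r a) else X a b * X a b + X b (r a) * X b (r a))"

lemma diameter_relation_small:
  assumes "a < b" "b < m" shows "diameter_relation a b"
proof -
  have P: "X a b = UU a b" using X_direct[of a b] assms by simp
  have Q: "X b (r a) = V b a" using X_opposite[of a b] assms by simp
  show ?thesis
  proof (cases is_C)
    case True
    have t2: "t = 2" and fm: "f m = x $ last * x $ last"
    using trace(1) True f_m W_cases(1) by (simp_all add: power2_eq_square)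
    show ?thesis
      unfolding diameter_relation_def P Q using True
      by (simp add: Y_def UU_def V_def t2 fm algebra_simps)
  next
    case False
    then have t0: "t = 0" using trace(2) by simp
    have "Y a (r a) = V a a" "Y b (r b) = V b b"
      using X_opposite[of a a] X_opposite[of b b] assms m2 False by (simp_all add: Y_def)
    then show ?thesis
      unfolding diameter_relation_def P Q using False
      by (simp add: UU_def V_def t0 algebra_simps)
  qed
qed

lemma diameter_relation_rotate:
  assumes "a < 2 * m" "b < 2 * m"
  shows "diameter_relation b (r a) \<longleftrightarrow> diameter_relation a b"
proof -
  have "Y (r a) (r (r a)) = Y a (r a)" using Y_half_turn[of a "r a"] assms r_less by simp
  moreover have "X (r a) (r b) = X a b" using X_half_turn[OF assms] .
  ultimately show ?thesis unfolding diameter_relation_def by (auto simp: add.commute mult.commute)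
qed

text \<open>Passing from (a, b) to (b, \<open>r a\<close>) preserves the relation and brings both
  vertices into the first half.\<close>

lemma diameter_relation_ccw:
  assumes ab: "a < 2 * m" "b < 2 * m" "ccw a b (r a)"
  shows "diameter_relation a b"
proof -
  have half: "diameter_relation a b" if ab: "a < m" "b < 2 * m" "ccw a b (r a)" for a b
  proof (cases "b < m")
    case True
    then show ?thesis using ab diameter_relation_small[of a b] by (simp add: ccw_def r_half)
  next
    case False
    define b' where "b' = b - m"
    have b: "b = b' + m" "b' < m" using False ab by (auto simp: b'_def)
    then have "r b' = b" "b' < a" using ab by (auto simp: r_half ccw_def)
    then show ?thesis
      using diameter_relation_small[of b' a] diameter_relation_rotate[of b' a] ab b by simp
  qed
  show ?thesis
  proof (cases "a < m")
    case True then show ?thesis using half ab by blast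
  next
    case False
    then have "r a < m" using ab by (auto simp: r_def)
    moreover have "ccw (r a) (r b) (r (r a))" using ab r_less by (simp add: r_ccw)
    ultimately have "diameter_relation (r a) (r b)" using half ab r_less by simp
    moreover have "diameter_relation (r a) (r b) \<longleftrightarrow> diameter_relation a b"
      using diameter_relation_rotate[of a b] diameter_relation_rotate[of b "r a"] ab r_less by simp
    ultimately show ?thesis by simp
  qed
qed

definition window :: "nat \<Rightarrow> nat \<Rightarrow> bool" where
  "window s a \<longleftrightarrow> s \<le> a \<and> a \<le> s + m"

lemma window_or: "s < m \<Longrightarrow> a < 2 * m \<Longrightarrow> window s a \<or> window s (r a)"
  by (auto simp: window_def r_def)

lemma window_both: "s < m \<Longrightarrow> a < 2 * m \<Longrightarrow> window s a \<Longrightarrow> window s (r a) \<Longrightarrow> a = s \<or> a = s + m"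
  by (auto simp: window_def r_def split: if_splits)

lemma window_edge:
  assumes "s < m" "u < 2 * m" "v < 2 * m" "\<not> crosses u v s (s + m)"
  shows "window s u \<and> window s v \<or> window s (r u) \<and> window s (r v)"
  using assms unfolding window_def r_def crosses_def ccw_def by (smt (z3))

end

section \<open>Exchange relations in types B and C\<close>

context type_BC
begin

lemma r_eq_swap: "a < 2 * m \<Longrightarrow> b < 2 * m \<Longrightarrow> r a = b \<longleftrightarrow> r b = a"
  using r_r by auto

lemma diameter_exists:
  assumes L: "labelled_tri L" "diagonal_pattern {last} L"
  obtains s where "s < m" "\<And>a b. orb (L last) a b \<longleftrightarrow> same_chord a b s (s + m)" "same_chord (fst (L last)) (snd (L last)) s (s + m)"
proof -
  define p q where "p = fst (L last)" and "q = snd (L last)"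
  have pq: "p < 2 * m" "q < 2 * m" "r p = q" "r q = p"
    using ltri_less[OF L(1), of last] L(2) r_eq_swap unfolding diagonal_pattern_def p_def q_def by auto
  define s where "s = min p q"
  have s: "s < m" "p = s \<and> q = s + m \<or> q = s \<and> p = s + m"
    using pq by (auto simp: s_def r_def min_def split: if_splits)
  have "orb (L last) a b \<longleftrightarrow> same_chord a b s (s + m)" for a b
    using s pq unfolding orb_def same_chord_def p_def[symmetric] q_def[symmetric] by auto
  then show thesis using that s unfolding p_def q_def same_chord_def by blast
qed

lemma not_diameter:
  assumes L: "labelled_tri L" "diagonal_pattern {last} L" and i: "i \<noteq> last" and o: "orb (L i) a b"
  shows "r a \<noteq> b"
proof -
  have "r (fst (L i)) \<noteq> snd (L i)" using L(2) i unfolding diagonal_pattern_def by auto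
  then show ?thesis
    using o ltri_less[OF L(1), of i] r_r r_eq_swap[of "fst (L i)" "snd (L i)"] unfolding orb_def same_chord_def by auto
qed

lemma chord_window:
  assumes L: "labelled_tri L" and s: "s < m" and d: "chords L s (s + m)" and uv: "chords L u v"
  shows "window s u \<and> window s v \<or> window s (r u) \<and> window s (r v)"
  using window_edge[OF s] tri_edge[OF ltri_tri[OF L] uv] tri_noncrossing[OF ltri_tri[OF L] uv d] by blast

text \<open>The diameter crosses none of the five chords, so each lies in one half. The halves share
  only the ends of the diameter, and \<open>a c\<close> is not the diameter; hence \<open>a\<close>
  or \<open>c\<close> lies in one half only and decides for all vertices.\<close>

lemma quad_window:
  assumes L: "labelled_tri L" and s: "s < m" and d: "chords L s (s + m)"
    and q: "quad (chords L) a b c d'" and ac: "r a \<noteq> c"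
  shows "(\<forall>u\<in>{a, b, c, d'}. window s u) \<or> (\<forall>u\<in>{a, b, c, d'}. window s (r u))"
proof -
  note lt = quad_less[OF ltri_tri[OF L] q]
  have e: "window s u \<and> window s v \<or> window s (r u) \<and> window s (r v)"
    if "(u, v) \<in> {(a, b), (b, c), (c, d'), (d', a), (a, c)}" for u v
    using that q chord_window[OF L s d] unfolding quad_def by blast
  have n: "\<not> (window s a \<and> window s (r a) \<and> window s c \<and> window s (r c))"
  proof
    assume w: "window s a \<and> window s (r a) \<and> window s c \<and> window s (r c)"
    have "a = s \<or> a = s + m" "c = s \<or> c = s + m"
      using w window_both[OF s lt(1)] window_both[OF s lt(3)] by blast+
    then show False using ac r_half(1)[OF s] r_half(2)[of s] quad_distinct[OF q] by auto
  qed
  have "window s a \<and> window s b \<or> window s (r a) \<and> window s (r b)"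
    "window s b \<and> window s c \<or> window s (r b) \<and> window s (r c)"
    "window s c \<and> window s d' \<or> window s (r c) \<and> window s (r d')"
    "window s d' \<and> window s a \<or> window s (r d') \<and> window s (r a)"
    "window s a \<and> window s c \<or> window s (r a) \<and> window s (r c)"
    by (rule e; simp)+
  then have "window s a \<and> window s b \<and> window s c \<and> window s d' \<or>
      window s (r a) \<and> window s (r b) \<and> window s (r c) \<and> window s (r d')"
    using n by satx
  then show ?thesis by simp
qed

text \<open>A diagonal other than the diameter flips inside one half polygon, where the plain
  Ptolemy relation holds; the diameter flips by \<open>diameter_relation\<close>.\<close>

lemma exchange_BC:
  assumes L: "labelled_tri L" "diagonal_pattern {last} L" and q: "quad (chords L) a b c d" and k: "L k = (a, c)"
  shows "Y a c * Y b d =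
        (if W = 2 \<and> k \<in> {last} then Y a b ^ (if r a = b then W else 1) + Y b c ^ (if r b = c then W else 1)
         else Y a b ^ (if r a = b then W else 1) * Y c d ^ (if r c = d then W else 1) +
              Y b c ^ (if r b = c then W else 1) * Y d a ^ (if r d = a then W else 1))"
proof -
  note lt = quad_less[OF ltri_tri[OF L(1)] q]
  have pw: "Y u v ^ (if r u = v then W else 1) = X u v" if "u \<in> {a, b, c, d}" "v \<in> {a, b, c, d}" for u v
    using Y_power[of u v] that lt by auto
  interpret F: orbit_flip "2 * m" r L k a b c d
    by unfold_locales (use L q k in auto)
  have ccw: "ccw a b c" "ccw c d a" using q by (auto simp: quad_def)
  have main: "Y a c * Y b d = (if is_C \<and> k = last then X a b + X b c else X a b * X c d + X b c * X d a)"
  proof (cases "k = last")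
    case True
    then have ra: "r a = c" using L(2) k unfolding diagonal_pattern_def by (metis fst_conv singletonI snd_conv)
    then have rb: "r b = d" using F.diameter_flip by blast
    have rc: "r c = a" "r d = b" using ra rb lt r_r by auto
    have "diameter_relation a b" using diameter_relation_ccw[OF lt(1,2)] ccw ra by simp
    moreover have "X c d = X a b" "X d a = X b c"
      using X_half_turn[OF lt(1,2)] X_half_turn[OF lt(2,3)] ra rb rc by auto
    ultimately show ?thesis using True by (simp add: diameter_relation_def ra rb)
  next
    case False
    then have ra: "r a \<noteq> c" using not_diameter[OF L, of k a c] k by simp
    then have rb: "r b \<noteq> d" using F.diameter_flip by blast
    obtain s where s: "s < m" "\<And>a b. orb (L last) a b \<longleftrightarrow> same_chord a b s (s + m)"
      using diameter_exists[OF L] by metis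
    have dm: "chords L s (s + m)" using s(2) chords_orb[of L last s "s + m"] by simp
    have pt: "X a c * X b d = X a b * X c d + X b c * X d a"
      using quad_window[OF L(1) s(1) dm q ra]
    proof
      assume w: "\<forall>u\<in>{a, b, c, d}. window s u"
      show ?thesis
      proof (rule ptolemy_ccw[OF ccw X_swap])
        fix u v w' z assume o: "u < v" "v < w'" "w' < z" "{u, v, w', z} = {a, b, c, d}"
        then have "window s u" "window s z" using w by blast+
        then show "X u w' * X v z = X u v * X w' z + X v w' * X u z"
          using X_ptolemy[of s u v w' z] o by (simp add: window_def)
      qed
    next
      assume w: "\<forall>u\<in>{a, b, c, d}. window s (r u)"
      have "ccw (r a) (r b) (r c)" "ccw (r c) (r d) (r a)" using ccw lt by (simp_all add: r_ccw)
      then have "X (r a) (r c) * X (r b) (r d) = X (r a) (r b) * X (r c) (r d) + X (r b) (r c) * X (r d) (r a)"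
      proof (rule ptolemy_ccw[OF _ _ X_swap])
        fix u v w' z assume o: "u < v" "v < w'" "w' < z" "{u, v, w', z} = {r a, r b, r c, r d}"
        then have "u \<in> {r a, r b, r c, r d}" "z \<in> {r a, r b, r c, r d}" by blast+
        then have "window s u" "window s z" using w by auto
        then show "X u w' * X v z = X u v * X w' z + X v w' * X u z"
          using X_ptolemy[of s u v w' z] o by (simp add: window_def)
      qed
      then show ?thesis using X_half_turn lt by simp
    qed
    have "Y a c = X a c" "Y b d = X b d" using ra rb by (simp_all add: Y_def)
    then show ?thesis using pt False by simp
  qed
  have e: "Y a b ^ (if r a = b then W else 1) = X a b" "Y c d ^ (if r c = d then W else 1) = X c d"
    "Y b c ^ (if r b = c then W else 1) = X b c" "Y d a ^ (if r d = a then W else 1) = X d a"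
    by (rule pw; simp)+
  show ?thesis unfolding e using main unfolding is_C_def by simp
qed

end

section \<open>Denominators with respect to one symmetric triangulation\<close>

locale type_BC_seed = type_BC \<sigma> x W for \<sigma> :: "'n::{finite,linorder} \<Rightarrow> nat" and x :: "'n tuple" and W :: nat +
  fixes L :: "'n \<Rightarrow> nat \<times> nat" and y :: "'n tuple" and s :: nat
  assumes L: "labelled_tri L" "diagonal_pattern {last} L" and indep: "alg_indep y"
    and y: "y $ i = Y (fst (L i)) (snd (L i))"
    and s: "s < m" "orb (L last) a b \<longleftrightarrow> same_chord a b s (s + m)" "same_chord (fst (L last)) (snd (L last)) s (s + m)"
begin

lemmas T = ltri_tri[OF L(1)]

lemma base: "chords L s (s + m)"
  using chords_orb[of L last s "s + m"] s(2) by simp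

lemma representative: "\<exists>g h. orb (L i) g h \<and> s \<le> g \<and> g < h \<and> h \<le> (s + m)"
proof -
  define p q where "p = fst (L i)" and "q = snd (L i)"
  have o: "orb (L i) p q" by (simp add: p_def q_def)
  have ne: "p \<noteq> q" "p < 2 * m" "q < 2 * m" using tri_edge[OF T chords_orb[of L i p q, OF o]] by auto
  have "orb (L i) (r p) (r q)" "r p \<noteq> r q" using ne orb_r[OF ltri_less[OF L(1)], of p q i] o r_eq_iff by auto
  then have "\<exists>g h. orb (L i) g h \<and> window s g \<and> window s h \<and> g \<noteq> h"
    using chord_window[OF L(1) s(1) base chords_orb[of L i p q, OF o]] o ne by blast
  then obtain g h where gh: "orb (L i) g h" "window s g" "window s h" "g \<noteq> h" by blast
  then consider "g < h" | "h < g" by linarith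
  then show ?thesis
  proof cases
    case 1 then show ?thesis using gh unfolding window_def by blast
  next
    case 2 then show ?thesis using gh orb_swap[of "L i" g h] unfolding window_def by blast
  qed
qed

definition G :: "'n \<Rightarrow> nat" where "G i = fst (SOME gh. orb (L i) (fst gh) (snd gh) \<and> s \<le> fst gh \<and> fst gh < snd gh \<and> snd gh \<le> (s + m))"

definition H :: "'n \<Rightarrow> nat" where "H i = snd (SOME gh. orb (L i) (fst gh) (snd gh) \<and> s \<le> fst gh \<and> fst gh < snd gh \<and> snd gh \<le> (s + m))"

lemma GH: "orb (L i) (G i) (H i)" "s \<le> G i" "G i < H i" "H i \<le> (s + m)"
proof -
  have "\<exists>gh. orb (L i) (fst gh) (snd gh) \<and> s \<le> fst gh \<and> fst gh < snd gh \<and> snd gh \<le> (s + m)"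
    using representative[of i] by simp
  from someI_ex[OF this] show "orb (L i) (G i) (H i)" "s \<le> G i" "G i < H i" "H i \<le> (s + m)"
    unfolding G_def H_def by blast+
qed

lemma GH_base: "i \<noteq> last \<Longrightarrow> (G i, H i) \<noteq> (s, (s + m))"
  using not_diameter[OF L, of i "G i" "H i"] GH(1)[of i] s(1) by (auto simp: r_half)

text \<open>A chord and its half turn image lie in the same closed half polygon only if the chord is
  the diameter.\<close>

lemma GH_unique:
  assumes "orb (L i) a b" "s \<le> a" "a < b" "b \<le> (s + m)"
  shows "(a, b) = (G i, H i)"
proof (rule ccontr)
  assume n: "(a, b) \<noteq> (G i, H i)"
  have lt: "fst (L i) < 2 * m" "snd (L i) < 2 * m" using ltri_less[OF L(1), of i] by auto
  have ab: "a < 2 * m" "b < 2 * m" using assms s(1) by auto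
  have "orb (G i, H i) a b"
    using orb_sym[of "L i" "(G i, H i)"] GH(1) assms(1) lt by simp
  then have "same_chord a b (r (G i)) (r (H i))"
    using n assms(3) GH(3)[of i] by (auto simp: orb_def same_chord_def)
  then have w: "window s (r (G i))" "window s (r (H i))"
    using assms by (auto simp: same_chord_def window_def)
  have "G i < 2 * m" "H i < 2 * m" "window s (G i)" "window s (H i)"
    using GH[of i] s(1) by (auto simp: window_def)
  then have "G i = s \<or> G i = (s + m)" "H i = s \<or> H i = (s + m)" using w window_both[OF s(1)] by blast+
  then have "G i = s" "H i = (s + m)" using GH(3)[of i] by auto
  then have "i = last" using GH_base by blast
  then show False using assms s n \<open>G i = s\<close> \<open>H i = (s + m)\<close> by (auto simp: same_chord_def)
qed

text \<open>Expected exponents inside the half polygon, where only the representative of each orbit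
  is met. At the diameter the value is \<open>- W\<close>, because its length is the
  \<open>W\<close>-th power of the variable.\<close>

definition E :: "'n \<Rightarrow> nat \<Rightarrow> nat \<Rightarrow> int" where
  "E i a b = (if i = last then (if (a, b) = (s, (s + m)) then - int W else 0) else crossing_number (G i) (H i) a b)"

lemma GH_last: "G last = s" "H last = (s + m)"
  using GH(1)[of last] GH(3)[of last] s(2) by (auto simp: same_chord_def)

lemma E_on_chord:
  assumes k: "orb (L k) a b" and ab: "s \<le> a" "a < b" "b \<le> (s + m)"
  shows "E i a b = (if i = k then (if k = last then - int W else - 1) else 0)"
proof (cases "i = k")
  case True
  have "(a, b) = (G k, H k)" by (rule GH_unique[OF k ab])
  then show ?thesis using True by (auto simp: E_def crossing_number_def GH_last)
next
  case False
  have "\<not> same_chord (G i) (H i) a b" "\<not> crosses (G i) (H i) a b"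
    using ltri_orb_not_eqc[OF L(1) GH(1) k False] ltri_orb_noncrossing[OF L(1) GH(1) k] by auto
  moreover have "i = last \<Longrightarrow> (a, b) \<noteq> (s, (s + m))"
    using False k s(2) ltri_inj[OF L(1), of k a b last] by auto
  ultimately show ?thesis using False by (auto simp: E_def crossing_number_def)
qed

lemma X_orb:
  assumes "orb (L k) a b"
  shows "X a b = y $ k ^ (if k = last then W else 1)"
proof -
  have lt: "fst (L k) < 2 * m" "snd (L k) < 2 * m" using ltri_less[OF L(1), of k] by auto
  have "X a b = X (fst (L k)) (snd (L k))"
  proof -
    have "X (r (snd (L k))) (r (fst (L k))) = X (fst (L k)) (snd (L k))" "X (r (fst (L k))) (r (snd (L k))) = X (fst (L k)) (snd (L k))"
      using X_half_turn lt X_swap[of "snd (L k)"] by auto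
    then show ?thesis using assms X_swap[of "snd (L k)"] unfolding orb_def same_chord_def by auto
  qed
  also have "\<dots> = y $ k ^ (if k = last then W else 1)"
    using Y_power[OF lt] L(2) unfolding y diagonal_pattern_def by auto
  finally show ?thesis .
qed

sublocale laurent_window "2 * m" s "s + m" "chords L" X y E
proof
  show "triangulation (2 * m) (chords L)" by (rule T)
  show "s < (s + m)" "(s + m) < 2 * m" "chords L s (s + m)" using s(1) m2 base by auto
  show "chords L u (Suc u)" if "s \<le> u" "u < (s + m)" for u
    using bdry_Suc[of u "2 * m"] that s(1) by (simp add: chords_def)
  show "X a c * X b d = X a b * X c d + X b c * X a d"
    if "s \<le> a" "a < b" "b < c" "c < d" "d \<le> (s + m)" for a b c d
    using X_ptolemy that .
  show "E i a c + E i b d = max (E i a b + E i c d) (E i b c + E i a d)"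
    if o: "s \<le> a" "a < b" "b < c" "c < d" "d \<le> (s + m)" for i a b c d
  proof (cases "i = last")
    case True
    then show ?thesis using o by (auto simp: E_def)
  next
    case False
    then show ?thesis using cr_tropical[OF o(2-4)] by (simp add: E_def)
  qed
  show "alg_indep y" by (rule indep)
  show "\<exists>k. X a b = y $ k \<and> (\<forall>i. E i a b = (if i = k then - 1 else 0))"
    if ab: "s \<le> a" "a < b" "b \<le> (s + m)" "chords L a b" "\<not> bdry (2 * m) a b" "(a, b) \<noteq> (s, (s + m))" for a b
  proof -
    obtain k where k: "orb (L k) a b" using ab unfolding chords_def by blast
    then have "k \<noteq> last" using s(2) ab by (auto simp: same_chord_def)
    then show ?thesis using E_on_chord[OF k ab(1-3)] X_orb[OF k] by (intro exI[of _ k]) simp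
  qed
  show "laurent_denom y (X a b) (\<lambda>i. E i a b)" if ab: "s \<le> a" "a < b" "b \<le> (s + m)" "chords L a b" for a b
  proof (cases "bdry (2 * m) a b")
    case True
    have "E i a b = 0" for i
    proof -
      have "\<not> same_chord (G i) (H i) a b"
        using True bdry_swap[of "2 * m"] ltri_orb_nbdry[OF L(1) GH(1), of i] by (auto simp: same_chord_def)
      moreover have "\<not> crosses (G i) (H i) a b"
        using tri_noncrossing[OF T chords_orb[of L i "G i" "H i", OF GH(1)] ab(4)] .
      moreover have "(a, b) \<noteq> (s, (s + m))" using bdry_not_diameter[OF True] s(1) by (auto simp: r_half)
      ultimately show ?thesis by (auto simp: E_def crossing_number_def)
    qed
    then show ?thesis using laurent_denom_1[OF indep] X_on_bdry[OF True] by simp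
  next
    case False
    then obtain k where k: "orb (L k) a b" using ab(4) unfolding chords_def by blast
    have "laurent_denom y (y $ k powi int (if k = last then W else 1))
        (\<lambda>i. if i = k then - int (if k = last then W else 1) else 0)"
      by (rule laurent_denom_var_power[OF indep])
    moreover have "(\<lambda>i. E i a b) = (\<lambda>i. if i = k then - int (if k = last then W else 1) else 0)"
      using E_on_chord[OF k ab(1-3)] by (intro ext) simp
    ultimately show ?thesis using X_orb[OF k] by (simp only: power_int_of_nat)
  qed
qed

text \<open>A chord from \<open>j\<close> out of the half polygon across the diameter crosses the
  representative of orbit i exactly when \<open>j\<close> is strictly below it.\<close>

definition leave :: "'n \<Rightarrow> nat \<Rightarrow> int" where
  "leave i j = (if i \<noteq> last \<and> G i < j \<and> j < H i then 1 else 0)"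

lemma base_length: "X s (s + m) = y $ last ^ W" "V s s = X s (s + m)"
  using X_orb[of last s "s + m"] s(2) X_opposite[of s s] s(1) m2 by (simp_all add: r_half)

text \<open>A Ptolemy relation with the diameter at \<open>s\<close>: inside the window
  \<open>V u s\<close> is the length from \<open>u\<close> to its far end, \<open>UU s u\<close>
  that from its near end. The term with \<open>t\<close> is the deviation due to the trace.\<close>

lemma V_identity: "V i j * V s s = V i s * V j s + t * (V i s * UU s j) + UU s i * UU s j"
  unfolding V_def UU_def by (simp add: algebra_simps)

text \<open>\<open>V_identity\<close> reduces to chords inside the half polygon. The trace term has
  no larger denominators than the first two terms together, and dividing by
  \<open>y $ last ^ W\<close> adds \<open>W\<close> at the diameter.\<close>

lemma leaving_denominator:
  assumes ij: "s < j" "j \<le> i" "i < (s + m)"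
  shows "laurent_denom y (X i (r j)) (\<lambda>u. leave u i + leave u j + (if u = last then int W else 0))"
proof -
  have je: "j < (s + m)" "s < i" "i < j + m" "i < 2 * m" using ij s(1) by auto
  have Ve: "V u s = X u (s + m)" if "s < u" "u < (s + m)" for u
    using X_opposite[of s u] that s(1) by (simp add: r_half)
  have Us: "UU s u = X s u" if "s < u" "u < (s + m)" for u
    using X_direct[of s u] that by simp
  have sides: "laurent_denom y (X u (s + m)) (\<lambda>k. E k u (s + m))" "laurent_denom y (X s u) (\<lambda>k. E k s u)"
    if "s < u" "u < (s + m)" for u
    using laurent_denom_window[of u "s + m"] laurent_denom_window[of s u] that by simp_all
  let ?d = "\<lambda>k. max (E k i (s + m) + E k j (s + m)) (E k s i + E k s j)"
  have d: "?d = (\<lambda>k. leave k i + leave k j)"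
    and le: "E k i (s + m) + E k s j \<le> ?d k" for k
  proof -
    have "?d k = leave k i + leave k j \<and> E k i (s + m) + E k s j \<le> ?d k" for k
    proof (cases "k = last")
      case True
      then show ?thesis using ij je by (simp add: E_def leave_def)
    next
      case False
      note c = cr_leaving[OF GH(2-4) GH_base[OF False] ij]
      show ?thesis using c False by (simp add: E_def leave_def)
    qed
    then show "?d = (\<lambda>k. leave k i + leave k j)" "E k i (s + m) + E k s j \<le> ?d k" for k by (intro ext, blast, blast)
  qed
  have "laurent_denom y ((X i (s + m) * X j (s + m) + X s i * X s j) + of_nat (2 * (W - 1)) * (X i (s + m) * X s j)) ?d"
    by (rule laurent_denom_add_nat[OF indep _ _ le]) (intro laurent_denom_add laurent_denom_mult indep sides je ij(1,3))+
  moreover have "(X i (s + m) * X j (s + m) + X s i * X s j) + of_nat (2 * (W - 1)) * (X i (s + m) * X s j) = X i (r j) * y $ last ^ W"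
    using V_identity[of i j] X_opposite[of j i] ij je Ve[of i] Ve[of j] Us[of i] Us[of j] base_length
    by (simp add: t_def add_ac)
  ultimately have "laurent_denom y (X i (r j) * y $ last ^ W) (\<lambda>k. leave k i + leave k j)"
    unfolding d by simp
  from laurent_denom_divide_power[OF indep this, of last W]
  show ?thesis using alg_indep_nonzero[OF indep, of last] by (simp add: add_ac)
qed

text \<open>In type C the relation between two diameters is linear, so a single division by
  \<open>y $ last\<close> suffices and the exponent at the diameter is 1.\<close>

lemma diameter_denominator:
  assumes i: "s < i" "i < (s + m)" and C: is_C
  shows "laurent_denom y (Y i (r i)) (\<lambda>u. leave u i + (if u = last then 1 else 0))"
proof -
  have sides: "laurent_denom y (X i (s + m)) (\<lambda>k. E k i (s + m))" "laurent_denom y (X s i) (\<lambda>k. E k s i)"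
    using laurent_denom_window[of i "s + m"] laurent_denom_window[of s i] i by simp_all
  have "diameter_relation s i"
    using diameter_relation_ccw[of s i] i s(1) by (simp add: ccw_def r_half)
  then have rel: "Y s (s + m) * Y i (r i) = X s i + X i (s + m)"
    using C s(1) by (simp add: diameter_relation_def r_half)
  have Ys: "Y s (s + m) = y $ last"
    using s(3) y[of last] Y_swap'[of s "s + m"] s(1) by (auto simp: same_chord_def)
  have "max (E k s i) (E k i (s + m)) = leave k i" for k
  proof (cases "k = last")
    case True
    then show ?thesis using i by (simp add: E_def leave_def)
  next
    case False
    note c = cr_leaving[OF GH(2-4) GH_base[OF False] i(1) order.refl i(2)]
    show ?thesis using c(1) False by (auto simp: E_def leave_def max_def split: if_splits)
  qed
  then have "laurent_denom y (X s i + X i (s + m)) (\<lambda>k. leave k i)"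
    using laurent_denom_add[OF indep sides(2,1)] by simp
  then have "laurent_denom y (Y i (r i) * y $ last) (\<lambda>k. leave k i)"
    using rel Ys by (simp add: mult.commute)
  from laurent_denom_divide_power[OF indep this, of last 1]
  show ?thesis using alg_indep_nonzero[OF indep, of last] by (simp cong: if_cong)
qed

end

lemma cr_window_leave:
  assumes "s \<le> g" "g < h" "h \<le> s + m" "s < i" "i < s + m" "q < s \<or> s + m < q"
  shows "crossing_number g h i q = (if g < i \<and> i < h then 1 else (0::int))"
proof -
  have "\<not> same_chord g h i q" using assms by (auto simp: same_chord_def)
  moreover have "crosses g h i q \<longleftrightarrow> g < i \<and> i < h"
    using assms unfolding crosses_def ccw_def by (smt (z3))
  ultimately show ?thesis by (simp add: crossing_number_def)
qed

lemma cr_window_outside: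
  assumes "s \<le> g" "g < h" "h \<le> s + m" "(g, h) \<noteq> (s, s + m)" "u \<le> s \<or> s + m \<le> u" "v \<le> s \<or> s + m \<le> v"
  shows "crossing_number g h u v = 0"
proof -
  have "\<not> same_chord g h u v" using assms by (auto simp: same_chord_def)
  moreover have "\<not> crosses g h u v"
    using assms unfolding crosses_def ccw_def by (smt (z3))
  ultimately show ?thesis by (simp add: crossing_number_def)
qed

context type_BC
begin

text \<open>The diameter is its own image, so orbit sums count a crossing with it twice, whereas its
  variable has exponent \<open>W\<close> in the denominator of the length of a chord crossing it.
  The two agree because \<open>D last * W = 2\<close>.\<close>

definition D :: "'n \<Rightarrow> int" where "D i = (if i = last \<and> \<not> is_C then 2 else 1)"

lemma D_W: "D last * int W = 2"
proof (cases is_C)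
  case True
  then have "D last = 1" by (simp add: D_def)
  then show ?thesis unfolding W_cases(1)[OF True] by simp
next
  case False
  then have "D last = 2" by (simp add: D_def)
  then show ?thesis unfolding W_cases(2)[OF False] by simp
qed

end

section \<open>From the half polygon to all chords\<close>

context type_BC_seed
begin

definition crossing_sum :: "'n \<Rightarrow> nat \<Rightarrow> nat \<Rightarrow> int" where
  "crossing_sum i p q = crossing_number (fst (L i)) (snd (L i)) p q + crossing_number (r (fst (L i))) (r (snd (L i))) p q"

definition crossing_formula :: "nat \<Rightarrow> nat \<Rightarrow> bool" where
  "crossing_formula p q \<longleftrightarrow> (\<exists>d. laurent_denom y (Y p q) d \<and>
     (\<forall>i. d i * D i * int (if r p = q then W else 1) = crossing_sum i p q))"

lemma GH_less: "G i < 2 * m" "H i < 2 * m"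
  using GH(3,4)[of i] s(1) by auto

lemma crossing_sum_GH:
  assumes pq: "p < 2 * m" "q < 2 * m"
  shows "crossing_sum i p q = crossing_number (G i) (H i) p q + crossing_number (G i) (H i) (r p) (r q)"
proof -
  define g where "g = (\<lambda>a b. crossing_number a b p q + crossing_number (r a) (r b) p q)"
  have lt: "fst (L i) < 2 * m" "snd (L i) < 2 * m" using ltri_less[OF L(1), of i] by auto
  have sw: "g a b = g b a" for a b unfolding g_def using cr_swap(1) by metis
  have gr: "g (r a) (r b) = g a b" if "a < 2 * m" "b < 2 * m" for a b
    using that by (simp add: g_def r_r)
  have "g (G i) (H i) = g (fst (L i)) (snd (L i))"
    using GH(1)[of i] gr[OF lt] gr[OF lt(2,1)] sw unfolding orb_def same_chord_def by metis
  then show ?thesis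
    using cr_r[OF GH_less pq, of i i] by (simp add: crossing_sum_def g_def)
qed

lemma crossing_formula_swap:
  assumes "p < 2 * m" "q < 2 * m" "crossing_formula p q" shows "crossing_formula q p"
proof -
  have "crossing_sum i q p = crossing_sum i p q" for i
    unfolding crossing_sum_def using cr_swap(2)[of _ _ p q] by simp
  then show ?thesis
    using assms Y_swap'[OF assms(1,2)] r_eq_swap[OF assms(1,2)] by (simp add: crossing_formula_def)
qed

lemma crossing_formula_half_turn:
  assumes pq: "p < 2 * m" "q < 2 * m" and c: "crossing_formula (r p) (r q)" shows "crossing_formula p q"
proof -
  have "crossing_sum i (r p) (r q) = crossing_sum i p q" for i
    using crossing_sum_GH[OF pq] crossing_sum_GH[of "r p" "r q"] pq r_less by (simp add: r_r)
  moreover have "r (r p) = r q \<longleftrightarrow> r p = q" using pq r_eq_iff r_less by simp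
  ultimately show ?thesis using c Y_half_turn[OF pq] by (simp add: crossing_formula_def)
qed

lemma half_turn_outside: "window s p \<Longrightarrow> r p \<le> s \<or> s + m \<le> r p"
  by (auto simp: window_def r_def)

text \<open>The image of the chord lies in the opposite half, where it meets no representative other
  than the diameter; the diameter itself is counted twice, which \<open>D\<close> and
  \<open>W\<close> compensate.\<close>

lemma crossing_formula_window:
  assumes pq: "s \<le> p" "p < q" "q \<le> s + m" shows "crossing_formula p q"
proof -
  have lt: "p < 2 * m" "q < 2 * m" using pq s(1) by auto
  have w: "window s p" "window s q" using pq by (auto simp: window_def)
  have out: "crossing_number (G i) (H i) (r p) (r q) = 0" if "i \<noteq> last" for i
    by (rule cr_window_outside[OF GH(2-4) GH_base[OF that]]) (use half_turn_outside w in auto)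
  then have other: "crossing_sum i p q = E i p q" if "i \<noteq> last" for i
    using that by (simp add: crossing_sum_GH[OF lt] E_def)
  show ?thesis
  proof (cases "(p, q) = (s, s + m)")
    case True
    then have rp: "r p = q" using s(1) by (simp add: r_half)
    have o: "orb (L last) p q" using True s(2) by simp
    have "Y p q = y $ last"
      using True s(3) y[of last] Y_swap'[OF lt] by (auto simp: same_chord_def)
    then have "laurent_denom y (Y p q) (\<lambda>i. if i = last then - 1 else 0)"
      using laurent_denom_var_power[OF indep, of last 1] by simp
    moreover have "(if i = last then - 1 else 0) * D i * int (if r p = q then W else 1) = crossing_sum i p q" for i
    proof (cases "i = last")
      case i: True
      have "r q = p" using rp lt r_eq_swap by simp
      then have "crossing_sum last p q = crossing_number s (s + m) p q + crossing_number s (s + m) q p"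
        by (simp add: crossing_sum_GH[OF lt] GH_last rp)
      then have "crossing_sum last p q = - 2"
        using True by (auto simp: crossing_number_def)
      then show ?thesis using i rp D_W by simp
    next
      case False
      then show ?thesis using other[OF False] E_on_chord[OF o pq, of i] by simp
    qed
    ultimately show ?thesis unfolding crossing_formula_def by blast
  next
    case False
    have rp: "r p \<noteq> q"
    proof
      assume "r p = q"
      then have "p = s \<or> p = s + m" using window_both[OF s(1) lt(1) w(1)] w(2) by simp
      then show False using False pq \<open>r p = q\<close> s(1) by (auto simp: r_half)
    qed
    have "crossing_sum last p q = 0"
    proof -
      have "\<not> crosses s (s + m) p q" "\<not> crosses s (s + m) (r p) (r q)"
        using pq half_turn_outside[OF w(1)] half_turn_outside[OF w(2)] unfolding crosses_def ccw_def by (smt (z3))+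
      moreover have "\<not> same_chord s (s + m) p q" using False pq by (auto simp: same_chord_def)
      moreover have "\<not> same_chord s (s + m) (r p) (r q)"
      proof -
        have "\<not> same_chord (r s) (r (s + m)) (r p) (r q)"
          using r_eqc[of s "s + m" p q] \<open>\<not> same_chord s (s + m) p q\<close> lt s(1) by simp
        then show ?thesis using s(1) by (auto simp: r_half same_chord_def)
      qed
      ultimately show ?thesis by (simp add: crossing_sum_GH[OF lt] GH_last crossing_number_def)
    qed
    moreover have "E last p q = 0" using False by (auto simp: E_def)
    ultimately have "E i p q * D i * int (if r p = q then W else 1) = crossing_sum i p q" for i
      using other[of i] rp by (cases "i = last") (simp_all add: D_def)
    moreover have "laurent_denom y (Y p q) (\<lambda>i. E i p q)"
      using laurent_denom_window[OF pq] rp by (simp add: Y_def)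
    ultimately show ?thesis unfolding crossing_formula_def by blast
  qed
qed

text \<open>The chord leaves the half polygon at \<open>i\<close> and its image leaves it at
  \<open>j\<close>; each contributes its own \<open>leave\<close> and one crossing with the
  diameter.\<close>

lemma crossing_formula_leaving:
  assumes ij: "s < j" "j \<le> i" "i < s + m" shows "crossing_formula i (r j)"
proof -
  have lt: "i < 2 * m" "j < 2 * m" "r j < 2 * m" "r i < 2 * m" using ij s(1) r_less by auto
  have out: "r u < s \<or> s + m < r u" if "s < u" "u < s + m" for u
    using that by (auto simp: r_def)
  have one: "crossing_number (G k) (H k) u (r v) = (if k = last then 1 else leave k u)"
    if "s < u" "u < s + m" "s < v" "v < s + m" for k u v
    using cr_window_leave[OF GH(2-4) that(1,2) out[OF that(3,4)], of k] that
    by (auto simp: leave_def GH_last)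
  have sum: "crossing_sum k i (r j) = (if k = last then 2 else leave k i + leave k j)" for k
    using one[of i j k] one[of j i k] ij lt cr_swap(2)[of "G k" "H k" j "r i"]
    by (simp add: crossing_sum_GH r_r)
  have ll: "leave last u = 0" for u by (simp add: leave_def)
  show ?thesis
  proof (cases "i = j \<and> is_C")
    case True
    have "laurent_denom y (Y i (r j)) (\<lambda>u. leave u i + (if u = last then 1 else 0))"
      using diameter_denominator[of i] True ij by simp
    moreover have "(leave k i + (if k = last then 1 else 0)) * D k * int (if r i = r j then W else 1)
        = crossing_sum k i (r j)" for k
    proof -
      have wt: "(if r i = r j then W else 1) = 2" using True W_cases(1) by auto
      have D: "D k = 1" using True by (simp add: D_def)
      show ?thesis unfolding wt D sum using True by (auto simp: ll)
    qed
    ultimately show ?thesis unfolding crossing_formula_def by blast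
  next
    case False
    have Y: "Y i (r j) = X i (r j)"
      using False lt r_eq_iff by (auto simp: Y_def)
    have wt: "(if r i = r j then W else 1) = 1"
      using False lt r_eq_iff W_cases(2) by auto
    have "(leave k i + leave k j + (if k = last then int W else 0)) * D k * int (if r i = r j then W else 1)
        = crossing_sum k i (r j)" for k
      unfolding wt using D_W by (cases "k = last") (simp_all add: sum ll D_def mult.commute)
    then show ?thesis using leaving_denominator[OF ij] unfolding crossing_formula_def Y by blast
  qed
qed

text \<open>Up to swapping the ends and applying the half turn, a chord lies in the half polygon or
  leaves it through the diameter.\<close>

lemma crossing_formula_all:
  assumes "p < 2 * m" "q < 2 * m" "p \<noteq> q" shows "crossing_formula p q"
proof -
  have *: "crossing_formula p q" if pq: "p < 2 * m" "q < 2 * m" "p \<noteq> q" "window s p" for p q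
  proof (cases "window s q")
    case True
    then show ?thesis
      using pq crossing_formula_window[of p q] crossing_formula_window[of q p] crossing_formula_swap[of q p] unfolding window_def
      by (cases "p < q") auto
  next
    case False
    then have rq: "window s (r q)" using window_or[OF s(1) pq(2)] by blast
    show ?thesis
    proof (cases "window s (r p)")
      case True
      then have "crossing_formula (r p) (r q)"
        using rq pq r_eq_iff[of p q] r_less crossing_formula_window[of "r p" "r q"] crossing_formula_window[of "r q" "r p"]
          crossing_formula_swap[of "r q" "r p"] unfolding window_def by (cases "r p < r q") auto
      then show ?thesis using crossing_formula_half_turn pq by blast
    next
      case n: False
      define j where "j = r q"
      have q: "q = r j" "j < 2 * m" using pq r_less by (simp_all add: j_def r_r)
      have bds: "u \<noteq> s \<and> u \<noteq> s + m" if "\<not> window s (r u)" for u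
        using that s(1) by (auto simp: window_def r_half)
      have j: "s < j" "j < s + m"
      proof -
        have "window s j" using rq unfolding j_def .
        moreover have "\<not> window s (r j)" using False q(1) by metis
        ultimately
        show "s < j" "j < s + m" using bds[of j] unfolding window_def by auto
      qed
      have p: "s < p" "p < s + m" using pq(4) bds[OF n] unfolding window_def by auto
      show ?thesis
      proof (cases "j \<le> p")
        case True
        then show ?thesis using crossing_formula_leaving j p q by simp
      next
        case g: False
        then have "crossing_formula j (r p)" using crossing_formula_leaving j p by simp
        then have "crossing_formula (r q) (r p)" by (simp add: j_def)
        then have "crossing_formula q p" using crossing_formula_half_turn pq by blast
        then show ?thesis using crossing_formula_swap pq by blast
      qed
    qed
  qed
  show ?thesis
    using window_or[OF s(1) assms(1)] *[OF assms] *[of "r p" "r q"] assms r_less r_eq_iff crossing_formula_half_turn by blast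
qed

end

context type_BC
begin

sublocale M: cluster_model "2 * m" r Y "{last}" W D
proof
  show "W = 1 \<or> W = 2" by (rule W12)
  show "Y a b = Y b a" if "a < 2 * m" "b < 2 * m" for a b using Y_swap' that .
  show "Y (r a) (r b) = Y a b" if "a < 2 * m" "b < 2 * m" for a b using Y_half_turn that .
  show "Y a b = 1" if "bdry (2 * m) a b" for a b
    using X_on_bdry[OF that] bdry_not_diameter[OF that] by (simp add: Y_def)
  fix L :: "'n \<Rightarrow> nat \<times> nat"
  assume L: "labelled_tri L" "diagonal_pattern {last} L"
  show "Y a c * Y b d =
        (if W = 2 \<and> k \<in> {last} then Y a b ^ (if r a = b then W else 1) + Y b c ^ (if r b = c then W else 1)
         else Y a b ^ (if r a = b then W else 1) * Y c d ^ (if r c = d then W else 1) +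
              Y b c ^ (if r b = c then W else 1) * Y d a ^ (if r d = a then W else 1))"
    if "quad (chords L) a b c d" "L k = (a, c)" for a b c d k
    using exchange_BC[OF L that] .
  fix y :: "'n tuple" and p q
  assume y: "alg_indep y" "\<And>i. y $ i = Y (fst (L i)) (snd (L i))" and pq: "edge (2 * m) p q"
  obtain s where s: "s < m" "\<And>a b. orb (L last) a b \<longleftrightarrow> same_chord a b s (s + m)"
    "same_chord (fst (L last)) (snd (L last)) s (s + m)"
    using diameter_exists[OF L] by metis
  interpret S: type_BC_seed \<sigma> x W L y s
    by unfold_locales (use L y s in auto)
  show "\<exists>e. laurent_denom y (Y p q) e \<and> (\<forall>i. e i * D i * int (if r p = q then W else 1) =
      crossing_number (fst (L i)) (snd (L i)) p q + crossing_number (r (fst (L i))) (r (snd (L i))) p q)"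
    using S.crossing_formula_all[of p q] pq unfolding S.crossing_formula_def S.crossing_sum_def edge_def by blast
qed

section \<open>The fan seed in types B and C\<close>

lemma \<sigma>_last: "\<sigma> i = CARD('n) \<longleftrightarrow> i = last"
  using \<sigma>_\<tau>[of "CARD('n)"] zero_less_card_finite[where 'a='n] \<sigma>_inj[of i last] by (simp add: last_def)

lemma fan_orb: "orb (fan i) a b \<longleftrightarrow> same_chord a b 0 (Suc (\<sigma> i)) \<or> same_chord a b m (r (Suc (\<sigma> i)))"
  using m2 by (simp add: orb_def fan_def r_half[of 0])

lemma r_Suc: "r (Suc (\<sigma> i)) = (if i = last then 0 else Suc (\<sigma> i) + m)"
  using \<sigma>_last[of i] \<sigma>_range(2)[of i] by (auto simp: r_def m_def)

lemma fan_chord: "2 \<le> j \<Longrightarrow> j \<le> m \<Longrightarrow> orb (fan (\<tau> (j - 1))) 0 j"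
  using \<sigma>_\<tau>[of "j - 1"] by (simp add: fan_orb m_def)

lemma fan_chord': "2 \<le> j \<Longrightarrow> j < m \<Longrightarrow> orb (fan (\<tau> (j - 1))) m (j + m)"
  using \<sigma>_\<tau>[of "j - 1"] by (simp add: fan_orb m_def r_half)

text \<open>A fan at 0 in one half and its image at \<open>m\<close> in the other, glued along the
  diameter \<open>0 m\<close>. Any other chord crosses the diameter or a neighbouring diagonal of
  one fan.\<close>

lemma fan_tri: "labelled_tri fan"
  unfolding labelled_tri_def
proof (intro conjI allI impI)
  let ?T = "chords fan"
  have v: "r (Suc (\<sigma> i)) = 0 \<and> Suc (\<sigma> i) = m \<or> m < r (Suc (\<sigma> i)) \<and> r (Suc (\<sigma> i)) < 2 * m \<and> Suc (\<sigma> i) < m \<and> 0 < \<sigma> i" for i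
    using \<sigma>_last[of i] \<sigma>_range[of i] by (auto simp: r_Suc m_def)
  have edge: "edge (2 * m) a b" if "?T a b" for a b
  proof -
    have "edge (2 * m) a b" if "orb (fan i) a b" for i
      using that v[of i] m2 unfolding fan_orb edge_def same_chord_def by (smt (z3))
    then show ?thesis using that by (auto simp: chords_def bdry_def)
  qed
  have oo: "\<not> crosses a b c d" if o: "orb (fan i) a b" "orb (fan j) c d" for i j a b c d
  proof -
    have "a = c \<or> a = d \<or> b = c \<or> b = d \<or> (a \<le> m \<and> b \<le> m \<and> (c = 0 \<or> m \<le> c) \<and> (d = 0 \<or> m \<le> d))
      \<or> (c \<le> m \<and> d \<le> m \<and> (a = 0 \<or> m \<le> a) \<and> (b = 0 \<or> m \<le> b))"
      using o v[of i] v[of j] unfolding fan_orb same_chord_def by (smt (z3))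
    then show ?thesis using edge o unfolding crosses_def ccw_def by (smt (z3))
  qed
  have nc: "\<not> crosses a b c d" if ab: "?T a b" and cd: "?T c d" for a b c d
  proof -
    have b: "\<not> crosses a b c d" if "bdry (2 * m) a b" "?T c d" for a b c d
      using edge[OF that(2)] that(1) unfolding bdry_def edge_def by blast
    consider "bdry (2 * m) a b" | "bdry (2 * m) c d" | i j where "orb (fan i) a b" "orb (fan j) c d"
      using ab cd unfolding chords_def by blast
    then show ?thesis
    proof cases
      case 1 then show ?thesis using b cd by blast
    next
      case 2 then show ?thesis using b[of c d a b] ab crs_swap(3) by blast
    next
      case 3 then show ?thesis using oo by blast
    qed
  qed
  have sw: "?T a b \<longleftrightarrow> ?T b a" for a b
    unfolding chords_def using bdry_swap orb_swap by blast
  have ch: "?T 0 j" if "2 \<le> j" "j \<le> m" for j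
    using fan_chord[OF that] unfolding chords_def by blast
  have ch': "?T m (j + m)" if "2 \<le> j" "j < m" for j
    using fan_chord'[OF that] unfolding chords_def by blast
  have max: "?T a b" if ab: "a < b" "b < 2 * m" and n: "\<And>c d. ?T c d \<Longrightarrow> \<not> crosses a b c d" for a b
  proof -
    consider "b = Suc a" | "a = 0" "b = 2 * m - 1" | "a = 0" "2 \<le> b" "b \<le> m"
      | "a = 0" "m < b" "Suc b < 2 * m" | "0 < a" "Suc a < b" "b \<le> m" | "0 < a" "a < m" "m < b"
      | "a = m" "Suc a < b" | "m < a" "Suc a < b"
      using ab by (smt (z3))
    then show ?thesis
    proof cases
      case 1 then show ?thesis using bdry_Suc ab by (simp add: chords_def)
    next
      case 2 then show ?thesis using bdry_last[of "2 * m"] m2 by (simp add: chords_def)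
    next
      case 3 then show ?thesis using ch by simp
    next
      case 4
      then have "?T m (Suc b - m + m)" by (intro ch') auto
      then have "\<not> crosses a b m (Suc b)" using n 4 by simp
      then show ?thesis using 4 m2 by (auto simp: crosses_def ccw_def)
    next
      case 5
      then have "\<not> crosses a b 0 (Suc a)" using n ch[of "Suc a"] by simp
      then show ?thesis using 5 by (auto simp: crosses_def ccw_def)
    next
      case 6
      then have "\<not> crosses a b 0 m" using n ch[of m] m2 by simp
      then show ?thesis using 6 by (auto simp: crosses_def ccw_def)
    next
      case 7
      then show ?thesis using ch'[of "b - m"] ab by simp
    next
      case 8
      then have "?T m (Suc a - m + m)" using ab by (intro ch') auto
      then have "\<not> crosses a b m (Suc a)" using n 8 by simp
      then show ?thesis using 8 ab by (auto simp: crosses_def ccw_def)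
    qed
  qed
  show "triangulation (2 * m) ?T"
    unfolding triangulation_def
  proof (intro allI iffI)
    fix a b assume "?T a b"
    then show "edge (2 * m) a b \<and> (\<forall>c d. ?T c d \<longrightarrow> \<not> crosses a b c d)" using nc edge by blast
  next
    fix a b assume ab: "edge (2 * m) a b \<and> (\<forall>c d. ?T c d \<longrightarrow> \<not> crosses a b c d)"
    then consider "a < b" | "b < a" unfolding edge_def by linarith
    then show "?T a b"
    proof cases
      case 1 then show ?thesis using max[of a b] ab by (simp add: edge_def)
    next
      case 2 then show ?thesis using max[of b a] ab crs_swap(1)[of a b] sw[of a b] by (simp add: edge_def)
    qed
  qed
  show "i = j" if "orb (fan i) a b" "orb (fan j) a b" for i j a b
    using that v[of i] v[of j] \<sigma>_inj[of i j] unfolding fan_orb same_chord_def by (auto simp: r_Suc split: if_splits)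
  show "\<not> bdry (2 * m) (fst (fan i)) (snd (fan i))" for i
    using bdry_cases[of "2 * m" 0 "Suc (\<sigma> i)"] \<sigma>_range[of i] by (auto simp: fan_def m_def)
qed

lemma fan_seed:
  assumes B: "\<And>i k. Q $ i $ k * int (if k = last then W else 1) =
      int (if i = last then W else 1) * (linear_quiver \<sigma> i k * (if k = last then 2 else 1))"
  shows "M.seed_tri fan (Q, x)"
  unfolding M.seed_tri_def
proof (intro conjI allI fan_tri)
  have "r 0 = m" using m2 by (simp add: r_def)
  moreover have "m = Suc (\<sigma> i) \<longleftrightarrow> i = last" for i
    using \<sigma>_last[of i] unfolding m_def by linarith
  ultimately show "diagonal_pattern {last} fan"
    by (simp add: diagonal_pattern_def fan_def)
  define \<beta>' where "\<beta>' = (\<lambda>i k. linear_quiver \<sigma> i k * (if k = last then 2 else 1))"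
  have "exchange_matrix fan \<beta>'"
  proof (rule exchange_matrixI[OF fan_tri])
    fix k
    let ?k = "\<sigma> k"
    have k: "1 \<le> ?k" "Suc ?k \<le> m" using \<sigma>_range[of k] by (auto simp: m_def)
    have ch: "chords fan 0 j" if "1 \<le> j" "j \<le> m" for j
      using that fan_chord[of j] bdry_Suc[of 0 "2 * m"] m2 unfolding chords_def
      by (cases "j = 1") auto
    have sc: "chords fan j (Suc j)" if "Suc j < 2 * m" for j
      using that bdry_Suc[of j "2 * m"] by (simp add: chords_def)
    have sy: "chords fan a b \<Longrightarrow> chords fan b a" for a b using tri_sym[OF ltri_tri[OF fan_tri]] .
    have v: "r (Suc (\<sigma> i)) = 0 \<and> Suc (\<sigma> i) = m \<or> r (Suc (\<sigma> i)) = Suc (\<sigma> i) + m \<and> Suc (\<sigma> i) < m" for i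
      using \<sigma>_last[of i] \<sigma>_range[of i] by (auto simp: r_Suc m_def)
    show "\<exists>a b c d. quad (chords fan) a b c d \<and> orb (a, c) (fst (fan k)) (snd (fan k)) \<and>
       (\<forall>i. \<beta>' i k = quad_sum fan i a b c d)"
    proof (cases "k = last")
      case False
      then have k3: "Suc (Suc ?k) \<le> m" using \<sigma>_last[of k] k by (auto simp: m_def)
      have "quad (chords fan) 0 ?k (Suc ?k) (Suc (Suc ?k))"
        unfolding quad_def using k k3 ch[of ?k] ch[of "Suc ?k"] sy[OF ch[of "Suc (Suc ?k)"]] sc[of ?k] sc[of "Suc ?k"]
        by (auto simp: ccw_def)
      moreover have "\<beta>' i k = quad_sum fan i 0 ?k (Suc ?k) (Suc (Suc ?k))" for i
      proof -
        have "orb (fan i) 0 ?k \<longleftrightarrow> Suc (\<sigma> i) = ?k" "\<not> orb (fan i) (Suc ?k) (Suc (Suc ?k))"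
          "\<not> orb (fan i) ?k (Suc ?k)" "orb (fan i) (Suc (Suc ?k)) 0 \<longleftrightarrow> \<sigma> i = Suc ?k"
          using k k3 v[of i] unfolding fan_orb same_chord_def by (smt (z3))+
        then show ?thesis using False by (simp add: \<beta>'_def quad_sum_def ind_def linear_quiver_def)
      qed
      ultimately show ?thesis
        by (intro exI[of _ 0] exI[of _ ?k] exI[of _ "Suc ?k"] exI[of _ "Suc (Suc ?k)"]) (simp add: fan_def)
    next
      case True
      then have km: "Suc ?k = m" using \<sigma>_last[of k] by (simp add: m_def)
      have r0: "r 0 = m" "r ?k = ?k + m" using km m2 by (auto simp: r_def)
      have m: "chords fan m (?k + m)" using chords_r[OF fan_tri ch[of ?k]] k r0 by simp
      have "2 * m - 1 = ?k + m" using km by simp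
      then have "chords fan 0 (?k + m)" using bdry_last[of "2 * m"] m2 by (simp add: chords_def)
      \<comment> \<open>Here \<open>?k\<close> is \<open>m - 1\<close>; the half turn swaps 0 with
        \<open>m\<close> and \<open>?k\<close> with \<open>?k + m\<close>, so opposite sides share
        an orbit and give the doubled entry.\<close>
      then have "quad (chords fan) 0 ?k m (?k + m)"
        unfolding quad_def using k km ch[of ?k] ch[of m] sy sc[of ?k] m m2
        by (auto simp: ccw_def)
      moreover have "\<beta>' i k = quad_sum fan i 0 ?k m (?k + m)" for i
      proof -
        have "orb (fan i) 0 ?k \<longleftrightarrow> Suc (\<sigma> i) = ?k" "orb (fan i) m (?k + m) \<longleftrightarrow> Suc (\<sigma> i) = ?k"
          "\<not> orb (fan i) ?k m" "\<not> orb (fan i) (?k + m) 0" "\<sigma> i \<noteq> Suc ?k"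
          using k km v[of i] unfolding fan_orb same_chord_def by (smt (z3))+
        then show ?thesis using True by (simp add: \<beta>'_def quad_sum_def ind_def linear_quiver_def)
      qed
      ultimately show ?thesis using km
        by (intro exI[of _ 0] exI[of _ ?k] exI[of _ m] exI[of _ "?k + m"]) (simp add: fan_def)
    qed
  qed
  then show "\<exists>\<beta>. exchange_matrix fan \<beta> \<and> (\<forall>i k. fst (Q, x) $ i $ k * int (M.wn k) = int (M.wn i) * \<beta> i k)"
    using B by (intro exI[of _ \<beta>']) (simp add: M.wn_def \<beta>'_def)
  show "snd (Q, x) $ i = Y (fst (fan i)) (snd (fan i))" for i
  proof -
    have si: "Suc (\<sigma> i) \<le> m" using \<sigma>_range(2)[of i] by (simp add: m_def)
    have X: "X 0 (Suc (\<sigma> i)) = f (Suc (\<sigma> i))"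
      using X_direct[of 0 "Suc (\<sigma> i)"] UU_U[of 0 "Suc (\<sigma> i)"] U_0[of "Suc (\<sigma> i)"] si by simp
    show ?thesis
    proof (cases "i = last")
      case True
      then have sm: "Suc (\<sigma> i) = m" using \<sigma>_last[of i] by (simp add: m_def)
      show ?thesis
      proof (cases is_C)
        case C: True
        have "A 0 + B 0 = 1" using m2 ends by (simp add: A_def B_def)
        then show ?thesis using C sm True m2 by (simp add: fan_def Y_def r_half)
      next
        case False
        have "x $ last ^ W = x $ last" using W_cases(2)[OF False] by (metis power_one_right)
        then show ?thesis using X sm True f_m False by (simp add: fan_def Y_def)
      qed
    next
      case False
      then have "Suc (\<sigma> i) < m" "\<sigma> i \<ge> 1" using \<sigma>_last[of i] si \<sigma>_range(1)[of i] by (auto simp: m_def)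
      then show ?thesis using X \<tau>_\<sigma>[of i] m2 by (simp add: fan_def Y_def r_half f_def)
    qed
  qed
  show "alg_indep (snd (Q, x))" using x by simp
qed

end

section \<open>Dynkin diagrams and the theorem\<close>

text \<open>Walk back from the anchored seed to the root and on to \<open>t\<^sub>0\<close>; from
  there both clusters are reached through the root again.\<close>

lemma (in cluster_model) denominator_injective_pattern:
  assumes g: "good_seed \<Sigma>" and L: "seed_tri L (fold mutate w \<Sigma>)"
    and d: "monomial_denominator_vector (cluster_at \<Sigma> t\<^sub>0) (cluster_at \<Sigma> t) k =
            monomial_denominator_vector (cluster_at \<Sigma> t\<^sub>0) (cluster_at \<Sigma> s) l"
  shows "cluster_monomial (cluster_at \<Sigma> t) k = cluster_monomial (cluster_at \<Sigma> s) l"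
proof -
  have path: "fold mutate v \<Sigma> = fold mutate (rev u @ v) (fold mutate u \<Sigma>)" for u v
    using fold_mutate_rev[OF g, of u] by simp
  obtain L0 where L0: "seed_tri L0 (fold mutate t\<^sub>0 \<Sigma>)"
    using seed_tri_transfer[OF L, of "rev w @ t\<^sub>0"] path[of t\<^sub>0 w] by auto
  show ?thesis
    using denominator_injective[OF L0, of "rev t\<^sub>0 @ t" k "rev t\<^sub>0 @ s" l] d path[of t t\<^sub>0] path[of s t\<^sub>0]
    by (simp add: seed_at_def)
qed

section \<open>Orienting the Dynkin path\<close>

definition dynkin_matrix :: "(nat \<Rightarrow> nat \<Rightarrow> nat \<Rightarrow> int) \<Rightarrow> ('n::finite \<Rightarrow> nat) \<Rightarrow> 'n int_matrix \<Rightarrow> bool" where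
  "dynkin_matrix c \<sigma> B \<longleftrightarrow> (\<forall>i j. i \<noteq> j \<longrightarrow> \<bar>B $ i $ j\<bar> = - c CARD('n) (\<sigma> i) (\<sigma> j))"

definition path_cartan :: "nat \<Rightarrow> (nat \<Rightarrow> nat \<Rightarrow> nat \<Rightarrow> int) \<Rightarrow> bool" where
  "path_cartan n c \<longleftrightarrow> (\<forall>p q. p \<noteq> q \<longrightarrow> c n p q \<noteq> 0 \<longleftrightarrow> q = Suc p \<or> p = Suc q)"

lemma path_cartan_ABC: "path_cartan n cartan_A" "path_cartan n cartan_B" "path_cartan n cartan_C"
  by (auto simp: path_cartan_def cartan_A_def cartan_B_def cartan_C_def)

text \<open>Mutation at a vertex all of whose arrows point the same way only reverses these arrows.
  Repeating this moves a wrongly oriented edge of the path down to its end, where it disappears;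
  the sum of the positions of the wrong edges decreases.\<close>

lemma orient_path:
  fixes \<sigma> :: "'n::{finite,linorder} \<Rightarrow> nat"
  assumes \<sigma>: "inj \<sigma>" "\<And>i. \<sigma> i \<ge> 1" and c: "path_cartan CARD('n) c"
  shows "good_seed \<Sigma> \<Longrightarrow> dynkin_matrix c \<sigma> (fst \<Sigma>) \<Longrightarrow>
    \<exists>w. dynkin_matrix c \<sigma> (fst (fold mutate w \<Sigma>)) \<and>
      (\<forall>i j. Suc (\<sigma> i) = \<sigma> j \<longrightarrow> fst (fold mutate w \<Sigma>) $ i $ j > 0)"
proof (induction "\<Sum>i | \<exists>j. Suc (\<sigma> i) = \<sigma> j \<and> fst \<Sigma> $ i $ j < 0. \<sigma> i" arbitrary: \<Sigma> rule: less_induct)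
  case (less \<Sigma>)
  define B where "B = fst \<Sigma>"
  define S where "S = (\<lambda>B :: 'n int_matrix. {i. \<exists>j. Suc (\<sigma> i) = \<sigma> j \<and> B $ i $ j < 0})"
  obtain u where u: "skew_by u B" using less.prems(1) unfolding good_seed_def B_def by blast
  have sgn: "B $ i $ j > 0 \<longleftrightarrow> B $ j $ i < 0" for i j
  proof -
    have up: "u i > 0" "u j > 0" and eq: "u i * B $ i $ j = - (u j * B $ j $ i)"
      using u unfolding skew_by_def by blast+
    have "B $ i $ j > 0 \<longleftrightarrow> u i * B $ i $ j > 0" using up(1) by (simp add: zero_less_mult_iff)
    moreover have "B $ j $ i < 0 \<longleftrightarrow> u j * B $ j $ i < 0" using up(2) by (simp add: mult_less_0_iff)
    ultimately show ?thesis using eq by linarith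
  qed
  have adj: "B $ i $ j \<noteq> 0 \<longleftrightarrow> \<sigma> j = Suc (\<sigma> i) \<or> \<sigma> i = Suc (\<sigma> j)" if "i \<noteq> j" for i j
  proof -
    have "\<sigma> i \<noteq> \<sigma> j" using that \<sigma>(1) by (auto dest: injD)
    then have "c CARD('n) (\<sigma> i) (\<sigma> j) \<noteq> 0 \<longleftrightarrow> \<sigma> j = Suc (\<sigma> i) \<or> \<sigma> i = Suc (\<sigma> j)"
      using c unfolding path_cartan_def by blast
    moreover have "\<bar>B $ i $ j\<bar> = - c CARD('n) (\<sigma> i) (\<sigma> j)"
      using less.prems(2) that unfolding dynkin_matrix_def B_def by blast
    then have "B $ i $ j \<noteq> 0 \<longleftrightarrow> c CARD('n) (\<sigma> i) (\<sigma> j) \<noteq> 0" by linarith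
    ultimately show ?thesis by blast
  qed
  have diag: "B $ i $ i = 0" for i using skew_by_diag[OF u] .
  show ?case
  proof (cases "S B = {}")
    case True
    have "B $ i $ j > 0" if "Suc (\<sigma> i) = \<sigma> j" for i j
    proof -
      have "\<not> B $ i $ j < 0" using True that unfolding S_def by blast
      moreover have "B $ i $ j \<noteq> 0" using adj[of i j] that by (cases "i = j") auto
      ultimately show ?thesis by linarith
    qed
    then show ?thesis using less.prems(2) by (intro exI[of _ "[]"]) (simp add: B_def)
  next
    case False
    \<comment> \<open>\<open>k\<close> starts the lowest wrong edge. The edge below it is oriented
      correctly, so every entry in column k is nonnegative and mutation only changes signs.\<close>
    define k where "k = arg_min_on \<sigma> (S B)"
    have k: "k \<in> S B" "\<And>i. i \<in> S B \<Longrightarrow> \<sigma> k \<le> \<sigma> i"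
      unfolding k_def using False arg_min_if_finite[of "S B" \<sigma>] by (auto simp: not_less[symmetric])
    obtain j where j: "Suc (\<sigma> k) = \<sigma> j" "B $ k $ j < 0" using k(1) unfolding S_def by blast
    have col: "B $ i $ k \<ge> 0" for i
    proof (cases "i = k")
      case True then show ?thesis by (simp add: diag)
    next
      case ik: False
      show ?thesis
      proof (rule ccontr)
        assume neg: "\<not> ?thesis"
        then consider "\<sigma> k = Suc (\<sigma> i)" | "\<sigma> i = Suc (\<sigma> k)" using adj[OF ik] by fastforce
        then show False
        proof cases
          case 1
          then have "i \<in> S B" unfolding S_def using neg by (intro CollectI exI[of _ k]) simp
          then show False using k(2)[of i] 1 by simp
        next
          case 2
          then have "i = j" using j(1) \<sigma>(1) by (auto dest: injD)
          then show False using neg sgn[of j k] j(2) by simp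
        qed
      qed
    qed
    then have row: "B $ k $ i \<le> 0" for i using sgn[of k i] col[of i] by linarith
    define B' where "B' = mutate_matrix k B"
    have B': "B' $ a $ b = (if a = k \<or> b = k then - B $ a $ b else B $ a $ b)" for a b
      using col[of a] row[of b] by (auto simp: B'_def mutate_matrix_def pos_part_def max_def)
    have dyn: "dynkin_matrix c \<sigma> B'"
      using less.prems(2) unfolding dynkin_matrix_def B_def[symmetric] by (auto simp: B')
    \<comment> \<open>Only the edge just below \<open>k\<close> can become wrong, and its position
      is one less than that of the edge repaired at \<open>k\<close>.\<close>
    define P where "P = {i. Suc (\<sigma> i) = \<sigma> k}"
    have sub: "S B' \<subseteq> (S B - {k}) \<union> P"
    proof
      fix i assume "i \<in> S B'"
      then obtain j' where j': "Suc (\<sigma> i) = \<sigma> j'" "B' $ i $ j' < 0" unfolding S_def by blast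
      have "i \<noteq> k"
      proof
        assume "i = k"
        then have "j' = j" using j' j \<sigma>(1) by (auto dest: injD)
        then show False using j' j \<open>i = k\<close> by (simp add: B')
      qed
      then show "i \<in> (S B - {k}) \<union> P" using j' by (auto simp: B' S_def P_def split: if_splits)
    qed
    have "sum \<sigma> P < \<sigma> k"
    proof (cases "P = {}")
      case True then show ?thesis using \<sigma>(2)[of k] by simp
    next
      case False
      then obtain i where i: "Suc (\<sigma> i) = \<sigma> k" by (auto simp: P_def)
      then have "P = {i}" unfolding P_def by (auto simp: inj_eq[OF \<sigma>(1), symmetric])
      then show ?thesis using i by simp
    qed
    have "sum \<sigma> (S B') \<le> sum \<sigma> ((S B - {k}) \<union> P)"
      by (rule sum_mono2) (use sub in auto)
    also have "\<dots> \<le> sum \<sigma> (S B - {k}) + sum \<sigma> P"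
      by (subst sum.union_inter[symmetric]) auto
    also have "\<dots> < sum \<sigma> (S B - {k}) + \<sigma> k" using \<open>sum \<sigma> P < \<sigma> k\<close> by simp
    also have "\<dots> = sum \<sigma> (S B)" using k(1) by (simp add: sum.remove[of "S B" k] add.commute)
    finally have less_sum: "sum \<sigma> (S B') < sum \<sigma> (S B)" .
    have f: "fst (mutate k \<Sigma>) = B'" by (simp add: mutate_def B'_def B_def)
    have "\<exists>w. dynkin_matrix c \<sigma> (fst (fold mutate w (mutate k \<Sigma>))) \<and>
      (\<forall>i j. Suc (\<sigma> i) = \<sigma> j \<longrightarrow> fst (fold mutate w (mutate k \<Sigma>)) $ i $ j > 0)"
    proof (rule less.hyps)
      show "(\<Sum>i | \<exists>j. Suc (\<sigma> i) = \<sigma> j \<and> fst (mutate k \<Sigma>) $ i $ j < 0. \<sigma> i)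
          < (\<Sum>i | \<exists>j. Suc (\<sigma> i) = \<sigma> j \<and> fst \<Sigma> $ i $ j < 0. \<sigma> i)"
        using less_sum unfolding f S_def B_def .
      show "good_seed (mutate k \<Sigma>)" by (rule good_seed_mutate[OF less.prems(1)])
      show "dynkin_matrix c \<sigma> (fst (mutate k \<Sigma>))" using dyn f by simp
    qed
    then obtain w where "dynkin_matrix c \<sigma> (fst (fold mutate w (mutate k \<Sigma>)))"
      "\<forall>i j. Suc (\<sigma> i) = \<sigma> j \<longrightarrow> fst (fold mutate w (mutate k \<Sigma>)) $ i $ j > 0" by blast
    then show ?thesis by (intro exI[of _ "k # w"]) simp
  qed
qed

lemma linear_seed:
  fixes \<Sigma> :: "'n::{finite,linorder} seed"
  assumes g: "good_seed \<Sigma>" and type: "cluster_type c \<Sigma>" and c: "path_cartan CARD('n) c"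
  obtains w \<sigma> where "bij_betw \<sigma> (UNIV :: 'n set) {1..CARD('n)}"
    "\<And>i k. fst (fold mutate w \<Sigma>) $ i $ k =
       (if Suc (\<sigma> i) = \<sigma> k then - c CARD('n) (\<sigma> i) (\<sigma> k) else if \<sigma> i = Suc (\<sigma> k) then c CARD('n) (\<sigma> i) (\<sigma> k) else 0)"
proof -
  obtain t \<sigma> where \<sigma>: "bij_betw \<sigma> (UNIV :: 'n set) {1..CARD('n)}"
    and t: "\<And>i j. cartan_counterpart (matrix_at \<Sigma> t) $ i $ j = c CARD('n) (\<sigma> i) (\<sigma> j)"
    using type unfolding cluster_type_def is_cartan_matrix_of_def by blast
  have inj: "inj \<sigma>" using \<sigma> by (simp add: bij_betw_def)
  have ge: "\<sigma> i \<ge> 1" for i using bij_betwE[OF \<sigma>] by auto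
  let ?\<Sigma> = "fold mutate t \<Sigma>"
  have "\<bar>fst ?\<Sigma> $ i $ j\<bar> = - c CARD('n) (\<sigma> i) (\<sigma> j)" if "i \<noteq> j" for i j
    using t[of i j] that by (simp add: cartan_counterpart_def seed_at_def)
  then have "dynkin_matrix c \<sigma> (fst ?\<Sigma>)" by (simp add: dynkin_matrix_def)
  then obtain w where w: "dynkin_matrix c \<sigma> (fst (fold mutate w ?\<Sigma>))"
    "\<And>i j. Suc (\<sigma> i) = \<sigma> j \<Longrightarrow> fst (fold mutate w ?\<Sigma>) $ i $ j > 0"
    using orient_path[OF inj ge c good_seed_fold[OF g]] by blast
  let ?B = "fst (fold mutate w ?\<Sigma>)"
  obtain u where u: "skew_by u ?B"
    using good_seed_fold[OF good_seed_fold[OF g]] unfolding good_seed_def by blast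
  have B: "?B $ i $ k =
       (if Suc (\<sigma> i) = \<sigma> k then - c CARD('n) (\<sigma> i) (\<sigma> k) else if \<sigma> i = Suc (\<sigma> k) then c CARD('n) (\<sigma> i) (\<sigma> k) else 0)" for i k
  proof (cases "i = k")
    case True
    then show ?thesis using skew_by_diag[OF u] by simp
  next
    case False
    have a: "\<bar>?B $ i $ k\<bar> = - c CARD('n) (\<sigma> i) (\<sigma> k)" using w(1) False unfolding dynkin_matrix_def by blast
    have ne: "\<sigma> i \<noteq> \<sigma> k" using False inj by (auto dest: injD)
    consider "Suc (\<sigma> i) = \<sigma> k" | "\<sigma> i = Suc (\<sigma> k)" | "Suc (\<sigma> i) \<noteq> \<sigma> k" "\<sigma> i \<noteq> Suc (\<sigma> k)" by blast
    then show ?thesis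
    proof cases
      case 1 then show ?thesis using a w(2)[OF 1] by simp
    next
      case 2
      have p: "?B $ k $ i > 0" using w(2)[of k i] 2 by simp
      have "u i > 0" "u k > 0" "u i * ?B $ i $ k = - (u k * ?B $ k $ i)" using u unfolding skew_by_def by blast+
      then have "u i * ?B $ i $ k < 0" using mult_pos_pos[OF \<open>u k > 0\<close> p] by linarith
      then have "?B $ i $ k < 0" using \<open>u i > 0\<close> by (simp add: mult_less_0_iff)
      then show ?thesis using a 2 by simp
    next
      case 3
      then have "c CARD('n) (\<sigma> i) (\<sigma> k) = 0" using c ne unfolding path_cartan_def by metis
      then show ?thesis using a 3 by simp
    qed
  qed
  have "fold mutate w ?\<Sigma> = fold mutate (t @ w) \<Sigma>" by simp
  then show thesis using that[OF \<sigma>, of "t @ w"] B by simp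
qed

theorem theorem1p4:
  fixes \<Sigma> :: "'n::{finite,linorder} seed"
    and t\<^sub>0 t s :: "'n list"
    and k l :: "(nat, 'n) vec"
  assumes "labeled_seed \<Sigma>"
    and "cluster_type cartan_A \<Sigma> \<or> cluster_type cartan_B \<Sigma> \<or> cluster_type cartan_C \<Sigma>"
    and "t\<^sub>0 \<in> regular_tree" and "t \<in> regular_tree" and "s \<in> regular_tree"
    and "cluster_monomial (cluster_at \<Sigma> t) k \<noteq> cluster_monomial (cluster_at \<Sigma> s) l"
  shows "monomial_denominator_vector (cluster_at \<Sigma> t\<^sub>0) (cluster_at \<Sigma> t) k
       \<noteq> monomial_denominator_vector (cluster_at \<Sigma> t\<^sub>0) (cluster_at \<Sigma> s) l"
proof
  assume d: "monomial_denominator_vector (cluster_at \<Sigma> t\<^sub>0) (cluster_at \<Sigma> t) k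
       = monomial_denominator_vector (cluster_at \<Sigma> t\<^sub>0) (cluster_at \<Sigma> s) l"
  have g: "good_seed \<Sigma>" by (rule labeled_seed_imp_good_seed[OF assms(1)])
  have indep: "alg_indep (snd (fold mutate w \<Sigma>))" for w
    using good_seed_fold[OF g] unfolding good_seed_def by blast
  consider "cluster_type cartan_A \<Sigma>" | "cluster_type cartan_B \<Sigma>" | "cluster_type cartan_C \<Sigma>"
    using assms(2) by blast
  then have "cluster_monomial (cluster_at \<Sigma> t) k = cluster_monomial (cluster_at \<Sigma> s) l"
  proof cases
    case 1
    obtain w \<sigma> where \<sigma>: "bij_betw \<sigma> (UNIV :: 'n set) {1..CARD('n)}"
      and B: "\<And>i k. fst (fold mutate w \<Sigma>) $ i $ k = (if Suc (\<sigma> i) = \<sigma> k then - cartan_A CARD('n) (\<sigma> i) (\<sigma> k)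
        else if \<sigma> i = Suc (\<sigma> k) then cartan_A CARD('n) (\<sigma> i) (\<sigma> k) else 0)"
      using linear_seed[OF g 1 path_cartan_ABC(1)] by metis
    \<comment> \<open>The model is anchored at the linearly oriented seed, whose cluster supplies
      the lengths of the fan.\<close>
    interpret type_A \<sigma> "snd (fold mutate w \<Sigma>)"
      by unfold_locales (use \<sigma> indep in auto)
    have "seed_tri fan (fst (fold mutate w \<Sigma>), snd (fold mutate w \<Sigma>))"
      by (rule fan_seed) (auto simp: B linear_quiver_def cartan_A_def)
    then show ?thesis using denominator_injective_pattern[OF g _ d, of fan w] by simp
  next
    case 2
    obtain w \<sigma> where \<sigma>: "bij_betw \<sigma> (UNIV :: 'n set) {1..CARD('n)}"
      and B: "\<And>i k. fst (fold mutate w \<Sigma>) $ i $ k = (if Suc (\<sigma> i) = \<sigma> k then - cartan_B CARD('n) (\<sigma> i) (\<sigma> k)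
        else if \<sigma> i = Suc (\<sigma> k) then cartan_B CARD('n) (\<sigma> i) (\<sigma> k) else 0)"
      using linear_seed[OF g 2 path_cartan_ABC(2)] by metis
    interpret type_BC \<sigma> "snd (fold mutate w \<Sigma>)" 1
      by unfold_locales (use \<sigma> indep in auto)
    have "M.seed_tri fan (fst (fold mutate w \<Sigma>), snd (fold mutate w \<Sigma>))"
    proof (rule fan_seed)
      fix i k
      show "fst (fold mutate w \<Sigma>) $ i $ k * int (if k = last then 1 else 1) =
          int (if i = last then 1 else 1) * (linear_quiver \<sigma> i k * (if k = last then 2 else 1))"
        using \<sigma>_last[of i] \<sigma>_last[of k] \<sigma>_range(2)[of i]
        by (auto simp: B linear_quiver_def cartan_A_def cartan_B_def)
    qed
    then show ?thesis using M.denominator_injective_pattern[OF g _ d, of fan w] by simp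
  next
    case 3
    obtain w \<sigma> where \<sigma>: "bij_betw \<sigma> (UNIV :: 'n set) {1..CARD('n)}"
      and B: "\<And>i k. fst (fold mutate w \<Sigma>) $ i $ k = (if Suc (\<sigma> i) = \<sigma> k then - cartan_C CARD('n) (\<sigma> i) (\<sigma> k)
        else if \<sigma> i = Suc (\<sigma> k) then cartan_C CARD('n) (\<sigma> i) (\<sigma> k) else 0)"
      using linear_seed[OF g 3 path_cartan_ABC(3)] by metis
    interpret type_BC \<sigma> "snd (fold mutate w \<Sigma>)" 2
      by unfold_locales (use \<sigma> indep in auto)
    have "M.seed_tri fan (fst (fold mutate w \<Sigma>), snd (fold mutate w \<Sigma>))"
    proof (rule fan_seed)
      fix i k
      show "fst (fold mutate w \<Sigma>) $ i $ k * int (if k = last then 2 else 1) =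
          int (if i = last then 2 else 1) * (linear_quiver \<sigma> i k * (if k = last then 2 else 1))"
        using \<sigma>_last[of i] \<sigma>_last[of k] \<sigma>_range(2)[of i] \<sigma>_range(2)[of k]
        by (auto simp: B linear_quiver_def cartan_A_def cartan_C_def)
    qed
    then show ?thesis using M.denominator_injective_pattern[OF g _ d, of fan w] by simp
  qed
  then show False using assms(6) by simp
qed

end
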